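(* Let $G\colon\mathbb{R}^n\times\mathbb{R}^n\times[0,\infty)\to[0,\infty)$ be a generalized Young function satisfying (H1), (H2) and (H3) (as defined in the context). Let $u\in C^2_c(\mathbb{R}^n)$. Then $$\lim_{s\uparrow 1}(1-s)\,\mathcal{J}_{s,G}(u)=\int_{\mathbb{R}^n}H_0(x,|\nabla u(x)|)\,dx,$$ where $$\mathcal{J}_{s,G}(u)=\iint_{\mathbb{R}^n\times\mathbb{R}^n}G\left(x,y,\frac{|u(x)-u(y)|}{|x-y|^s}\right)\frac{dx\,dy}{|x-y|^n}$$ and $$H_0(x,t)=\int_0^1\int_{\mathbb{S}^{n-1}}G(x,x,t|w_n|r)\,dS_w\,\frac{dr}{r}.$$
   Context: Let $n\ge 1$ be an integer and $s\in(0,1)$. A generalized Young function is a function $G\colon\mathbb{R}^n\times\mathbb{R}^n\times[0,\infty)\to[0,\infty)$ of the form $G(x,y,t)=\int_0^t g(x,y,\tau)\,d\tau$, where $g\colon\mathbb{R}^n\times\mathbb{R}^n\times[0,\infty)\to[0,\infty)$ satisfies, for every $(x,y)$: (i) $g(x,y,0)=0$ and $g(x,y,t)>0$ for $t>0$; (ii) $t\mapsto g(x,y,t)$ is nondecreasing on $[0,\infty)$; (iii) $t\mapsto g(x,y,t)$ is right continuous on $[0,\infty)$ and $\lim_{t\to\infty}g(x,y,t)=\infty$. It is understood that $(x,y)\mapsto G(x,y,t)$ is measurable for each $t$. Hypotheses: (H1) there exist constants $0<C_1\le C_2<\infty$ such that $C_1\le G(x,y,1)\le C_2$ for all $x,y\in\mathbb{R}^n$;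 (H2) for every $x\in\mathbb{R}^n$ and $t\ge0$, the map $y\mapsto G(x,y,t)$ is continuous on $\mathbb{R}^n$; (H3) there exist constants $1<p^-\le p^+<\infty$ such that $p^-\le \frac{t\,g(x,y,t)}{G(x,y,t)}\le p^+$ for all $x,y\in\mathbb{R}^n$ and $t>0$. $\mathbb{S}^{n-1}$ is the unit sphere of $\mathbb{R}^n$, $dS$ is its $(n-1)$-dimensional Hausdorff (surface) measure, and $w_n$ is the $n$-th coordinate of $w\in\mathbb{S}^{n-1}$. $C^2_c(\mathbb{R}^n)$ is the space of real-valued compactly supported $C^2$ functions. *)

theory Defs
  imports "HOL-Analysis.Analysis"
begin

subsection \<open>Hausdorff measure\<close>

text \<open>
  The weight is \<open>\<omega>\<^sub>d (diam C / 2)\<^sup>d\<close>, with \<open>\<omega>\<^sub>d\<close> the volume of the unit ball of \<open>\<real>\<^sup>d\<close>; with this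
  normalisation the \<open>d\<close>-dimensional Hausdorff measure on \<open>\<real>\<^sup>d\<close> is Lebesgue measure. The empty set is
  treated separately because \<open>0 ^ 0 = 1\<close>: for \<open>d = 0\<close> nonempty sets have weight \<open>1\<close> and the measure
  is counting measure.
\<close>

definition hausdorff_weight :: "nat \<Rightarrow> 'a::metric_space set \<Rightarrow> ennreal" where
  "hausdorff_weight d C =
     (if C = {} then 0 else ennreal (unit_ball_vol (real d) * (diameter C / 2) ^ d))"

text \<open>
  Boundedness is required explicitly, as \<^const>\<open>diameter\<close> is real-valued and unspecified on unbounded
  sets.
\<close>

definition hausdorff_pre :: "nat \<Rightarrow> real \<Rightarrow> 'a::metric_space set \<Rightarrow> ennreal" where
  "hausdorff_pre d \<delta> A =
     (INF C \<in> {C :: nat \<Rightarrow> 'a set. A \<subseteq> (\<Union>i. C i) \<and> (\<forall>i. bounded (C i) \<and> diameter (C i) \<le> \<delta>)}.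
        \<Sum>i. hausdorff_weight d (C i))"

definition hausdorff_outer :: "nat \<Rightarrow> 'a::metric_space set \<Rightarrow> ennreal" where
  "hausdorff_outer d A = (SUP \<delta> \<in> {0<..}. hausdorff_pre d \<delta> A)"

definition hausdorff_measure :: "nat \<Rightarrow> 'a::metric_space measure" where
  "hausdorff_measure d = measure_of UNIV (sets borel) (hausdorff_outer d)"

lemma space_hausdorff_measure [simp]: "space (hausdorff_measure d) = UNIV"
  by (simp add: hausdorff_measure_def)

lemma sets_hausdorff_measure [simp, measurable_cong]: "sets (hausdorff_measure d) = sets borel"
  unfolding hausdorff_measure_def
  by (metis sets.sets_measure_of_eq space_borel)

text \<open>
  A function that is not countably additive would be turned into the zero measure by
  \<^const>\<open>measure_of\<close>; the following facts show that this does not happen here.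
\<close>

lemma hausdorff_weight_empty [simp]: "hausdorff_weight d {} = 0"
  by (simp add: hausdorff_weight_def)

lemma hausdorff_weight_mono:
  assumes "A \<subseteq> B" "bounded B"
  shows "hausdorff_weight d A \<le> hausdorff_weight d B"
proof -
  have "diameter A \<le> diameter B" using assms by (rule diameter_subset)
  moreover have "0 \<le> diameter A" using assms by (meson bounded_subset diameter_ge_0)
  ultimately show ?thesis using assms
    by (auto simp: hausdorff_weight_def intro!: ennreal_leI mult_left_mono power_mono)
qed

lemma hausdorff_pre_le:
  assumes "A \<subseteq> (\<Union>i. C i)" "\<And>i. bounded (C i)" "\<And>i. diameter (C i) \<le> \<delta>"
  shows "hausdorff_pre d \<delta> A \<le> (\<Sum>i. hausdorff_weight d (C i))"
  unfolding hausdorff_pre_def by (rule INF_lower) (use assms in auto)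

lemma hausdorff_pre_mono: "A \<subseteq> B \<Longrightarrow> hausdorff_pre d \<delta> A \<le> hausdorff_pre d \<delta> B"
  unfolding hausdorff_pre_def by (rule INF_superset_mono) auto

lemma hausdorff_pre_antimono: "\<delta> \<le> \<delta>' \<Longrightarrow> hausdorff_pre d \<delta>' A \<le> hausdorff_pre d \<delta> A"
  unfolding hausdorff_pre_def by (rule INF_superset_mono) (auto intro: order_trans)

lemma hausdorff_pre_le_outer: "0 < \<delta> \<Longrightarrow> hausdorff_pre d \<delta> A \<le> hausdorff_outer d A"
  unfolding hausdorff_outer_def by (rule SUP_upper) auto

lemma hausdorff_outer_empty [simp]: "hausdorff_outer d {} = 0"
proof -
  have "hausdorff_pre d \<delta> {} \<le> 0" if "0 < \<delta>" for \<delta>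
    using hausdorff_pre_le[of "{}" "\<lambda>_. {}" \<delta> d] that by simp
  then have "hausdorff_outer d {} \<le> 0"
    unfolding hausdorff_outer_def by (intro SUP_least) auto
  then show ?thesis by simp
qed

lemma hausdorff_outer_mono: "A \<subseteq> B \<Longrightarrow> hausdorff_outer d A \<le> hausdorff_outer d B"
  unfolding hausdorff_outer_def by (intro SUP_mono) (auto intro: hausdorff_pre_mono)

lemma hausdorff_pre_subadditive:
  fixes A :: "nat \<Rightarrow> 'a::metric_space set"
  shows "hausdorff_pre d \<delta> (\<Union>i. A i) \<le> (\<Sum>n. hausdorff_pre d \<delta> (A n))"
proof (rule ennreal_le_epsilon)
  fix e :: real assume "0 < e" "(\<Sum>n. hausdorff_pre d \<delta> (A n)) < top"
  then have *: "hausdorff_pre d \<delta> (A n) < hausdorff_pre d \<delta> (A n) + e * (1/2)^Suc n" for n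
    by (auto simp add: less_top dest!: ennreal_suminf_lessD)
  have "\<exists>C. A n \<subseteq> (\<Union>i. C i) \<and> (\<forall>i. bounded (C i) \<and> diameter (C i) \<le> \<delta>) \<and>
      (\<Sum>i. hausdorff_weight d (C i)) \<le> hausdorff_pre d \<delta> (A n) + e * (1/2)^Suc n" for n
    using *[of n] by (subst (asm) (1) hausdorff_pre_def) (auto simp: INF_less_iff intro: less_imp_le)
  then obtain B where B: "\<And>n. A n \<subseteq> (\<Union>i. B n i)" "\<And>n i. bounded (B n i)"
      "\<And>n i. diameter (B n i) \<le> \<delta>"
      "\<And>n. (\<Sum>i. hausdorff_weight d (B n i)) \<le> hausdorff_pre d \<delta> (A n) + e * (1/2)^Suc n"
    by metis
  define C where "C = case_prod B o prod_decode"
  have "(\<Union>i. A i) \<subseteq> (\<Union>i. C i)"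
    using B(1) by (auto simp add: C_def subset_eq) (metis prod.case prod_encode_inverse)
  then have "hausdorff_pre d \<delta> (\<Union>i. A i) \<le> (\<Sum>i. hausdorff_weight d (C i))"
    by (rule hausdorff_pre_le) (auto simp: C_def B split: prod.split)
  also have "\<dots> = (\<Sum>i. (case_prod (\<lambda>n i. hausdorff_weight d (B n i)) o prod_decode) i)"
    by (simp add: C_def comp_def split_beta)
  also have "\<dots> = (\<Sum>n. \<Sum>i. hausdorff_weight d (B n i))"
    unfolding comp_def by (intro suminf_ennreal_2dimen) auto
  also have "\<dots> \<le> (\<Sum>n. hausdorff_pre d \<delta> (A n) + e * (1/2) ^ Suc n)"
    by (intro suminf_le allI B) auto
  also have "\<dots> = (\<Sum>n. hausdorff_pre d \<delta> (A n)) + (\<Sum>n. ennreal e * ennreal ((1/2) ^ Suc n))"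
    using \<open>0 < e\<close> by (subst suminf_add[symmetric])
      (auto simp del: ennreal_suminf_cmult simp add: ennreal_mult[symmetric])
  also have "\<dots> = (\<Sum>n. hausdorff_pre d \<delta> (A n)) + e"
    unfolding ennreal_suminf_cmult
    by (subst suminf_ennreal_eq[OF zero_le_power power_half_series]) auto
  finally show "hausdorff_pre d \<delta> (\<Union>i. A i) \<le> (\<Sum>n. hausdorff_pre d \<delta> (A n)) + e" .
qed

lemma hausdorff_outer_subadditive:
  "hausdorff_outer d (\<Union>i. A i) \<le> (\<Sum>n. hausdorff_outer d (A (n::nat)))"
  unfolding hausdorff_outer_def[of d "\<Union>i. A i"]
proof (rule SUP_least)
  fix \<delta> :: real assume "\<delta> \<in> {0<..}"
  have "hausdorff_pre d \<delta> (\<Union>i. A i) \<le> (\<Sum>n. hausdorff_pre d \<delta> (A n))"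
    by (rule hausdorff_pre_subadditive)
  also have "\<dots> \<le> (\<Sum>n. hausdorff_outer d (A n))"
    using \<open>\<delta> \<in> {0<..}\<close> by (intro suminf_le hausdorff_pre_le_outer) auto
  finally show "hausdorff_pre d \<delta> (\<Union>i. A i) \<le> (\<Sum>n. hausdorff_outer d (A n))" .
qed

lemma outer_measure_space_hausdorff: "outer_measure_space UNIV (hausdorff_outer d)"
  unfolding outer_measure_space_def positive_def increasing_def countably_subadditive_def
  by (auto intro: hausdorff_outer_mono hausdorff_outer_subadditive)

lemma hausdorff_outer_Un: "hausdorff_outer d (A \<union> B) \<le> hausdorff_outer d A + hausdorff_outer d B"
proof -
  have eq: "(\<Union>i. if i = 0 then A else if i = Suc 0 then B else {}) = A \<union> B"
    by (auto split: if_splits)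
  have "hausdorff_outer d (A \<union> B) \<le>
      (\<Sum>n. hausdorff_outer d (if n = 0 then A else if n = Suc 0 then B else {}))"
    using hausdorff_outer_subadditive[of d "\<lambda>i. if i = 0 then A else if i = Suc 0 then B else {}"]
    unfolding eq .
  also have "\<dots> = hausdorff_outer d A + hausdorff_outer d B"
    by (subst suminf_finite[of "{0, Suc 0}"]) auto
  finally show ?thesis .
qed

lemma hausdorff_outer_separated:
  fixes A B :: "'a::metric_space set"
  assumes "0 < e" and sep: "\<And>a b. a \<in> A \<Longrightarrow> b \<in> B \<Longrightarrow> e \<le> dist a b"
  shows "hausdorff_outer d A + hausdorff_outer d B \<le> hausdorff_outer d (A \<union> B)"
proof -
  have split: "hausdorff_pre d \<delta> A + hausdorff_pre d \<delta> B \<le> hausdorff_pre d \<delta> (A \<union> B)"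
    if "0 < \<delta>" "\<delta> < e" for \<delta>
    unfolding hausdorff_pre_def[of d \<delta> "A \<union> B"]
  proof (safe intro!: INF_greatest)
    fix C :: "nat \<Rightarrow> 'a set"
    assume C: "A \<union> B \<subseteq> (\<Union>i. C i)" "\<forall>i. bounded (C i) \<and> diameter (C i) \<le> \<delta>"
    have small: "hausdorff_weight d (C i \<inter> A) + hausdorff_weight d (C i \<inter> B) \<le> hausdorff_weight d (C i)"
      for i
    proof -
      have "C i \<inter> A = {} \<or> C i \<inter> B = {}"
      proof (rule ccontr)
        assume "\<not> ?thesis"
        then obtain a b where ab: "a \<in> C i" "a \<in> A" "b \<in> C i" "b \<in> B" by auto
        have "dist a b \<le> diameter (C i)"
          using C ab by (intro diameter_bounded_bound) auto
        also have "\<dots> < e" using C(2) that by (meson le_less_trans)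
        finally show False using sep ab by force
      qed
      then show ?thesis using C(2) by (auto intro!: hausdorff_weight_mono)
    qed
    have diam: "diameter (C i \<inter> S) \<le> \<delta>" "bounded (C i \<inter> S)" for i S
      using C(2) diameter_subset[of "C i \<inter> S" "C i"] by (auto intro: order_trans bounded_Int)
    have "hausdorff_pre d \<delta> A + hausdorff_pre d \<delta> B \<le>
        (\<Sum>i. hausdorff_weight d (C i \<inter> A)) + (\<Sum>i. hausdorff_weight d (C i \<inter> B))"
      using C(1) by (intro add_mono hausdorff_pre_le diam) auto
    also have "\<dots> = (\<Sum>i. hausdorff_weight d (C i \<inter> A) + hausdorff_weight d (C i \<inter> B))"
      by (intro suminf_add) auto
    also have "\<dots> \<le> (\<Sum>i. hausdorff_weight d (C i))"
      by (intro suminf_le small) auto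
    finally show "hausdorff_pre d \<delta> A + hausdorff_pre d \<delta> B \<le> (\<Sum>i. hausdorff_weight d (C i))" .
  qed
  have both: "hausdorff_pre d \<delta> A + hausdorff_pre d \<delta>' B \<le> hausdorff_outer d (A \<union> B)"
    if "0 < \<delta>" "0 < \<delta>'" for \<delta> \<delta>'
  proof -
    define \<eta> where "\<eta> = min (min \<delta> \<delta>') (e / 2)"
    have \<eta>: "0 < \<eta>" "\<eta> < e" "\<eta> \<le> \<delta>" "\<eta> \<le> \<delta>'" using that \<open>0 < e\<close> by (auto simp: \<eta>_def)
    have "hausdorff_pre d \<delta> A + hausdorff_pre d \<delta>' B \<le> hausdorff_pre d \<eta> A + hausdorff_pre d \<eta> B"
      using \<eta> by (intro add_mono hausdorff_pre_antimono)
    also have "\<dots> \<le> hausdorff_outer d (A \<union> B)"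
      using split[OF \<eta>(1,2)] hausdorff_pre_le_outer[OF \<eta>(1)] by (rule order_trans)
    finally show ?thesis .
  qed
  have ne: "{0::real<..} \<noteq> {}" by (metis greaterThan_iff empty_iff zero_less_one)
  have "hausdorff_outer d A + hausdorff_outer d B =
      (SUP \<delta>\<in>{0<..}. hausdorff_pre d \<delta> A + hausdorff_outer d B)"
    unfolding hausdorff_outer_def[of d A] by (rule ennreal_SUP_add_left[symmetric, OF ne])
  also have "\<dots> \<le> hausdorff_outer d (A \<union> B)"
  proof (rule SUP_least)
    fix \<delta> :: real assume "\<delta> \<in> {0<..}"
    have "hausdorff_pre d \<delta> A + hausdorff_outer d B =
        (SUP \<delta>'\<in>{0<..}. hausdorff_pre d \<delta> A + hausdorff_pre d \<delta>' B)"
      unfolding hausdorff_outer_def[of d B] by (rule ennreal_SUP_add_right[OF ne])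
    also have "\<dots> \<le> hausdorff_outer d (A \<union> B)"
      using \<open>\<delta> \<in> {0<..}\<close> both by (intro SUP_least) auto
    finally show "hausdorff_pre d \<delta> A + hausdorff_outer d B \<le> hausdorff_outer d (A \<union> B)" .
  qed
  finally show ?thesis .
qed

lemma hausdorff_outer_sum_separated:
  fixes R :: "nat \<Rightarrow> 'a::metric_space set"
  assumes sep: "\<And>i j. i < j \<Longrightarrow> j < n \<Longrightarrow> \<exists>e>0. \<forall>a\<in>R i. \<forall>b\<in>R j. e \<le> dist a b"
  shows "(\<Sum>i<n. hausdorff_outer d (R i)) \<le> hausdorff_outer d (\<Union>i<n. R i)"
  using sep
proof (induction n)
  case (Suc n)
  have "\<exists>e>0. \<forall>a\<in>(\<Union>i<m. R i). \<forall>b\<in>R n. e \<le> dist a b" if "m \<le> n" for m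
    using that
  proof (induction m)
    case (Suc m)
    then obtain e where e: "e > 0" "\<forall>a\<in>(\<Union>i<m. R i). \<forall>b\<in>R n. e \<le> dist a b" by auto
    obtain e' where e': "e' > 0" "\<forall>a\<in>R m. \<forall>b\<in>R n. e' \<le> dist a b"
      using Suc.prems \<open>\<And>i j. \<lbrakk>i < j; j < Suc n\<rbrakk> \<Longrightarrow> _\<close>[of m n] by auto
    show ?case
      using e e' by (intro exI[of _ "min e e'"]) (auto simp: lessThan_Suc min_le_iff_disj)
  qed (auto intro: exI[of _ 1])
  from this[of n] obtain e where e: "e > 0" "\<forall>a\<in>(\<Union>i<n. R i). \<forall>b\<in>R n. e \<le> dist a b" by auto
  have "(\<Sum>i<Suc n. hausdorff_outer d (R i)) \<le> hausdorff_outer d (\<Union>i<n. R i) + hausdorff_outer d (R n)"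
    using Suc by (auto intro!: add_mono)
  also have "\<dots> \<le> hausdorff_outer d ((\<Union>i<n. R i) \<union> R n)"
    by (rule hausdorff_outer_separated[of e]) (use e in auto)
  also have "(\<Union>i<n. R i) \<union> R n = (\<Union>i<Suc n. R i)"
    by (auto simp: lessThan_Suc)
  finally show ?case .
qed simp

lemma hausdorff_outer_closed:
  fixes F A :: "'a::metric_space set"
  assumes "closed F"
  shows "hausdorff_outer d (A \<inter> F) + hausdorff_outer d (A - F) \<le> hausdorff_outer d A"
proof (cases "F = {} \<or> hausdorff_outer d A = top")
  case False
  then have F: "F \<noteq> {}" and fin: "hausdorff_outer d A < top" by (auto simp: less_top)
  define S where "S n = {x \<in> A. inverse (Suc n) \<le> infdist x F}" for n
  define R where "R n = S (Suc n) - S n" for n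
  have SF: "hausdorff_outer d (A \<inter> F) + hausdorff_outer d (S n) \<le> hausdorff_outer d A" for n
  proof -
    have "hausdorff_outer d (A \<inter> F) + hausdorff_outer d (S n) \<le> hausdorff_outer d (A \<inter> F \<union> S n)"
    proof (rule hausdorff_outer_separated[of "inverse (Suc n)"])
      fix a b assume "a \<in> A \<inter> F" "b \<in> S n"
      then show "inverse (Suc n) \<le> dist a b"
        using infdist_le[of a F b] by (auto simp: S_def dist_commute)
    qed auto
    also have "\<dots> \<le> hausdorff_outer d A" by (rule hausdorff_outer_mono) (auto simp: S_def)
    finally show ?thesis .
  qed
  have sepR: "\<exists>e>0. \<forall>a\<in>R i. \<forall>b\<in>R j. e \<le> dist a b" if "Suc i < j" for i j
  proof (intro exI conjI ballI)
    show "0 < inverse (real (Suc (Suc i))) - inverse (real (Suc j))"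
      using that by (simp add: less_imp_inverse_less)
    fix a b assume ab: "a \<in> R i" "b \<in> R j"
    then have "inverse (real (Suc (Suc i))) \<le> infdist a F" "infdist b F < inverse (real (Suc j))"
      by (auto simp: R_def S_def)
    moreover have "infdist a F \<le> infdist b F + dist a b" by (rule infdist_triangle)
    ultimately show "inverse (real (Suc (Suc i))) - inverse (real (Suc j)) \<le> dist a b" by linarith
  qed
  have half: "(\<Sum>i<n. hausdorff_outer d (R (2 * i + c))) \<le> hausdorff_outer d A" for n c
  proof -
    have "(\<Sum>i<n. hausdorff_outer d (R (2 * i + c))) \<le> hausdorff_outer d (\<Union>i<n. R (2 * i + c))"
      by (rule hausdorff_outer_sum_separated) (auto intro!: sepR)
    also have "\<dots> \<le> hausdorff_outer d A" by (rule hausdorff_outer_mono) (auto simp: R_def S_def)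
    finally show ?thesis .
  qed
  have "(\<Sum>i<n. hausdorff_outer d (R i)) \<le> hausdorff_outer d A + hausdorff_outer d A" for n
  proof -
    have "(\<Sum>i<n. hausdorff_outer d (R i)) \<le> (\<Sum>i<2 * n. hausdorff_outer d (R i))"
      by (rule sum_mono2) auto
    also have "\<dots> = (\<Sum>i<n. hausdorff_outer d (R (2 * i + 0))) + (\<Sum>i<n. hausdorff_outer d (R (2 * i + 1)))"
      by (induction n) (auto simp: algebra_simps)
    also have "\<dots> \<le> hausdorff_outer d A + hausdorff_outer d A"
      by (intro add_mono half)
    finally show ?thesis .
  qed
  then have "(\<Sum>i. hausdorff_outer d (R i)) \<le> hausdorff_outer d A + hausdorff_outer d A"
    by (intro suminf_le_const) auto
  also have "\<dots> < top" using fin by (simp add: ennreal_add_less_top)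
  finally have sumfin: "(\<Sum>i. hausdorff_outer d (R i)) \<noteq> top" by simp
  have tail0: "(\<lambda>n. \<Sum>i. hausdorff_outer d (R (i + n))) \<longlonglongrightarrow> 0"
  proof -
    have f: "hausdorff_outer d (R i) \<noteq> top" for i
      using sumfin ennreal_suminf_lessD less_top by blast
    define r where "r i = enn2real (hausdorff_outer d (R i))" for i
    have r: "hausdorff_outer d (R i) = ennreal (r i)" "0 \<le> r i" for i
      using f by (auto simp: r_def less_top)
    have sr: "summable r" using sumfin r by (auto intro!: summable_suminf_not_top)
    have "(\<lambda>n. ennreal (\<Sum>i. r (i + n))) \<longlonglongrightarrow> ennreal 0"
      by (intro tendsto_ennrealI suminf_exist_split2 sr)
    moreover have "(\<Sum>i. hausdorff_outer d (R (i + n))) = ennreal (\<Sum>i. r (i + n))" for n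
      unfolding r using sr r by (intro suminf_ennreal2) (auto simp: summable_iff_shift)
    ultimately show ?thesis by simp
  qed
  have "hausdorff_outer d (A \<inter> F) + hausdorff_outer d (A - F) \<le>
      hausdorff_outer d A + (\<Sum>i. hausdorff_outer d (R (i + n)))" for n
  proof -
    have "A - F \<subseteq> S n \<union> (\<Union>i. R (i + n))"
    proof
      fix x assume x: "x \<in> A - F"
      then have "0 < infdist x F"
        using F \<open>closed F\<close> by (metis DiffD2 infdist_pos_not_in_closed)
      then obtain m where m: "inverse (real (Suc m)) < infdist x F" using reals_Archimedean by blast
      define k where "k = (LEAST k. x \<in> S k)"
      have xm: "x \<in> S m" using x m by (auto simp: S_def)
      then have k: "x \<in> S k" "\<And>j. j < k \<Longrightarrow> x \<notin> S j"
        unfolding k_def by (auto intro: LeastI dest: not_less_Least)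
      show "x \<in> S n \<union> (\<Union>i. R (i + n))"
      proof (cases "k \<le> n")
        case True
        have "inverse (real (Suc n)) \<le> inverse (real (Suc k))" using True by (intro le_imp_inverse_le) auto
        also have "\<dots> \<le> infdist x F" using k(1) by (auto simp: S_def)
        finally have "x \<in> S n" using x by (auto simp: S_def)
        then show ?thesis by simp
      next
        case False
        then have "x \<in> R ((k - 1 - n) + n)" using k by (auto simp: R_def)
        then show ?thesis by blast
      qed
    qed
    then have "hausdorff_outer d (A - F) \<le> hausdorff_outer d (S n \<union> (\<Union>i. R (i + n)))"
      by (rule hausdorff_outer_mono)
    also have "\<dots> \<le> hausdorff_outer d (S n) + hausdorff_outer d (\<Union>i. R (i + n))"
      by (rule hausdorff_outer_Un)
    also have "\<dots> \<le> hausdorff_outer d (S n) + (\<Sum>i. hausdorff_outer d (R (i + n)))"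
      by (intro add_left_mono hausdorff_outer_subadditive)
    finally have "hausdorff_outer d (A \<inter> F) + hausdorff_outer d (A - F) \<le>
        (hausdorff_outer d (A \<inter> F) + hausdorff_outer d (S n)) + (\<Sum>i. hausdorff_outer d (R (i + n)))"
      by (simp add: add.assoc add_left_mono)
    also have "\<dots> \<le> hausdorff_outer d A + (\<Sum>i. hausdorff_outer d (R (i + n)))"
      by (intro add_right_mono SF)
    finally show ?thesis .
  qed
  moreover have "(\<lambda>n. hausdorff_outer d A + (\<Sum>i. hausdorff_outer d (R (i + n)))) \<longlonglongrightarrow> hausdorff_outer d A + 0"
    by (intro tendsto_add tendsto_const tail0)
  ultimately show ?thesis by (simp add: LIMSEQ_le_const)
qed auto

lemma measure_space_hausdorff:
  "measure_space UNIV (sets (borel :: 'a::metric_space measure)) (hausdorff_outer d)"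
proof -
  define L where "L = lambda_system UNIV (UNIV :: 'a set set) (hausdorff_outer d)"
  have L: "measure_space UNIV L (hausdorff_outer d)"
    unfolding L_def
    using sigma_algebra.caratheodory_lemma[OF sigma_algebra_Pow, of UNIV "hausdorff_outer d"]
      outer_measure_space_hausdorff[of d] by simp
  interpret L: sigma_algebra UNIV L using L by (simp add: measure_space_def)
  have "F \<in> L" if "closed F" for F
    unfolding L_def lambda_system_def
  proof (clarsimp, rule antisym)
    fix X
    show "hausdorff_outer d (F \<inter> X) + hausdorff_outer d ((UNIV - F) \<inter> X) \<le> hausdorff_outer d X"
      using hausdorff_outer_closed[OF that, of d X] by (simp add: Int_commute Diff_eq)
    show "hausdorff_outer d X \<le> hausdorff_outer d (F \<inter> X) + hausdorff_outer d ((UNIV - F) \<inter> X)"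
      using hausdorff_outer_Un[of d "F \<inter> X" "(UNIV - F) \<inter> X"]
      by (metis Compl_eq_Diff_UNIV Int_commute Int_Un_distrib Int_UNIV_right Un_Diff_cancel Un_UNIV_right)
  qed
  then have "sigma_sets UNIV (Collect closed) \<subseteq> L"
    by (intro L.sigma_sets_subset) auto
  then have sub: "sets borel \<subseteq> L" by (simp add: borel_eq_closed)
  have "countably_additive (sets (borel :: 'a measure)) (hausdorff_outer d)"
    unfolding countably_additive_def
  proof (intro allI impI)
    fix A :: "nat \<Rightarrow> 'a set"
    assume A: "range A \<subseteq> sets borel" "disjoint_family A" "\<Union> (range A) \<in> sets borel"
    have "countably_additive L (hausdorff_outer d)" using L by (simp add: measure_space_def)
    then show "(\<Sum>i. hausdorff_outer d (A i)) = hausdorff_outer d (\<Union> (range A))"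
      unfolding countably_additive_def using A sub by (meson subset_iff)
  qed
  then show ?thesis
    using sets.sigma_algebra_axioms[of "borel :: 'a measure"]
    by (simp add: measure_space_def positive_def)
qed

lemma emeasure_hausdorff_measure:
  "A \<in> sets borel \<Longrightarrow> emeasure (hausdorff_measure d) A = hausdorff_outer d A"
  using measure_space_hausdorff[of d]
  by (intro emeasure_measure_of[OF hausdorff_measure_def])
    (auto simp: measure_space_def hausdorff_measure_def sets.sets_measure_of_eq[of borel, simplified])


subsection \<open>Compactly supported twice continuously differentiable functions\<close>

definition C2 :: "('a::real_normed_vector \<Rightarrow> real) \<Rightarrow> bool" where
  "C2 u \<longleftrightarrow> (\<exists>(Du :: 'a \<Rightarrow> 'a \<Rightarrow>\<^sub>L real) (D2u :: 'a \<Rightarrow> 'a \<Rightarrow>\<^sub>L ('a \<Rightarrow>\<^sub>L real)).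
     (\<forall>x. (u has_derivative blinfun_apply (Du x)) (at x)) \<and>
     (\<forall>x. (Du has_derivative blinfun_apply (D2u x)) (at x)) \<and>
     continuous_on UNIV D2u)"

definition C2_compact_support :: "('a::real_normed_vector \<Rightarrow> real) \<Rightarrow> bool" where
  "C2_compact_support u \<longleftrightarrow> C2 u \<and> compact (closure {x. u x \<noteq> 0})"

definition grad :: "(real ^ 'n \<Rightarrow> real) \<Rightarrow> real ^ 'n \<Rightarrow> real ^ 'n" where
  "grad u x = (\<chi> i. frechet_derivative u (at x) (axis i 1))"


subsection \<open>Generalized Young functions\<close>

text \<open>
  Functions of \<open>t \<in> [0, \<infinity>)\<close> are total functions on \<^typ>\<open>real\<close> whose values at negative arguments are
  never used. Measurability in \<open>(x, y)\<close> is Lebesgue measurability on the product space.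
\<close>

definition generalized_young ::
    "(real ^ 'n \<Rightarrow> real ^ 'n \<Rightarrow> real \<Rightarrow> real) \<Rightarrow> (real ^ 'n \<Rightarrow> real ^ 'n \<Rightarrow> real \<Rightarrow> real) \<Rightarrow> bool" where
  "generalized_young g G \<longleftrightarrow>
     (\<forall>x y. g x y 0 = 0 \<and> (\<forall>t>0. g x y t > 0) \<and>
        mono_on {0..} (g x y) \<and>
        (\<forall>t\<ge>0. continuous (at_right t) (g x y)) \<and>
        filterlim (g x y) at_top at_top) \<and>
     (\<forall>x y. \<forall>t\<ge>0. G x y t = (LBINT \<tau>:{0..t}. g x y \<tau>)) \<and>
     (\<forall>t\<ge>0. (\<lambda>(x, y). G x y t) \<in> borel_measurable lebesgue)"

definition H1 :: "(real ^ 'n \<Rightarrow> real ^ 'n \<Rightarrow> real \<Rightarrow> real) \<Rightarrow> bool" where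
  "H1 G \<longleftrightarrow> (\<exists>C1 C2. 0 < C1 \<and> C1 \<le> C2 \<and> (\<forall>x y. C1 \<le> G x y 1 \<and> G x y 1 \<le> C2))"

definition H2 :: "(real ^ 'n \<Rightarrow> real ^ 'n \<Rightarrow> real \<Rightarrow> real) \<Rightarrow> bool" where
  "H2 G \<longleftrightarrow> (\<forall>x. \<forall>t\<ge>0. continuous_on UNIV (\<lambda>y. G x y t))"

definition H3 ::
    "(real ^ 'n \<Rightarrow> real ^ 'n \<Rightarrow> real \<Rightarrow> real) \<Rightarrow> (real ^ 'n \<Rightarrow> real ^ 'n \<Rightarrow> real \<Rightarrow> real) \<Rightarrow> bool" where
  "H3 g G \<longleftrightarrow> (\<exists>p q. 1 < p \<and> p \<le> q \<and>
     (\<forall>x y. \<forall>t>0. p \<le> t * g x y t / G x y t \<and> t * g x y t / G x y t \<le> q))"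


subsection \<open>The energies\<close>

text \<open>
  All integrands are nonnegative, so the integrals are taken in \<open>[0, \<infinity>]\<close>. The integrand of
  \<open>frac_energy\<close> on the diagonal, a null set, is irrelevant.
\<close>

definition frac_energy ::
    "real \<Rightarrow> (real ^ 'n \<Rightarrow> real ^ 'n \<Rightarrow> real \<Rightarrow> real) \<Rightarrow> (real ^ 'n \<Rightarrow> real) \<Rightarrow> ennreal" where
  "frac_energy s G u =
     (\<integral>\<^sup>+(x, y). ennreal (G x y (\<bar>u x - u y\<bar> / norm (x - y) powr s) / norm (x - y) ^ CARD('n))
        \<partial>lebesgue)"

text \<open>
  The index type \<open>'n\<close> carries no order, so the last coordinate \<open>w\<^sub>n\<close> becomes \<open>w $ k\<close> for an index
  \<open>k\<close> passed as an argument.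
\<close>

definition H0 ::
    "(real ^ 'n \<Rightarrow> real ^ 'n \<Rightarrow> real \<Rightarrow> real) \<Rightarrow> 'n \<Rightarrow> real ^ 'n \<Rightarrow> real \<Rightarrow> ennreal" where
  "H0 G k x t =
     (\<integral>\<^sup>+r\<in>{0<..<1}.
        (\<integral>\<^sup>+w\<in>sphere 0 1. ennreal (G x x (t * \<bar>w $ k\<bar> * r)) \<partial>hausdorff_measure (CARD('n) - 1)) / ennreal r
      \<partial>lborel)"

end

theory Submission
  imports Defs
begin

text \<open>
  Fix \<open>x\<close> and write \<open>y = x + h\<close>. The energy of the pairs with \<open>\<bar>h\<bar> > 1\<close> stays bounded as \<open>s\<close> tends to \<open>1\<close>
  (\<open>far_energy_bounded\<close>), so the factor \<open>1 - s\<close> kills it. For the pairs with \<open>\<bar>h\<bar> \<le> 1\<close> the singular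
  measure \<open>(1 - s) dh / \<bar>h\<bar>\<^sup>n\<close> is transformed by the radial dilation \<open>h = \<bar>z\<bar>\<^sup>a\<^sup>-\<^sup>1 z\<close> with
  \<open>a = 1 / (1 - s)\<close>. In polar coordinates \<open>dh / \<bar>h\<bar>\<^sup>n\<close> is the product of the surface measure and
  \<open>dr / r\<close>, and \<open>r \<mapsto> r\<^sup>a\<close> multiplies \<open>dr / r\<close> by \<open>a\<close>; hence the factor \<open>1 - s\<close> is absorbed exactly.
  The dilation also normalises the difference quotient: with \<open>t = \<bar>z\<bar>\<^sup>a\<^sup>-\<^sup>1\<close> one has \<open>h = t z\<close> and
  \<open>\<bar>h\<bar>\<^sup>s = t\<close>, so that (\<open>near_integral_dilated\<close>)

    \<open>(1 - s) \<integral>\<^bsub>\<bar>h\<bar> \<le> 1\<^esub> G(x, x + h, \<bar>u(x) - u(x + h)\<bar> / \<bar>h\<bar>\<^sup>s) dh / \<bar>h\<bar>\<^sup>n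
      = \<integral>\<^bsub>\<bar>z\<bar> \<le> 1\<^esub> G(x, x + t z, \<bar>u(x) - u(x + t z)\<bar> / t) dz / \<bar>z\<bar>\<^sup>n\<close>.

  For \<open>\<bar>z\<bar> < 1\<close> the number \<open>t\<close> tends to \<open>0\<close> as \<open>s\<close> tends to \<open>1\<close>, and the integrand converges to
  \<open>G(x, x, \<bar>\<nabla>u(x) \<bullet> z\<bar>) / \<bar>z\<bar>\<^sup>n\<close> because \<open>G\<close> is jointly continuous in its last two arguments
  (\<open>young_tendsto\<close>). Convexity of \<open>G\<close> in its last argument and the Lipschitz bound for \<open>u\<close> dominate it
  by a multiple of \<open>\<bar>z\<bar>\<^sup>1\<^sup>-\<^sup>n\<close>, which is integrable, so dominated convergence applies, first in \<open>z\<close> and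
  then in \<open>x\<close> (\<open>near_energy_tendsto\<close>).

  The limit \<open>\<integral>\<^bsub>\<bar>z\<bar> \<le> 1\<^esub> G(x, x, \<bar>\<nabla>u(x) \<bullet> z\<bar>) dz / \<bar>z\<bar>\<^sup>n\<close> has to be recognised as \<open>H\<^sub>0(x, \<bar>\<nabla>u(x)\<bar>)\<close>. A
  rotation turns the gradient to the direction of the chosen axis and polar coordinates finish the
  computation (\<open>H0_eq_ball_integral\<close>), provided that the surface measure of polar coordinates, defined
  by the volumes of cones over subsets of the sphere, is the \<open>(n - 1)\<close>-dimensional Hausdorff measure
  with its normalising constant (\<open>surface_measure_eq_cone_measure\<close>). This is the geometric part.
  Hausdorff measure of top dimension is Lebesgue measure (\<open>hausdorff_outer_eq_lborel\<close>): the isodiametric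
  inequality, proved by Steiner symmetrization, gives one inequality and Vitali's covering theorem the
  other. A small spherical cap is the graph, with Lipschitz constant close to \<open>1\<close>, of a function on a
  flat disc of one dimension less, and the cone over it is close to a flat cone, so both measures of
  the cap are close to the volume of that disc. Two finite measures whose values on small balls
  agree uniformly up to factors tending to \<open>1\<close> are equal (\<open>measure_eqI_of_ball_comparison\<close>).
\<close>

section \<open>Steiner symmetrization and the isodiametric inequality\<close>

text \<open>
  Tonelli's theorem for one coordinate direction against the remaining ones.
\<close>

lemma nn_integral_lborel_slice:
  fixes F :: "'a::euclidean_space \<Rightarrow> ennreal"
  assumes b: "b \<in> Basis" and F[measurable]: "F \<in> borel_measurable borel"
  shows "(\<integral>\<^sup>+x. F x \<partial>lborel) =
    (\<integral>\<^sup>+f. (\<integral>\<^sup>+t. F ((\<Sum>c\<in>Basis - {b}. f c *\<^sub>R c) + t *\<^sub>R b) \<partial>lborel) \<partial>(\<Pi>\<^sub>M c\<in>Basis - {b}. lborel))"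
proof -
  interpret product_sigma_finite "\<lambda>_::'a. lborel :: real measure" ..
  have m: "(\<lambda>f. \<Sum>c\<in>Basis. f c *\<^sub>R c) \<in> measurable (\<Pi>\<^sub>M c\<in>Basis. lborel) (borel :: 'a measure)"
    by measurable
  have "(\<integral>\<^sup>+x. F x \<partial>lborel) = (\<integral>\<^sup>+f. F (\<Sum>c\<in>Basis. f c *\<^sub>R c) \<partial>(\<Pi>\<^sub>M c\<in>Basis. lborel))"
    by (subst lborel_eq, subst nn_integral_distr) (use m in auto)
  also have "\<dots> = (\<integral>\<^sup>+f. F (\<Sum>c\<in>Basis. f c *\<^sub>R c) \<partial>(\<Pi>\<^sub>M c\<in>insert b (Basis - {b}). lborel))"
    using b by (simp add: insert_absorb)
  also have "\<dots> = (\<integral>\<^sup>+f. (\<integral>\<^sup>+t. F (\<Sum>c\<in>Basis. (f(b := t)) c *\<^sub>R c) \<partial>lborel) \<partial>(\<Pi>\<^sub>M c\<in>Basis - {b}. lborel))"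
    using b measurable_compose[OF m F] by (subst product_nn_integral_insert) (auto simp: insert_absorb)
  also have "\<dots> = (\<integral>\<^sup>+f. (\<integral>\<^sup>+t. F ((\<Sum>c\<in>Basis - {b}. f c *\<^sub>R c) + t *\<^sub>R b) \<partial>lborel)
      \<partial>(\<Pi>\<^sub>M c\<in>Basis - {b}. lborel))"
  proof -
    have "(\<Sum>c\<in>Basis. (f(b := t)) c *\<^sub>R c) = (\<Sum>c\<in>Basis - {b}. f c *\<^sub>R c) + t *\<^sub>R b" for f t
      using b by (subst sum.remove[OF _ b]) (auto simp: add.commute intro!: sum.cong)
    then show ?thesis by simp
  qed
  finally show ?thesis .
qed

definition line_section :: "'a::euclidean_space set \<Rightarrow> 'a \<Rightarrow> 'a \<Rightarrow> real set" where
  "line_section A b x = {t. x + t *\<^sub>R b \<in> A}"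

text \<open>
  The Steiner symmetral: every line parallel to \<open>b\<close> meets it in an open segment centred at the
  hyperplane orthogonal to \<open>b\<close>, as long as its intersection with \<open>A\<close>. As sections are compared by
  length only, \<open>x\<close> need not be projected to that hyperplane first.
\<close>

definition steiner :: "'a::euclidean_space \<Rightarrow> 'a set \<Rightarrow> 'a set" where
  "steiner b A = {x. ennreal (2 * \<bar>x \<bullet> b\<bar>) < emeasure lborel (line_section A b x)}"

lemma line_section_borel [measurable]:
  assumes "A \<in> sets borel" shows "line_section A b x \<in> sets borel"
proof -
  have "(\<lambda>t. x + t *\<^sub>R b) -` A \<inter> space borel \<in> sets borel"
    by (rule measurable_sets[OF _ assms]) measurable
  then show ?thesis by (simp add: line_section_def vimage_def)
qed

lemma emeasure_line_section_shift:
  assumes "A \<in> sets borel"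
  shows "emeasure lborel (line_section A b (x + s *\<^sub>R b)) = emeasure lborel (line_section A b x)"
proof -
  have "emeasure lborel (line_section A b x) = emeasure (distr lborel borel ((+) s)) (line_section A b x)"
    by (simp add: lborel_distr_plus)
  also have "\<dots> = emeasure lborel ((+) s -` line_section A b x \<inter> space lborel)"
    using assms by (subst emeasure_distr) auto
  also have "(+) s -` line_section A b x \<inter> space lborel = line_section A b (x + s *\<^sub>R b)"
    by (auto simp: line_section_def algebra_simps)
  finally show ?thesis by simp
qed

lemma measurable_emeasure_line_section:
  assumes A: "A \<in> sets borel"
  shows "(\<lambda>x. emeasure lborel (line_section A b x)) \<in> borel_measurable borel"
proof -
  have "(\<lambda>x. \<integral>\<^sup>+t. indicator A (x + t *\<^sub>R b) \<partial>lborel) \<in> borel_measurable borel"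
    using A by measurable
  also have "(\<lambda>x. \<integral>\<^sup>+t. indicator A (x + t *\<^sub>R b) \<partial>lborel) = (\<lambda>x. emeasure lborel (line_section A b x))"
  proof
    fix x
    have "(\<integral>\<^sup>+t. indicator A (x + t *\<^sub>R b) \<partial>lborel) = (\<integral>\<^sup>+t. indicator (line_section A b x) t \<partial>lborel)"
      by (intro nn_integral_cong) (auto simp: line_section_def split: split_indicator)
    then show "(\<integral>\<^sup>+t. indicator A (x + t *\<^sub>R b) \<partial>lborel) = emeasure lborel (line_section A b x)"
      using A by simp
  qed
  finally show ?thesis .
qed

lemma steiner_borel [measurable]:
  assumes "A \<in> sets borel" shows "steiner b A \<in> sets borel"
proof -
  note [measurable] = measurable_emeasure_line_section[OF assms]
  show ?thesis unfolding steiner_def by measurable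
qed

lemma emeasure_steiner:
  assumes b: "b \<in> Basis" and A[measurable]: "A \<in> sets borel"
    and fin: "\<And>x. emeasure lborel (line_section A b x) < top"
  shows "emeasure lborel (steiner b A) = emeasure lborel A"
proof -
  have [simp]: "b \<bullet> b = 1" using b by (simp add: inner_Basis)
  have perp: "(\<Sum>c\<in>Basis - {b}. f c *\<^sub>R c) \<bullet> b = 0" for f :: "'a \<Rightarrow> real"
    using b by (auto simp: inner_sum_left inner_Basis intro!: sum.neutral)
  have sec: "emeasure lborel {t. ennreal (2 * \<bar>t\<bar>) < c} = c" if "c < top" for c
  proof -
    obtain r where r: "c = ennreal r" "0 \<le> r" using \<open>c < top\<close> by (cases c) auto
    have "{t. ennreal (2 * \<bar>t\<bar>) < c} = {- (r/2)<..<r/2}"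
      using r by (auto simp: ennreal_less_iff)
    then show ?thesis using r by simp
  qed
  have 1: "(\<integral>\<^sup>+t. indicator A (y + t *\<^sub>R b) \<partial>lborel) = emeasure lborel (line_section A b y)" for y
  proof -
    have "(\<integral>\<^sup>+t. indicator A (y + t *\<^sub>R b) \<partial>lborel) = (\<integral>\<^sup>+t. indicator (line_section A b y) t \<partial>lborel)"
      by (intro nn_integral_cong) (auto simp: line_section_def split: split_indicator)
    then show ?thesis by simp
  qed
  have 2: "(\<integral>\<^sup>+t. indicator (steiner b A) (y + t *\<^sub>R b) \<partial>lborel) = emeasure lborel (line_section A b y)"
    if "y \<bullet> b = 0" for y
  proof -
    let ?S = "{t. ennreal (2 * \<bar>t\<bar>) < emeasure lborel (line_section A b y)}"
    have "(\<integral>\<^sup>+t. indicator (steiner b A) (y + t *\<^sub>R b) \<partial>lborel) = (\<integral>\<^sup>+t. indicator ?S t \<partial>lborel)"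
      using that
      by (intro nn_integral_cong)
        (auto simp: steiner_def emeasure_line_section_shift inner_add_left split: split_indicator)
    also have "\<dots> = emeasure lborel ?S" by simp
    also have "\<dots> = emeasure lborel (line_section A b y)" using fin by (intro sec)
    finally show ?thesis .
  qed
  have "emeasure lborel (steiner b A) = (\<integral>\<^sup>+x. indicator (steiner b A) x \<partial>lborel)" by simp
  also have "\<dots> = (\<integral>\<^sup>+x. indicator A x \<partial>lborel)"
    unfolding nn_integral_lborel_slice[OF b borel_measurable_indicator[OF steiner_borel[OF A]]]
      nn_integral_lborel_slice[OF b borel_measurable_indicator[OF A]]
    by (simp add: 1 2[OF perp])
  finally show ?thesis by simp
qed

text \<open>
  Two sets of reals contain points whose distance is at least the sum of half their lengths:
  otherwise the suprema and infima would satisfy \<open>sup P - inf Q \<le> \<bar>s\<bar> + \<bar>t\<bar>\<close> and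
  \<open>sup Q - inf P \<le> \<bar>s\<bar> + \<bar>t\<bar>\<close>, and adding these contradicts the lengths.
\<close>

lemma two_sets_far_points:
  fixes P Q :: "real set" and s t :: real
  assumes P: "ennreal (2 * \<bar>s\<bar>) < emeasure lborel P" and Q: "ennreal (2 * \<bar>t\<bar>) < emeasure lborel Q"
  shows "\<exists>p\<in>P. \<exists>q\<in>Q. \<bar>s\<bar> + \<bar>t\<bar> \<le> \<bar>p - q\<bar>"
proof (rule ccontr)
  assume "\<not> ?thesis"
  then have less: "\<bar>p - q\<bar> < \<bar>s\<bar> + \<bar>t\<bar>" if "p \<in> P" "q \<in> Q" for p q
    using that by (meson not_less)
  have ne: "P \<noteq> {}" "Q \<noteq> {}" using P Q by auto
  then obtain p0 q0 where p0: "p0 \<in> P" and q0: "q0 \<in> Q" by blast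
  have bP: "bdd_above P" "bdd_below P"
    using less[OF _ q0]
    by (auto simp: abs_less_iff algebra_simps
        intro!: bdd_aboveI[of _ "q0 + (\<bar>s\<bar> + \<bar>t\<bar>)"] bdd_belowI[of _ "q0 - (\<bar>s\<bar> + \<bar>t\<bar>)"] less_imp_le)
  have bQ: "bdd_above Q" "bdd_below Q"
    using less[OF p0]
    by (auto simp: abs_less_iff algebra_simps
        intro!: bdd_aboveI[of _ "p0 + (\<bar>s\<bar> + \<bar>t\<bar>)"] bdd_belowI[of _ "p0 - (\<bar>s\<bar> + \<bar>t\<bar>)"] less_imp_le)
  have meas: "2 * \<bar>r\<bar> < Sup R - Inf R"
    if "ennreal (2 * \<bar>r\<bar>) < emeasure lborel R" "bdd_above R" "bdd_below R" "R \<noteq> {}" for r and R :: "real set"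
  proof -
    have IS: "Inf R \<le> Sup R" using that by (intro cInf_le_cSup)
    have "R \<subseteq> {Inf R..Sup R}" using that by (auto intro: cInf_lower cSup_upper)
    then have "emeasure lborel R \<le> emeasure lborel {Inf R..Sup R}" by (rule emeasure_mono) auto
    also have "\<dots> = ennreal (Sup R - Inf R)" using IS by simp
    finally show ?thesis using that(1) IS by (metis ennreal_less_iff order_less_le_trans abs_ge_zero mult_nonneg_nonneg zero_le_numeral)
  qed
  have A: "Sup P - Inf Q \<le> \<bar>s\<bar> + \<bar>t\<bar>"
  proof -
    have "p - (\<bar>s\<bar> + \<bar>t\<bar>) \<le> Inf Q" if "p \<in> P" for p
      using less[OF that] ne by (intro cInf_greatest) (auto simp: abs_less_iff intro: less_imp_le, fastforce)
    then have "Sup P \<le> Inf Q + (\<bar>s\<bar> + \<bar>t\<bar>)" using ne by (intro cSup_least) (auto simp: algebra_simps)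
    then show ?thesis by simp
  qed
  have B: "Sup Q - Inf P \<le> \<bar>s\<bar> + \<bar>t\<bar>"
  proof -
    have "q - (\<bar>s\<bar> + \<bar>t\<bar>) \<le> Inf P" if "q \<in> Q" for q
      using less[OF _ that] ne by (intro cInf_greatest) (auto simp: abs_less_iff intro: less_imp_le, fastforce)
    then have "Sup Q \<le> Inf P + (\<bar>s\<bar> + \<bar>t\<bar>)" using ne by (intro cSup_least) (auto simp: algebra_simps)
    then show ?thesis by simp
  qed
  show False
    using meas[OF P bP ne(1)] meas[OF Q bQ ne(2)] A B by linarith
qed

text \<open>
  Symmetrization does not increase the diameter: two points of the symmetral at heights \<open>s\<close> and \<open>t\<close>
  can be replaced by points of \<open>A\<close> on the same two lines whose heights differ at least as much.
\<close>

lemma steiner_dist_le: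
  assumes b: "b \<in> Basis" and A: "A \<in> sets borel"
    and D: "\<And>x y. x \<in> A \<Longrightarrow> y \<in> A \<Longrightarrow> dist x y \<le> D"
    and x: "x \<in> steiner b A" and y: "y \<in> steiner b A"
  shows "dist x y \<le> D"
proof -
  have bb: "b \<bullet> b = 1" using b by (simp add: inner_Basis)
  \<comment> \<open>Move both points along \<open>b\<close> into the hyperplane orthogonal to \<open>b\<close>; their distance is then split by Pythagoras.\<close>
  define s t where "s = x \<bullet> b" and "t = y \<bullet> b"
  define x0 y0 where "x0 = x + (- s) *\<^sub>R b" and "y0 = y + (- t) *\<^sub>R b"
  have perp: "x0 \<bullet> b = 0" "y0 \<bullet> b = 0" by (auto simp: x0_def y0_def s_def t_def inner_diff_left bb)
  have "ennreal (2 * \<bar>s\<bar>) < emeasure lborel (line_section A b x0)"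
    using x A by (simp add: steiner_def x0_def s_def emeasure_line_section_shift del: scaleR_minus_left)
  moreover have "ennreal (2 * \<bar>t\<bar>) < emeasure lborel (line_section A b y0)"
    using y A by (simp add: steiner_def y0_def t_def emeasure_line_section_shift del: scaleR_minus_left)
  ultimately obtain p q where p: "x0 + p *\<^sub>R b \<in> A" and q: "y0 + q *\<^sub>R b \<in> A"
      and pq: "\<bar>s\<bar> + \<bar>t\<bar> \<le> \<bar>p - q\<bar>"
    using two_sets_far_points unfolding line_section_def by blast
  have pyth: "(dist (x0 + p *\<^sub>R b) (y0 + q *\<^sub>R b))\<^sup>2 = (norm (x0 - y0))\<^sup>2 + (p - q)\<^sup>2" for p q
  proof -
    have "x0 + p *\<^sub>R b - (y0 + q *\<^sub>R b) = (x0 - y0) + (p - q) *\<^sub>R b" by (simp add: algebra_simps)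
    moreover have "(norm ((x0 - y0) + (p - q) *\<^sub>R b))\<^sup>2 = (norm (x0 - y0))\<^sup>2 + (norm ((p - q) *\<^sub>R b))\<^sup>2"
      by (rule norm_add_Pythagorean) (simp add: orthogonal_def inner_diff_left perp)
    ultimately show ?thesis using b by (metis dist_norm norm_Basis norm_scaleR mult.right_neutral power2_abs)
  qed
  have "x = x0 + s *\<^sub>R b" "y = y0 + t *\<^sub>R b" by (auto simp: x0_def y0_def)
  then have "(dist x y)\<^sup>2 = (norm (x0 - y0))\<^sup>2 + (s - t)\<^sup>2" using pyth by simp
  also have "\<dots> \<le> (norm (x0 - y0))\<^sup>2 + (p - q)\<^sup>2"
    using pq by (intro add_left_mono) (simp add: abs_le_square_iff[symmetric])
  also have "\<dots> = (dist (x0 + p *\<^sub>R b) (y0 + q *\<^sub>R b))\<^sup>2" using pyth by simp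
  also have "\<dots> \<le> D\<^sup>2" using D[OF p q] by (simp add: power_mono)
  finally show ?thesis
    using D[OF p q] by (meson abs_le_square_iff abs_of_nonneg order_trans power2_le_imp_le zero_le_dist)
qed

definition reflect :: "'a::euclidean_space \<Rightarrow> 'a \<Rightarrow> 'a" where
  "reflect c x = x - (2 * (x \<bullet> c)) *\<^sub>R c"

lemma reflect_reflect: "c \<in> Basis \<Longrightarrow> reflect c (reflect c x) = x"
  by (simp add: reflect_def inner_diff_left inner_Basis algebra_simps)

lemma steiner_reflect_self:
  assumes b: "b \<in> Basis" and A: "A \<in> sets borel" and x: "x \<in> steiner b A"
  shows "reflect b x \<in> steiner b A"
  using x emeasure_line_section_shift[OF A, of b x "- (2 * (x \<bullet> b))"] b
  by (simp add: steiner_def reflect_def inner_diff_left inner_Basis)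

text \<open>
  Symmetries gained in one direction survive symmetrization in an orthogonal direction; this is what
  makes it possible to treat the coordinates one after the other.
\<close>

lemma steiner_reflect_other:
  assumes b: "b \<in> Basis" and c: "c \<in> Basis" "c \<noteq> b"
    and sym: "\<And>x. x \<in> A \<Longrightarrow> reflect c x \<in> A" and x: "x \<in> steiner b A"
  shows "reflect c x \<in> steiner b A"
proof -
  have [simp]: "b \<bullet> c = 0" "c \<bullet> b = 0" using b c by (auto simp: inner_Basis)
  have eq: "reflect c x + t *\<^sub>R b = reflect c (x + t *\<^sub>R b)" for t
    by (simp add: reflect_def inner_add_left)
  have "reflect c z \<in> A \<longleftrightarrow> z \<in> A" for z
    using sym reflect_reflect[OF c(1)] by metis
  then have "line_section A b (reflect c x) = line_section A b x"
    by (simp add: line_section_def eq)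
  then show ?thesis using x by (simp add: steiner_def reflect_def inner_diff_left)
qed

lemma emeasure_line_section_finite:
  assumes b: "b \<in> Basis" and A: "bounded A"
  shows "emeasure lborel (line_section A b x) < top"
proof -
  obtain B where B: "\<And>y. y \<in> A \<Longrightarrow> norm y \<le> B" using A by (auto simp: bounded_iff)
  have "line_section A b x \<subseteq> {- (B + norm x)..B + norm x}"
  proof
    fix t assume "t \<in> line_section A b x"
    then have "norm (x + t *\<^sub>R b) \<le> B" using B by (simp add: line_section_def)
    then have "norm (t *\<^sub>R b) \<le> B + norm x" by (metis add.commute add_diff_cancel_left' norm_triangle_le_diff norm_triangle_ineq4 order_trans add_right_mono)
    then show "t \<in> {- (B + norm x)..B + norm x}" using b by (simp add: abs_le_iff)
  qed
  then have "emeasure lborel (line_section A b x) \<le> emeasure lborel {- (B + norm x)..B + norm x}"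
    by (rule emeasure_mono) auto
  also have "\<dots> < top" by (rule emeasure_compact_finite[unfolded infinity_ennreal_def]) (rule compact_Icc)
  finally show ?thesis .
qed

text \<open>
  Successive Steiner symmetrization in the coordinate directions.
\<close>

lemma symmetrize:
  fixes A S :: "'a::euclidean_space set"
  assumes A: "A \<in> sets borel" and D: "\<And>x y. x \<in> A \<Longrightarrow> y \<in> A \<Longrightarrow> dist x y \<le> D"
    and S: "S \<subseteq> Basis"
  shows "\<exists>B\<in>sets borel. emeasure lborel B = emeasure lborel A \<and> (\<forall>x\<in>B. \<forall>y\<in>B. dist x y \<le> D)
    \<and> (\<forall>c\<in>S. \<forall>x\<in>B. reflect c x \<in> B)"
  using finite_subset[OF S finite_Basis] S
proof (induction S rule: finite_induct)
  case empty
  show ?case by (rule bexI[OF _ A]) (auto intro: D)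
next
  case (insert b S)
  then obtain B where B: "B \<in> sets borel" "emeasure lborel B = emeasure lborel A"
    "\<And>x y. x \<in> B \<Longrightarrow> y \<in> B \<Longrightarrow> dist x y \<le> D" "\<And>c x. c \<in> S \<Longrightarrow> x \<in> B \<Longrightarrow> reflect c x \<in> B"
    by auto
  have b: "b \<in> Basis" using insert by auto
  have "bounded B" using B(3) bounded_two_points by blast
  then have fin: "emeasure lborel (line_section B b x) < top" for x
    by (rule emeasure_line_section_finite[OF b])
  show ?case
  proof (rule bexI[of _ "steiner b B"], intro conjI ballI)
    show "emeasure lborel (steiner b B) = emeasure lborel A"
      using emeasure_steiner[OF b B(1) fin] B(2) by simp
    show "dist x y \<le> D" if "x \<in> steiner b B" "y \<in> steiner b B" for x y
      using steiner_dist_le[OF b B(1) B(3)] that by blast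
    show "reflect c x \<in> steiner b B" if "c \<in> insert b S" "x \<in> steiner b B" for c x
      using steiner_reflect_self[OF b B(1)] steiner_reflect_other[OF b _ _ B(4)] that insert by (metis insert_iff subsetD)
  qed (use B(1) in auto)
qed

text \<open>
  A set that is symmetric in all coordinate directions is symmetric about the origin, so each of
  its points has norm at most half the diameter, and the set lies in the ball of that radius.
\<close>

theorem isodiametric:
  fixes A :: "'a::euclidean_space set"
  assumes A: "A \<in> sets borel" "bounded A"
  shows "emeasure lborel A \<le> ennreal (unit_ball_vol (real DIM('a)) * (diameter A / 2) ^ DIM('a))"
proof -
  have D: "dist x y \<le> diameter A" if "x \<in> A" "y \<in> A" for x y
    using A that by (intro diameter_bounded_bound)
  obtain B :: "'a set" where B: "emeasure lborel B = emeasure lborel A"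
    "\<And>x y. x \<in> B \<Longrightarrow> y \<in> B \<Longrightarrow> dist x y \<le> diameter A" "\<And>c x. c \<in> Basis \<Longrightarrow> x \<in> B \<Longrightarrow> reflect c x \<in> B"
    using symmetrize[OF A(1) D order_refl] by metis
  have flip: "x - (\<Sum>c\<in>S. (2 * (x \<bullet> c)) *\<^sub>R c) \<in> B" if "x \<in> B" "S \<subseteq> Basis" for x S
    using finite_subset[OF that(2) finite_Basis] that(2)
  proof (induction S rule: finite_induct)
    case (insert b S)
    let ?y = "x - (\<Sum>c\<in>S. (2 * (x \<bullet> c)) *\<^sub>R c)"
    have b: "b \<in> Basis" using insert by auto
    have "(\<Sum>c\<in>S. (2 * (x \<bullet> c)) *\<^sub>R c) \<bullet> b = 0"
      using insert by (auto simp: inner_sum_left inner_Basis intro!: sum.neutral)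
    then have "?y \<bullet> b = x \<bullet> b" by (simp add: inner_diff_left)
    then have "reflect b ?y = x - (\<Sum>c\<in>insert b S. (2 * (x \<bullet> c)) *\<^sub>R c)"
      using insert by (simp add: reflect_def algebra_simps)
    then show ?case using B(3)[OF b] insert by (metis insert_subset)
  qed (use that in auto)
  have "B \<subseteq> cball 0 (diameter A / 2)"
  proof
    fix x assume x: "x \<in> B"
    \<comment> \<open>Reflecting in all coordinates maps \<open>x\<close> to \<open>x - 2 x = - x\<close>.\<close>
    have "(\<Sum>c\<in>Basis. (2 * (x \<bullet> c)) *\<^sub>R c) = 2 *\<^sub>R (\<Sum>c\<in>Basis. (x \<bullet> c) *\<^sub>R c)"
      by (simp add: scaleR_right.sum)
    also have "\<dots> = x + x" by (simp add: euclidean_representation scaleR_2)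
    finally have "- x \<in> B" using flip[OF x order_refl] by simp
    then have "dist x (- x) \<le> diameter A" using B(2) x by blast
    moreover have "dist x (- x) = 2 * norm x" by (simp add: dist_norm flip: scaleR_2)
    ultimately show "x \<in> cball 0 (diameter A / 2)" by simp
  qed
  then have "emeasure lborel B \<le> emeasure lborel (cball 0 (diameter A / 2) :: 'a set)"
    by (rule emeasure_mono) auto
  also have "\<dots> = ennreal (unit_ball_vol (real DIM('a)) * (diameter A / 2) ^ DIM('a))"
    using diameter_ge_0[OF A(2)] by (intro emeasure_cball) auto
  finally show ?thesis by (simp add: B)
qed

section \<open>Hausdorff measure of top dimension is Lebesgue measure\<close>

text \<open>
  Coverings indexed by an arbitrary countable set, as the covering theorems produce them; missing
  indices are filled up with the empty set, which has weight \<open>0\<close>.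
\<close>

lemma hausdorff_pre_le_countable:
  assumes K: "countable K" and A: "A \<subseteq> (\<Union>i\<in>K. C i)"
    and C: "\<And>i. i \<in> K \<Longrightarrow> bounded (C i)" "\<And>i. i \<in> K \<Longrightarrow> diameter (C i) \<le> \<delta>" and \<delta>: "0 \<le> \<delta>"
  shows "hausdorff_pre d \<delta> A \<le> (\<integral>\<^sup>+i. hausdorff_weight d (C i) \<partial>count_space K)"
proof -
  define f where "f = to_nat_on K"
  have bij: "bij_betw f K (f ` K)" unfolding f_def by (rule inj_on_imp_bij_betw[OF inj_on_to_nat_on[OF K]])
  define C' where "C' n = (if n \<in> f ` K then C (inv_into K f n) else {})" for n
  have C'f: "C' (f i) = C i" if "i \<in> K" for i
    using that bij by (simp add: C'_def bij_betw_inv_into_left)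
  have "hausdorff_pre d \<delta> A \<le> (\<Sum>n. hausdorff_weight d (C' n))"
  proof (rule hausdorff_pre_le)
    show "A \<subseteq> (\<Union>n. C' n)" using A C'f by fastforce
    show "bounded (C' n)" "diameter (C' n) \<le> \<delta>" for n
      using C \<delta> by (auto simp: C'_def inv_into_into)
  qed
  also have "\<dots> = (\<integral>\<^sup>+n. hausdorff_weight d (C' n) \<partial>count_space UNIV)"
    by (simp add: nn_integral_count_space_nat)
  also have "\<dots> = (\<integral>\<^sup>+n. hausdorff_weight d (C' n) * indicator (f ` K) n \<partial>count_space UNIV)"
    by (intro nn_integral_cong) (auto simp: C'_def split: split_indicator)
  also have "\<dots> = (\<integral>\<^sup>+n. hausdorff_weight d (C' n) \<partial>count_space (f ` K))"
    by (simp add: nn_integral_count_space_indicator)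
  also have "\<dots> = (\<integral>\<^sup>+i. hausdorff_weight d (C' (f i)) \<partial>count_space K)"
    by (rule nn_integral_bij_count_space[OF bij, symmetric])
  also have "\<dots> = (\<integral>\<^sup>+i. hausdorff_weight d (C i) \<partial>count_space K)"
    by (intro nn_integral_cong) (simp add: C'f)
  finally show ?thesis .
qed

lemma hausdorff_weight_cball:
  fixes a :: "'a::euclidean_space"
  assumes "0 \<le> r"
  shows "hausdorff_weight DIM('a) (cball a r) = emeasure lborel (cball a r)"
  using assms by (simp add: hausdorff_weight_def emeasure_cball)

text \<open>
  By the isodiametric inequality the weight of a set is at least the volume of its closure.
\<close>

lemma lborel_le_hausdorff_outer:
  fixes A :: "'a::euclidean_space set"
  assumes "A \<in> sets borel"
  shows "emeasure lborel A \<le> hausdorff_outer DIM('a) A"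
proof -
  have "emeasure lborel A \<le> hausdorff_pre DIM('a) 1 A"
    unfolding hausdorff_pre_def
  proof (safe intro!: INF_greatest)
    fix C :: "nat \<Rightarrow> 'a set"
    assume C: "A \<subseteq> (\<Union>i. C i)" "\<forall>i. bounded (C i) \<and> diameter (C i) \<le> 1"
    have "emeasure lborel A \<le> emeasure lborel (\<Union>i. closure (C i))"
    proof (rule emeasure_mono)
      show "A \<subseteq> (\<Union>i. closure (C i))" using C(1) closure_subset[of "C _"] by blast
      show "(\<Union>i. closure (C i)) \<in> sets lborel" by (auto intro!: sets.countable_UN borel_closed)
    qed
    also have "\<dots> \<le> (\<Sum>i. emeasure lborel (closure (C i)))"
      by (intro emeasure_subadditive_countably) (auto intro!: borel_closed)
    also have "\<dots> \<le> (\<Sum>i. hausdorff_weight DIM('a) (C i))"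
    proof (intro suminf_le)
      fix i
      show "emeasure lborel (closure (C i)) \<le> hausdorff_weight DIM('a) (C i)"
        using isodiametric[of "closure (C i)"] C(2) by (simp add: bounded_closure hausdorff_weight_def diameter_closure)
    qed auto
    finally show "emeasure lborel A \<le> (\<Sum>i. hausdorff_weight DIM('a) (C i))" .
  qed
  also have "\<dots> \<le> hausdorff_outer DIM('a) A" by (rule hausdorff_pre_le_outer) simp
  finally show ?thesis .
qed

lemma emeasure_disjoint_cballs:
  fixes a :: "'i \<Rightarrow> 'a::euclidean_space"
  assumes "countable K" "pairwise (\<lambda>i j. disjnt (cball (a i) (r i)) (cball (a j) (r j))) K"
  shows "(\<integral>\<^sup>+i. emeasure lborel (cball (a i) (r i)) \<partial>count_space K) = emeasure lborel (\<Union>i\<in>K. cball (a i) (r i))"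
  using assms
  by (intro emeasure_UN_countable[symmetric])
    (auto simp: disjoint_family_on_def pairwise_def disjnt_def)

text \<open>
  Lebesgue null sets are Hausdorff null sets. A null set lies in an open set of small volume; the
  \<open>5r\<close>-covering lemma covers it by balls that have total volume at most \<open>5\<^sup>d\<close> times as large.
\<close>

lemma hausdorff_pre_negligible:
  fixes N :: "'a::euclidean_space set"
  assumes N: "negligible N" and \<delta>: "0 < \<delta>"
  shows "hausdorff_pre DIM('a) \<delta> N = 0"
proof -
  have "hausdorff_pre DIM('a) \<delta> N \<le> 0 + ennreal e" if e: "0 < e" for e
  proof -
    define e' where "e' = e / 5 ^ DIM('a)"
    have e': "0 < e'" using e by (simp add: e'_def)
    have N0: "N \<in> null_sets lebesgue" using N by (simp add: negligible_iff_null_sets)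
    then obtain U where U: "open U" "N \<subseteq> U" "emeasure lebesgue (U - N) < ennreal e'"
      using sets_lebesgue_outer_open[OF null_setsD2[OF N0] e'] by metis
    have "emeasure lebesgue (U - N) = emeasure lebesgue U"
      using U(1) N0 by (intro emeasure_Diff_null_set) auto
    moreover have "emeasure lebesgue U = emeasure lborel U" using U(1) by simp
    ultimately have measU: "emeasure lborel U < ennreal e'" using U(3) by simp
    \<comment> \<open>Radii at most \<open>\<delta> / 10\<close> keep the diameters of the five times larger balls below \<open>\<delta>\<close>.\<close>
    have "\<exists>r>0. r \<le> \<delta> / 10 \<and> cball x r \<subseteq> U" if "x \<in> N" for x
    proof -
      obtain s where "s > 0" "cball x s \<subseteq> U"
        using open_contains_cball[THEN iffD1, OF U(1)] U(2) \<open>x \<in> N\<close> by blast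
      then have "0 < min s (\<delta>/10)" "cball x (min s (\<delta>/10)) \<subseteq> U"
        using \<delta> subset_cball[of "min s (\<delta>/10)" s x] by simp_all
      then show ?thesis by (meson min.cobounded2)
    qed
    then obtain r where r: "\<And>x. x \<in> N \<Longrightarrow> 0 < r x \<and> r x \<le> \<delta> / 10 \<and> cball x (r x) \<subseteq> U" by metis
    have "N \<subseteq> (\<Union>x\<in>N. cball x (r x))" using r by force
    obtain K where K: "countable K" "K \<subseteq> N"
       "pairwise (\<lambda>i j. disjnt (cball i (r i)) (cball j (r j))) K" "N \<subseteq> (\<Union>i\<in>K. cball i (5 * r i))"
    proof (rule Vitali_covering_lemma_cballs[where K=N and a="\<lambda>x. x" and r=r and B="\<delta>/10" and S=N])
      show "N \<subseteq> (\<Union>x\<in>N. cball x (r x))" by fact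
      show "0 < r x \<and> r x \<le> \<delta> / 10" if "x \<in> N" for x using r[OF that] by blast
    qed (rule that)
    have "hausdorff_pre DIM('a) \<delta> N \<le> (\<integral>\<^sup>+i. hausdorff_weight DIM('a) (cball i (5 * r i)) \<partial>count_space K)"
    proof (rule hausdorff_pre_le_countable[OF K(1,4)])
      show "diameter (cball i (5 * r i)) \<le> \<delta>" if "i \<in> K" for i
        using r[of i] K(2) that by auto
    qed (use \<delta> in auto)
    also have "\<dots> = (\<integral>\<^sup>+i. ennreal (5 ^ DIM('a)) * emeasure lborel (cball i (r i)) \<partial>count_space K)"
    proof (intro nn_integral_cong)
      fix i assume "i \<in> space (count_space K)"
      then have "0 \<le> r i" using r[of i] K(2) by auto
      then show "hausdorff_weight DIM('a) (cball i (5 * r i)) = ennreal (5 ^ DIM('a)) * emeasure lborel (cball i (r i))"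
        by (simp add: hausdorff_weight_cball emeasure_cball power_mult_distrib ennreal_mult[symmetric]
            mult.left_commute)
    qed
    also have "\<dots> = ennreal (5 ^ DIM('a)) * emeasure lborel (\<Union>i\<in>K. cball i (r i))"
      using emeasure_disjoint_cballs[OF K(1,3)] by (simp add: nn_integral_cmult)
    also have "\<dots> \<le> ennreal (5 ^ DIM('a)) * emeasure lborel U"
    proof (intro mult_left_mono emeasure_mono)
      show "(\<Union>i\<in>K. cball i (r i)) \<subseteq> U" using r K(2) by fast
    qed (use U in auto)
    also have "\<dots> \<le> ennreal (5 ^ DIM('a)) * ennreal e'"
      using measU by (intro mult_left_mono less_imp_le) auto
    also have "\<dots> = ennreal e" by (simp add: e'_def ennreal_mult[symmetric] e less_imp_le)
    finally show ?thesis by simp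
  qed
  then have "hausdorff_pre DIM('a) \<delta> N \<le> 0" by (rule ennreal_le_epsilon)
  then show ?thesis by simp
qed

lemma hausdorff_pre_Un: "hausdorff_pre d \<delta> (A \<union> B) \<le> hausdorff_pre d \<delta> A + hausdorff_pre d \<delta> B"
  if "0 < \<delta>"
proof -
  have e: "hausdorff_pre d \<delta> {} = 0"
    using hausdorff_pre_le_outer[OF that, of d "{}"] by simp
  have eq: "(\<Union>i. if i = 0 then A else if i = Suc 0 then B else {}) = A \<union> B"
    by (auto split: if_splits)
  have "hausdorff_pre d \<delta> (A \<union> B) \<le>
      (\<Sum>n. hausdorff_pre d \<delta> (if n = 0 then A else if n = Suc 0 then B else {}))"
    using hausdorff_pre_subadditive[of d \<delta> "\<lambda>i. if i = 0 then A else if i = Suc 0 then B else {}"]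
    unfolding eq .
  also have "\<dots> = hausdorff_pre d \<delta> A + hausdorff_pre d \<delta> B"
    by (subst suminf_finite[of "{0, Suc 0}"]) (auto simp: e)
  finally show ?thesis .
qed

text \<open>
  Vitali's theorem fills an open set, up to a null set, with disjoint small balls, and for balls
  weight and volume agree.
\<close>

lemma hausdorff_outer_open_le:
  fixes U :: "'a::euclidean_space set"
  assumes U: "open U"
  shows "hausdorff_outer DIM('a) U \<le> emeasure lborel U"
  unfolding hausdorff_outer_def
proof (rule SUP_least)
  fix \<delta> :: real assume "\<delta> \<in> {0<..}"
  then have \<delta>: "0 < \<delta>" by simp
  let ?K = "{(x, r). 0 < r \<and> r \<le> \<delta> / 2 \<and> cball x r \<subseteq> U}"
  obtain K where K: "countable K" "K \<subseteq> ?K"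
     "pairwise (\<lambda>i j. disjnt (cball (fst i) (snd i)) (cball (fst j) (snd j))) K"
     "negligible (U - (\<Union>i\<in>K. cball (fst i) (snd i)))"
  proof (rule Vitali_covering_theorem_cballs[of ?K snd U fst])
    show "0 < snd i" if "i \<in> ?K" for i using that by auto
    show "\<exists>i. i \<in> ?K \<and> x \<in> cball (fst i) (snd i) \<and> snd i < d" if "x \<in> U" "0 < d" for x d
    proof -
      obtain s where "s > 0" "cball x s \<subseteq> U"
        using open_contains_cball[THEN iffD1, OF U(1)] \<open>x \<in> U\<close> by blast
      moreover define t where "t = min s (min (\<delta>/2) (d/2))"
      ultimately have "0 < t" "t \<le> \<delta> / 2" "t < d" "cball x t \<subseteq> U"
        using \<delta> that(2) subset_cball[of t s x] by (simp_all add: min_less_iff_disj min_le_iff_disj)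
      then show ?thesis by (intro exI[of _ "(x, t)"]) simp
    qed
  qed (rule that)
  have Kr: "0 < snd i" "snd i \<le> \<delta> / 2" "cball (fst i) (snd i) \<subseteq> U" if "i \<in> K" for i
    using subsetD[OF K(2) that] by (simp_all add: case_prod_beta)
  let ?V = "\<Union>i\<in>K. cball (fst i) (snd i)"
  have "hausdorff_pre DIM('a) \<delta> U \<le> hausdorff_pre DIM('a) \<delta> (?V \<union> (U - ?V))"
    by (rule hausdorff_pre_mono) auto
  also have "\<dots> \<le> hausdorff_pre DIM('a) \<delta> ?V + hausdorff_pre DIM('a) \<delta> (U - ?V)"
    by (rule hausdorff_pre_Un[OF \<delta>])
  also have "hausdorff_pre DIM('a) \<delta> (U - ?V) = 0" by (rule hausdorff_pre_negligible[OF K(4) \<delta>])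
  also have "hausdorff_pre DIM('a) \<delta> ?V \<le> (\<integral>\<^sup>+i. hausdorff_weight DIM('a) (cball (fst i) (snd i)) \<partial>count_space K)"
  proof (rule hausdorff_pre_le_countable[OF K(1) order_refl])
    show "diameter (cball (fst i) (snd i)) \<le> \<delta>" if "i \<in> K" for i
      using Kr[OF that] by simp
  qed (use \<delta> in auto)
  also have "\<dots> = (\<integral>\<^sup>+i. emeasure lborel (cball (fst i) (snd i)) \<partial>count_space K)"
    by (intro nn_integral_cong hausdorff_weight_cball) (simp add: Kr(1) less_imp_le)
  also have "\<dots> = emeasure lborel ?V" by (rule emeasure_disjoint_cballs[OF K(1,3)])
  also have "\<dots> \<le> emeasure lborel U"
  proof (rule emeasure_mono)
    show "?V \<subseteq> U" using Kr(3) by blast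
  qed (use U in auto)
  finally show "hausdorff_pre DIM('a) \<delta> U \<le> emeasure lborel U" by (simp add: add_right_mono)
qed

theorem hausdorff_outer_eq_lborel:
  fixes A :: "'a::euclidean_space set"
  assumes A: "A \<in> sets borel"
  shows "hausdorff_outer DIM('a) A = emeasure lborel A"
proof (rule antisym[OF ennreal_le_epsilon lborel_le_hausdorff_outer[OF A]])
  fix e :: real assume e: "0 < e"
  obtain U where U: "open U" "A \<subseteq> U" "emeasure lborel (U - A) < ennreal e"
    using outer_regular_lborel[OF A e] by metis
  have "hausdorff_outer DIM('a) A \<le> hausdorff_outer DIM('a) U" using U by (intro hausdorff_outer_mono)
  also have "\<dots> \<le> emeasure lborel U" by (rule hausdorff_outer_open_le[OF U(1)])
  also have "\<dots> = emeasure lborel (A \<union> (U - A))" using U by (simp add: Un_absorb1)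
  also have "\<dots> \<le> emeasure lborel A + emeasure lborel (U - A)"
    using A U by (intro emeasure_subadditive) auto
  also have "\<dots> \<le> emeasure lborel A + ennreal e" using U by (intro add_left_mono) auto
  finally show "hausdorff_outer DIM('a) A \<le> emeasure lborel A + ennreal e" .
qed

section \<open>Hausdorff measure of Lipschitz images\<close>

lemma le_cmult_if:
  fixes x y :: ennreal
  assumes c: "0 < c" and le: "ennreal (1 / c) * x \<le> y"
  shows "x \<le> ennreal c * y"
proof -
  have "x = ennreal c * (ennreal (1 / c) * x)"
    using c by (simp add: mult.assoc[symmetric] ennreal_mult[symmetric])
  also have "\<dots> \<le> ennreal c * y" using le by (intro mult_left_mono) auto
  finally show ?thesis .
qed

lemma hausdorff_outer_lipschitz:
  fixes f :: "'a::metric_space \<Rightarrow> 'b::metric_space"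
  assumes L: "0 < L" and f: "\<And>x y. x \<in> A \<Longrightarrow> y \<in> A \<Longrightarrow> dist (f x) (f y) \<le> L * dist x y"
  shows "hausdorff_outer d (f ` A) \<le> ennreal (L ^ d) * hausdorff_outer d A"
  unfolding hausdorff_outer_def[of d "f ` A"]
proof (rule SUP_least)
  fix \<delta> :: real assume "\<delta> \<in> {0<..}"
  then have \<delta>: "0 < \<delta> / L" using L by simp
  have "hausdorff_pre d \<delta> (f ` A) \<le> ennreal (L ^ d) * hausdorff_pre d (\<delta> / L) A"
  proof (rule le_cmult_if)
    show "ennreal (1 / L ^ d) * hausdorff_pre d \<delta> (f ` A) \<le> hausdorff_pre d (\<delta> / L) A"
      unfolding hausdorff_pre_def[of d "\<delta> / L"]
    proof (safe intro!: INF_greatest)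
      fix C :: "nat \<Rightarrow> 'a set"
      assume C: "A \<subseteq> (\<Union>i. C i)" "\<forall>i. bounded (C i) \<and> diameter (C i) \<le> \<delta> / L"
      have d: "dist (f x) (f y) \<le> L * diameter (C i)" if "x \<in> C i \<inter> A" "y \<in> C i \<inter> A" for x y i
      proof -
        have "dist (f x) (f y) \<le> L * dist x y" using f that by auto
        also have "\<dots> \<le> L * diameter (C i)"
          using C(2) that L by (intro mult_left_mono diameter_bounded_bound) auto
        finally show ?thesis .
      qed
      have diam: "diameter (f ` (C i \<inter> A)) \<le> L * diameter (C i)" for i
        using C(2) L diameter_ge_0[of "C i"] d[where i=i]
        by (auto simp: diameter_def[of "f ` _"] intro!: cSUP_least)
      have bdd: "bounded (f ` (C i \<inter> A))" for i
        using d unfolding bounded_two_points by blast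
      have "hausdorff_pre d \<delta> (f ` A) \<le> (\<Sum>i. hausdorff_weight d (f ` (C i \<inter> A)))"
      proof (rule hausdorff_pre_le)
        show "f ` A \<subseteq> (\<Union>i. f ` (C i \<inter> A))" using C(1) by blast
        show "diameter (f ` (C i \<inter> A)) \<le> \<delta>" for i
        proof -
          have "L * diameter (C i) \<le> L * (\<delta> / L)" using C(2) L by (intro mult_left_mono) auto
          then show ?thesis using diam[of i] L by simp
        qed
      qed (rule bdd)
      also have "\<dots> \<le> (\<Sum>i. ennreal (L ^ d) * hausdorff_weight d (C i))"
      proof (intro suminf_le)
        fix i
        have "diameter (C i) \<ge> 0" using C(2) by (simp add: diameter_ge_0)
        moreover have "0 \<le> diameter (f ` (C i \<inter> A))" using bdd by (rule diameter_ge_0)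
        ultimately have "(diameter (f ` (C i \<inter> A)) / 2) ^ d \<le> L ^ d * (diameter (C i) / 2) ^ d"
          using diam[of i] unfolding power_mult_distrib[symmetric] by (intro power_mono) auto
        then show "hausdorff_weight d (f ` (C i \<inter> A)) \<le> ennreal (L ^ d) * hausdorff_weight d (C i)"
          using L by (auto simp: hausdorff_weight_def ennreal_mult'[symmetric] mult.left_commute
              intro!: ennreal_leI mult_left_mono)
      qed auto
      also have "\<dots> = ennreal (L ^ d) * (\<Sum>i. hausdorff_weight d (C i))" by simp
      finally have "ennreal (1 / L ^ d) * hausdorff_pre d \<delta> (f ` A)
          \<le> ennreal (1 / L ^ d) * (ennreal (L ^ d) * (\<Sum>i. hausdorff_weight d (C i)))"
        by (intro mult_left_mono) auto
      also have "\<dots> = (\<Sum>i. hausdorff_weight d (C i))"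
        using L by (simp add: mult.assoc[symmetric] ennreal_mult[symmetric])
      finally show "ennreal (1 / L ^ d) * hausdorff_pre d \<delta> (f ` A) \<le> (\<Sum>i. hausdorff_weight d (C i))" .
    qed
  qed (use L in auto)
  also have "\<dots> \<le> ennreal (L ^ d) * hausdorff_outer d A"
    by (intro mult_left_mono hausdorff_pre_le_outer \<delta>) auto
  finally show "hausdorff_pre d \<delta> (f ` A) \<le> ennreal (L ^ d) * hausdorff_outer d A" .
qed

lemma hausdorff_outer_isometry:
  fixes f :: "'a::metric_space \<Rightarrow> 'b::metric_space"
  assumes "\<And>x y. x \<in> A \<Longrightarrow> y \<in> A \<Longrightarrow> dist (f x) (f y) = dist x y"
  shows "hausdorff_outer d (f ` A) = hausdorff_outer d A"
proof (rule antisym)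
  show "hausdorff_outer d (f ` A) \<le> hausdorff_outer d A"
    using hausdorff_outer_lipschitz[of 1 A f d] assms by simp
  have inj: "inj_on f A" using assms by (metis dist_eq_0_iff inj_onI)
  have "dist (inv_into A f x) (inv_into A f y) \<le> 1 * dist x y" if "x \<in> f ` A" "y \<in> f ` A" for x y
    using that inj by (auto simp: assms)
  then have "hausdorff_outer d (inv_into A f ` (f ` A)) \<le> hausdorff_outer d (f ` A)"
    using hausdorff_outer_lipschitz[of 1 "f ` A" "inv_into A f" d] by simp
  then show "hausdorff_outer d A \<le> hausdorff_outer d (f ` A)" using inj by simp
qed

text \<open>
  The isometry may go between different types. As Hausdorff measure depends on the metric only, no
  determinants are involved.
\<close>

lemma emeasure_lborel_isometry:
  fixes f :: "'a::euclidean_space \<Rightarrow> 'b::euclidean_space"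
  assumes "DIM('a) = DIM('b)" "A \<in> sets borel" "f ` A \<in> sets borel"
    and "\<And>x y. x \<in> A \<Longrightarrow> y \<in> A \<Longrightarrow> dist (f x) (f y) = dist x y"
  shows "emeasure lborel (f ` A) = emeasure lborel A"
  using assms hausdorff_outer_isometry[of A f "DIM('a)"]
  by (simp flip: hausdorff_outer_eq_lborel)

section \<open>Polar coordinates\<close>

text \<open>
  The surface measure of the sphere as it comes out of polar coordinates: \<open>d\<close> times the volume of the
  cone, with apex \<open>0\<close> and height \<open>1\<close>, over a subset of the sphere.
\<close>

definition cone_measure :: "'a::euclidean_space measure" where
  "cone_measure =
     distr (density lborel (\<lambda>z. ennreal DIM('a) * indicator (cball 0 1 - {0}) z)) borel sgn"

lemma space_cone_measure [simp]: "space cone_measure = UNIV"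
  by (simp add: cone_measure_def)

lemma sets_cone_measure [simp, measurable_cong]: "sets cone_measure = sets borel"
  by (simp add: cone_measure_def)

lemma sgn_section_borel:
  fixes A :: "'a::real_normed_vector set"
  assumes A: "A \<in> sets borel" and P: "{z. P z} \<in> sets borel"
  shows "{z. P z \<and> sgn z \<in> A} \<in> sets borel"
proof -
  have "sgn -` A \<inter> space borel \<in> sets (borel :: 'a measure)"
    by (rule measurable_sets[OF borel_measurable_sgn A])
  then have "{z. P z} \<inter> sgn -` A \<in> sets borel" using P by auto
  also have "{z. P z} \<inter> sgn -` A = {z. P z \<and> sgn z \<in> A}" by auto
  finally show ?thesis .
qed

lemma punctured_cball_borel: "{z::'a::euclidean_space. z \<noteq> 0 \<and> norm z \<le> r} \<in> sets borel"
proof -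
  have "{z::'a. z \<noteq> 0 \<and> norm z \<le> r} = cball 0 r - {0}" by auto
  then show ?thesis by simp
qed

abbreviation unit_cone :: "'a::real_normed_vector set \<Rightarrow> 'a set" where
  "unit_cone A \<equiv> {z. (z \<noteq> 0 \<and> norm z \<le> 1) \<and> sgn z \<in> A}"

lemma emeasure_cone_measure:
  fixes A :: "'a::euclidean_space set"
  assumes A: "A \<in> sets borel"
  shows "emeasure cone_measure A
    = ennreal DIM('a) * emeasure lborel (unit_cone A)"
proof -
  have m: "sgn -` A \<inter> space borel \<in> sets (borel :: 'a measure)"
    by (rule measurable_sets[OF borel_measurable_sgn A])
  have "emeasure cone_measure A
    = (\<integral>\<^sup>+z. ennreal DIM('a) * indicator (cball 0 1 - {0}) z * indicator (sgn -` A) z \<partial>lborel)"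
    unfolding cone_measure_def
  proof (subst emeasure_distr)
    show "emeasure (density lborel (\<lambda>z. ennreal DIM('a) * indicator (cball 0 1 - {0}) z))
        (sgn -` A \<inter> space (density lborel (\<lambda>z. ennreal DIM('a) * indicator (cball 0 1 - {0}) z)))
      = (\<integral>\<^sup>+z. ennreal DIM('a) * indicator (cball 0 1 - {0}) z * indicator (sgn -` A) z \<partial>lborel)"
    proof (subst emeasure_density)
      show "(\<lambda>z. ennreal DIM('a) * indicator (cball 0 1 - {0}) z) \<in> borel_measurable lborel"
        by (intro borel_measurable_times_ennreal borel_measurable_const borel_measurable_indicator) simp
    qed (use m in simp_all)
  qed (use A in auto)
  also have "\<dots> = (\<integral>\<^sup>+z. ennreal DIM('a) *
      indicator (unit_cone A) z \<partial>lborel)"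
    by (intro nn_integral_cong) (auto split: split_indicator)
  also have "\<dots> = ennreal DIM('a) * emeasure lborel (unit_cone A)"
    using sgn_section_borel[OF A punctured_cball_borel[of 1]] by (simp add: nn_integral_cmult)
  finally show ?thesis .
qed

lemma emeasure_cone_measure_finite:
  "emeasure (cone_measure :: 'a::euclidean_space measure) A < top"
proof (cases "A \<in> sets borel")
  case True
  have "emeasure lborel (unit_cone A) \<le> emeasure lborel (cball (0::'a) 1)"
    by (intro emeasure_mono) auto
  also have "\<dots> < top" by (simp add: emeasure_cball)
  finally show ?thesis using True by (simp add: emeasure_cone_measure ennreal_mult_less_top)
next
  case False
  then show ?thesis by (simp add: emeasure_notin_sets)
qed

lemma finite_measure_cone_measure: "finite_measure (cone_measure :: 'a::euclidean_space measure)"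
  using emeasure_cone_measure_finite[of "UNIV :: 'a set"] by (intro finite_measureI) auto

lemma emeasure_cone_measure_off_sphere:
  "emeasure (cone_measure :: 'a::euclidean_space measure) (- sphere 0 1) = 0"
proof -
  have "{z. (z \<noteq> 0 \<and> norm z \<le> 1) \<and> sgn z \<in> - sphere (0::'a) 1} = {}"
    by (auto simp: norm_sgn)
  moreover have "- sphere (0::'a) 1 \<in> sets borel" by (intro borel_comp borel_closed closed_sphere)
  ultimately show ?thesis by (simp only: emeasure_cone_measure emeasure_empty mult_zero_right)
qed

lemma AE_cone_measure_norm: "AE w in (cone_measure :: 'a::euclidean_space measure). norm w = 1"
  using emeasure_cone_measure_off_sphere
  by (intro AE_I[of _ _ "- sphere 0 1"]) auto

text \<open>
  This homogeneity is the reason why polar coordinates give a product measure.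
\<close>

lemma emeasure_cone_scale:
  fixes A :: "'a::euclidean_space set"
  assumes A: "A \<in> sets borel" and a: "0 < a"
  shows "emeasure lborel {z. (z \<noteq> 0 \<and> norm z \<le> a) \<and> sgn z \<in> A}
    = ennreal (a ^ DIM('a)) * emeasure lborel (unit_cone A)"
proof -
  let ?C = "\<lambda>a. {z. (z \<noteq> 0 \<and> norm z \<le> a) \<and> sgn z \<in> A}"
  have "?C a = (\<lambda>z. a *\<^sub>R z + 0) ` ?C 1"
  proof (intro equalityI subsetI)
    fix z assume z: "z \<in> ?C a"
    have "(1 / a) *\<^sub>R z \<in> ?C 1" using z a by (auto simp: sgn_scaleR field_simps)
    then show "z \<in> (\<lambda>z. a *\<^sub>R z + 0) ` ?C 1"
      using a by (intro image_eqI[of _ _ "(1 / a) *\<^sub>R z"]) auto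
  qed (use a in \<open>auto simp: sgn_scaleR mult_left_le\<close>)
  then have "emeasure lebesgue (?C a) = emeasure lebesgue ((\<lambda>z. a *\<^sub>R z + 0) ` ?C 1)" by simp
  also have "\<dots> = ennreal (\<bar>a\<bar> ^ DIM('a)) * emeasure lebesgue (?C 1)"
    by (rule emeasure_lebesgue_affine)
  finally have "emeasure lebesgue (?C a) = ennreal (\<bar>a\<bar> ^ DIM('a)) * emeasure lebesgue (?C 1)" .
  then show ?thesis
    using a sgn_section_borel[OF A punctured_cball_borel, of 1] sgn_section_borel[OF A punctured_cball_borel, of a]
    by simp
qed

definition radial_measure :: "nat \<Rightarrow> real measure" where
  "radial_measure n = density lborel (\<lambda>r. ennreal (r ^ (n - 1)) * indicator {0<..} r)"

lemma space_radial_measure [simp]: "space (radial_measure n) = UNIV"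
  by (simp add: radial_measure_def)

lemma sets_radial_measure [simp, measurable_cong]: "sets (radial_measure n) = sets borel"
  by (simp add: radial_measure_def)

lemma sigma_finite_radial_measure: "sigma_finite_measure (radial_measure n)"
  unfolding radial_measure_def
  by (subst sigma_finite_measure.sigma_finite_iff_density_finite[OF lborel.sigma_finite_measure_axioms]) (auto simp: ennreal_mult_eq_top_iff split: split_indicator)

lemma emeasure_radial_measure_atMost:
  assumes n: "0 < n"
  shows "emeasure (radial_measure n) {..a} = (if 0 < a then ennreal (a ^ n / n) else 0)"
proof -
  have e: "emeasure (radial_measure n) {..a} = (\<integral>\<^sup>+r. ennreal (r ^ (n - 1)) * indicator {0<..} r * indicator {..a} r \<partial>lborel)"
    unfolding radial_measure_def by (subst emeasure_density) auto
  show ?thesis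
  proof (cases "0 < a")
    case True
    have "(\<integral>\<^sup>+r. ennreal (r ^ (n - 1)) * indicator {0<..} r * indicator {..a} r \<partial>lborel)
        = (\<integral>\<^sup>+r. ennreal (r ^ (n - 1)) * indicator {0..a} r \<partial>lborel)"
    proof (rule nn_integral_cong_AE)
      show "AE r in lborel. ennreal (r ^ (n - 1)) * indicator {0<..} r * indicator {..a} r
          = ennreal (r ^ (n - 1)) * indicator {0..a} r"
        using AE_lborel_singleton[of 0] by eventually_elim (auto split: split_indicator)
    qed
    also have "\<dots> = ennreal (a ^ n / n - 0 ^ n / n)"
    proof (rule nn_integral_FTC_Icc)
      show "((\<lambda>r. r ^ n / real n) has_real_derivative r ^ (n - 1)) (at r)" for r
        using n by (auto intro!: derivative_eq_intros)
    qed (use True in auto)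
    finally show ?thesis using e True n by (simp add: power_0_left)
  next
    case False
    then have "(\<integral>\<^sup>+r. ennreal (r ^ (n - 1)) * indicator {0<..} r * indicator {..a} r \<partial>lborel) = (\<integral>\<^sup>+r. 0 \<partial>(lborel :: real measure))"
      by (intro nn_integral_cong) (auto split: split_indicator)
    then show ?thesis using e False by simp
  qed
qed

text \<open>
  On a product of an angular set \<open>A\<close> and a radial set \<open>B\<close> both sides are measures in \<open>B\<close>. They agree for
  \<open>B = (-\<infinity>, a]\<close> by homogeneity, and these intervals generate the Borel sets.
\<close>

lemma polar_product:
  "(cone_measure :: 'a::euclidean_space measure) \<Otimes>\<^sub>M radial_measure DIM('a)
     = distr (density lborel (indicator (- {0}))) (borel \<Otimes>\<^sub>M borel) (\<lambda>z. (sgn z, norm z))"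
proof (rule pair_measure_eqI)
  show "sigma_finite_measure (cone_measure :: 'a measure)"
    by (rule finite_measure.axioms(1)[OF finite_measure_cone_measure])
  show "sigma_finite_measure (radial_measure DIM('a))" by (rule sigma_finite_radial_measure)
  show "sets ((cone_measure :: 'a measure) \<Otimes>\<^sub>M radial_measure DIM('a))
      = sets (distr (density lborel (indicator (- {0}))) (borel \<Otimes>\<^sub>M borel) (\<lambda>z::'a. (sgn z, norm z)))"
    unfolding sets_distr by (rule sets_pair_measure_cong) simp_all
  fix A :: "'a set" and B :: "real set" assume "A \<in> sets cone_measure" "B \<in> sets (radial_measure DIM('a))"
  then have A: "A \<in> sets borel" and B: "B \<in> sets borel" by auto
  define M where "M = distr (density lborel (indicator {z. z \<noteq> 0 \<and> sgn z \<in> A})) borel (norm :: 'a \<Rightarrow> real)"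
  define N where "N = scale_measure (emeasure cone_measure A) (radial_measure DIM('a))"
  have Am: "{z. z \<noteq> 0 \<and> sgn z \<in> A} \<in> sets borel" by (rule sgn_section_borel[OF A]) simp
  have Memb: "emeasure M X = emeasure lborel {z. (z \<noteq> 0 \<and> norm z \<in> X) \<and> sgn z \<in> A}" if X: "X \<in> sets borel" for X
  proof -
    have X': "norm -` X \<inter> space borel \<in> sets (borel :: 'a measure)"
      by (rule measurable_sets[OF _ X]) simp
    have "emeasure M X = (\<integral>\<^sup>+z. indicator {z. z \<noteq> 0 \<and> sgn z \<in> A} z * indicator (norm -` X) z \<partial>lborel)"
      unfolding M_def using X X' Am by (subst emeasure_distr) (auto simp: emeasure_density)
    also have "\<dots> = (\<integral>\<^sup>+z. indicator ({z. z \<noteq> 0 \<and> sgn z \<in> A} \<inter> norm -` X) z \<partial>lborel)"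
      by (intro nn_integral_cong) (auto split: split_indicator)
    also have "\<dots> = emeasure lborel ({z. z \<noteq> 0 \<and> sgn z \<in> A} \<inter> norm -` X)"
      using X' Am by (intro nn_integral_indicator) auto
    also have "{z. z \<noteq> 0 \<and> sgn z \<in> A} \<inter> norm -` X = {z. (z \<noteq> 0 \<and> norm z \<in> X) \<and> sgn z \<in> A}" by auto
    finally show ?thesis .
  qed
  have MN: "emeasure M {..a} = emeasure N {..a}" for a
  proof (cases "0 < a")
    case True
    have "emeasure M {..a} = ennreal (a ^ DIM('a)) * emeasure lborel (unit_cone A)"
      using emeasure_cone_scale[OF A True] by (simp add: Memb)
    also have "\<dots> = emeasure cone_measure A * ennreal (a ^ DIM('a) / DIM('a))"
    proof -
      have "ennreal (a ^ DIM('a)) = ennreal DIM('a) * ennreal (a ^ DIM('a) / DIM('a))"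
        using True by (subst ennreal_mult[symmetric]) auto
      then show ?thesis by (simp add: emeasure_cone_measure[OF A] mult_ac)
    qed
    also have "\<dots> = emeasure N {..a}" using True by (simp add: N_def emeasure_radial_measure_atMost)
    finally show ?thesis .
  next
    case False
    then have e: "{z. (z \<noteq> 0 \<and> norm z \<in> {..a}) \<and> sgn z \<in> A} = {}"
      by (auto simp: not_less) (metis norm_le_zero_iff order_trans)
    have "emeasure M {..a} = 0" by (subst Memb) (simp_all only: e, simp_all)
    then show ?thesis using False by (simp add: N_def emeasure_radial_measure_atMost)
  qed
  have "M = N"
  proof (rule measure_eqI_generator_eq[where E="range atMost" and \<Omega>=UNIV and A="\<lambda>i. {..real i}"])
    show "Int_stable (range atMost :: real set set)" by (auto simp: Int_stable_def)
    show "sets M = sigma_sets UNIV (range atMost)" "sets N = sigma_sets UNIV (range atMost)"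
      by (auto simp: M_def N_def borel_eq_atMost)
    show "(\<Union>i. {..real i}) = UNIV" by (auto intro: real_arch_simple)
    show "emeasure M {..real i} \<noteq> \<infinity>" for i
      using emeasure_cone_measure_finite[of A]
      by (auto simp: MN N_def emeasure_radial_measure_atMost ennreal_mult_eq_top_iff)
  qed (auto simp: MN)
  have P: "(\<lambda>z::'a. (sgn z, norm z)) -` (A \<times> B) \<inter> space borel \<in> sets borel"
    by (rule measurable_sets[of _ _ "borel \<Otimes>\<^sub>M borel"]) (use A B in auto)
  have "emeasure cone_measure A * emeasure (radial_measure DIM('a)) B = emeasure N B"
    by (simp add: N_def)
  also have "\<dots> = emeasure lborel {z. (z \<noteq> 0 \<and> norm z \<in> B) \<and> sgn z \<in> A}"
    using Memb[OF B] \<open>M = N\<close> by simp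
  also have "{z. (z \<noteq> 0 \<and> norm z \<in> B) \<and> sgn z \<in> A} = - {0} \<inter> (\<lambda>z. (sgn z, norm z)) -` (A \<times> B)" by auto
  also have "emeasure lborel \<dots> = (\<integral>\<^sup>+z. indicator (- {0} \<inter> (\<lambda>z::'a. (sgn z, norm z)) -` (A \<times> B)) z \<partial>lborel)"
    using P by (intro nn_integral_indicator[symmetric]) auto
  also have "\<dots> = (\<integral>\<^sup>+z. indicator (- {0}) z * indicator ((\<lambda>z::'a. (sgn z, norm z)) -` (A \<times> B)) z \<partial>lborel)"
    by (intro nn_integral_cong) (auto split: split_indicator)
  also have "\<dots> = emeasure (distr (density lborel (indicator (- {0}))) (borel \<Otimes>\<^sub>M borel) (\<lambda>z::'a. (sgn z, norm z))) (A \<times> B)"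
    using P A B by (subst emeasure_distr) (auto simp: emeasure_density)
  finally show "emeasure cone_measure A * emeasure (radial_measure DIM('a)) B =
     emeasure (distr (density lborel (indicator (- {0}))) (borel \<Otimes>\<^sub>M borel) (\<lambda>z::'a. (sgn z, norm z))) (A \<times> B)" .
qed

theorem nn_integral_polar:
  fixes f :: "'a::euclidean_space \<Rightarrow> ennreal"
  assumes f[measurable]: "f \<in> borel_measurable borel"
  shows "(\<integral>\<^sup>+z. f z \<partial>lborel)
    = (\<integral>\<^sup>+w. (\<integral>\<^sup>+r\<in>{0<..}. f (r *\<^sub>R w) * ennreal (r ^ (DIM('a) - 1)) \<partial>lborel) \<partial>cone_measure)"
proof -
  interpret R: sigma_finite_measure "radial_measure DIM('a)" by (rule sigma_finite_radial_measure)
  have mf: "(\<lambda>p. f (snd p *\<^sub>R fst p)) \<in> borel_measurable (borel \<Otimes>\<^sub>M (borel :: real measure))"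
    by measurable
  have "(\<integral>\<^sup>+z. f z \<partial>lborel) = (\<integral>\<^sup>+z. indicator (- {0}) z * f (norm z *\<^sub>R sgn z) \<partial>lborel)"
  proof (rule nn_integral_cong_AE)
    show "AE z in lborel. f z = indicator (- {0}) z * f (norm z *\<^sub>R sgn z)"
      using AE_lborel_singleton[of 0] by eventually_elim (auto simp: sgn_div_norm)
  qed
  also have "\<dots> = (\<integral>\<^sup>+z. f (norm z *\<^sub>R sgn z) \<partial>density lborel (indicator (- {0})))"
    by (subst nn_integral_density) auto
  also have "\<dots> = (\<integral>\<^sup>+p. f (snd p *\<^sub>R fst p) \<partial>(cone_measure \<Otimes>\<^sub>M radial_measure DIM('a)))"
    unfolding polar_product by (subst nn_integral_distr) (use mf in auto)
  also have "\<dots> = (\<integral>\<^sup>+w. (\<integral>\<^sup>+r. f (r *\<^sub>R w) \<partial>radial_measure DIM('a)) \<partial>cone_measure)"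
  proof (subst R.nn_integral_fst[symmetric])
    show "(\<lambda>p. f (snd p *\<^sub>R fst p)) \<in> borel_measurable (cone_measure \<Otimes>\<^sub>M radial_measure DIM('a))"
      by measurable
  qed simp
  also have "(\<lambda>w::'a. (\<integral>\<^sup>+r. f (r *\<^sub>R w) \<partial>radial_measure DIM('a)))
     = (\<lambda>w. (\<integral>\<^sup>+r\<in>{0<..}. f (r *\<^sub>R w) * ennreal (r ^ (DIM('a) - 1)) \<partial>lborel))"
    unfolding radial_measure_def
    by (rule ext, subst nn_integral_density) (auto intro!: nn_integral_cong simp: mult_ac split: split_indicator)
  finally show ?thesis .
qed

text \<open>
  The weight \<open>\<bar>z\<bar>\<^sup>-\<^sup>d\<close> turns the radial measure into the scale invariant measure \<open>dr / r\<close>.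
\<close>

corollary nn_integral_polar_scale_invariant:
  fixes f :: "'a::euclidean_space \<Rightarrow> ennreal"
  assumes f[measurable]: "f \<in> borel_measurable borel"
  shows "(\<integral>\<^sup>+z. f z * ennreal (1 / norm z ^ DIM('a)) \<partial>lborel)
    = (\<integral>\<^sup>+w. (\<integral>\<^sup>+r\<in>{0<..}. f (r *\<^sub>R w) * ennreal (1 / r) \<partial>lborel) \<partial>cone_measure)"
proof -
  have "(\<integral>\<^sup>+z. f z * ennreal (1 / norm z ^ DIM('a)) \<partial>lborel)
    = (\<integral>\<^sup>+w. (\<integral>\<^sup>+r\<in>{0<..}. f (r *\<^sub>R w) * ennreal (1 / norm (r *\<^sub>R w) ^ DIM('a)) * ennreal (r ^ (DIM('a) - 1)) \<partial>lborel)
        \<partial>cone_measure)"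
    by (rule nn_integral_polar) measurable
  also have "\<dots> = (\<integral>\<^sup>+w. (\<integral>\<^sup>+r\<in>{0<..}. f (r *\<^sub>R w) * ennreal (1 / r) \<partial>lborel) \<partial>cone_measure)"
  proof (rule nn_integral_cong_AE)
    show "AE w in (cone_measure :: 'a measure).
        (\<integral>\<^sup>+r\<in>{0<..}. f (r *\<^sub>R w) * ennreal (1 / norm (r *\<^sub>R w) ^ DIM('a)) * ennreal (r ^ (DIM('a) - 1)) \<partial>lborel)
      = (\<integral>\<^sup>+r\<in>{0<..}. f (r *\<^sub>R w) * ennreal (1 / r) \<partial>lborel)"
      using AE_cone_measure_norm
    proof eventually_elim
      case (elim w)
      have "ennreal (1 / norm (r *\<^sub>R w) ^ DIM('a)) * ennreal (r ^ (DIM('a) - 1)) = ennreal (1 / r)" if "0 < r" for r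
      proof -
        have "r ^ DIM('a) = r * r ^ (DIM('a) - 1)"
          by (metis DIM_positive Suc_diff_1 power_Suc)
        then have "1 / r ^ DIM('a) * r ^ (DIM('a) - 1) = 1 / r" using that by simp
        then show ?thesis using that elim by (simp flip: ennreal_mult)
      qed
      then show ?case
        by (intro nn_integral_cong) (auto simp: mult.assoc split: split_indicator)
    qed
  qed
  finally show ?thesis .
qed

corollary nn_integral_polar_unit_ball:
  fixes f :: "'a::euclidean_space \<Rightarrow> ennreal"
  assumes f[measurable]: "f \<in> borel_measurable borel"
  shows "(\<integral>\<^sup>+z\<in>cball 0 1. f z * ennreal (1 / norm z ^ DIM('a)) \<partial>lborel)
    = (\<integral>\<^sup>+w. (\<integral>\<^sup>+r\<in>{0<..1}. f (r *\<^sub>R w) * ennreal (1 / r) \<partial>lborel) \<partial>cone_measure)"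
proof -
  have [measurable]: "cball (0::'a) 1 \<in> sets borel" by simp
  have "(\<integral>\<^sup>+z\<in>cball 0 1. f z * ennreal (1 / norm z ^ DIM('a)) \<partial>lborel)
    = (\<integral>\<^sup>+z. f z * indicator (cball 0 1) z * ennreal (1 / norm z ^ DIM('a)) \<partial>lborel)"
    by (simp add: mult_ac)
  also have "\<dots> = (\<integral>\<^sup>+w. (\<integral>\<^sup>+r\<in>{0<..}. f (r *\<^sub>R w) * indicator (cball 0 1) (r *\<^sub>R w) * ennreal (1 / r) \<partial>lborel) \<partial>cone_measure)"
    by (rule nn_integral_polar_scale_invariant) measurable
  also have "\<dots> = (\<integral>\<^sup>+w. (\<integral>\<^sup>+r\<in>{0<..1}. f (r *\<^sub>R w) * ennreal (1 / r) \<partial>lborel) \<partial>cone_measure)"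
  proof (rule nn_integral_cong_AE)
    show "AE w in (cone_measure :: 'a measure).
      (\<integral>\<^sup>+r\<in>{0<..}. f (r *\<^sub>R w) * indicator (cball 0 1) (r *\<^sub>R w) * ennreal (1 / r) \<partial>lborel)
      = (\<integral>\<^sup>+r\<in>{0<..1}. f (r *\<^sub>R w) * ennreal (1 / r) \<partial>lborel)"
      using AE_cone_measure_norm
      by eventually_elim (intro nn_integral_cong, auto split: split_indicator)
  qed
  finally show ?thesis .
qed

text \<open>
  The substitution \<open>r \<mapsto> r\<^sup>\<alpha>\<close> multiplies \<open>dr / r\<close> by \<open>\<alpha>\<close>. It is carried out on \<open>[a, 1]\<close> with \<open>a > 0\<close>, where
  the power is smooth, and \<open>a\<close> then tends to \<open>0\<close>.
\<close>

lemma nn_integral_dilate_radius: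
  fixes h :: "real \<Rightarrow> real"
  assumes h[measurable]: "h \<in> borel_measurable borel" and h0: "\<And>r. 0 \<le> h r" and \<alpha>: "0 < \<alpha>"
  shows "(\<integral>\<^sup>+r\<in>{0<..1}. ennreal (h r) * ennreal (1 / r) \<partial>lborel)
    = ennreal \<alpha> * (\<integral>\<^sup>+r\<in>{0<..1}. ennreal (h (r powr \<alpha>)) * ennreal (1 / r) \<partial>lborel)"
proof -
  define a where "a m = 1 / real (Suc m)" for m
  have a: "0 < a m" "a m \<le> 1" for m by (auto simp: a_def)
  have a_dec: "a n \<le> a m" if "m \<le> n" for m n using that by (simp add: a_def frac_le)
  have a_lim: "a \<longlonglongrightarrow> 0" unfolding a_def by (rule LIMSEQ_Suc[OF lim_1_over_n])
  have lim: "(\<lambda>m. \<integral>\<^sup>+r. F r * indicator {b m..1} r \<partial>lborel) \<longlonglongrightarrow> (\<integral>\<^sup>+r\<in>{0<..1}. F r \<partial>lborel)"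
    if F[measurable]: "F \<in> borel_measurable borel" and b: "\<And>m. 0 < b m" "\<And>m n. m \<le> n \<Longrightarrow> b n \<le> b m" "b \<longlonglongrightarrow> 0"
    for F :: "real \<Rightarrow> ennreal" and b :: "nat \<Rightarrow> real"
  proof (rule nn_integral_LIMSEQ)
    show "incseq (\<lambda>m r. F r * indicator {b m..1} r)"
      using b(2) by (intro monoI le_funI) (auto intro: order_trans split: split_indicator)
    show "(\<lambda>m. F r * indicator {b m..1} r) \<longlonglongrightarrow> F r * indicator {0<..1} r" for r
    proof (rule tendsto_eventually)
      show "\<forall>\<^sub>F m in sequentially. F r * indicator {b m..1} r = F r * indicator {0<..1} r"
      proof (cases "0 < r")
        case True
        with order_tendstoD(2)[OF b(3)] have "\<forall>\<^sub>F m in sequentially. b m < r" by blast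
        then show ?thesis by eventually_elim (use True in \<open>auto split: split_indicator\<close>)
      next
        case False
        then show ?thesis using b(1) by (intro always_eventually) (auto split: split_indicator dest: order.strict_trans2)
      qed
    qed
  qed measurable
  have sub: "(\<integral>\<^sup>+r. ennreal (h r) * ennreal (1 / r) * indicator {a m powr \<alpha>..1} r \<partial>lborel)
    = ennreal \<alpha> * (\<integral>\<^sup>+r. ennreal (h (r powr \<alpha>)) * ennreal (1 / r) * indicator {a m..1} r \<partial>lborel)" for m
  proof -
    have "(\<integral>\<^sup>+r. ennreal (h r) * ennreal (1 / r) * indicator {a m powr \<alpha>..1} r \<partial>lborel)
      = (\<integral>\<^sup>+r. ennreal (h r / r * indicator {a m powr \<alpha>..1 powr \<alpha>} r) \<partial>lborel)"
      using a(1)[of m] h0 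
      by (intro nn_integral_cong) (auto simp: ennreal_mult'[symmetric] split: split_indicator)
    also have "\<dots> = (\<integral>\<^sup>+r. ennreal (h (r powr \<alpha>) / r powr \<alpha> * (\<alpha> * r powr (\<alpha> - 1)) * indicator {a m..1} r) \<partial>lborel)"
    proof (rule nn_integral_substitution[where g="\<lambda>r. r powr \<alpha>"])
      show "set_borel_measurable borel {a m powr \<alpha>..1 powr \<alpha>} (\<lambda>r. h r / r)"
        unfolding set_borel_measurable_def by measurable
      show "((\<lambda>r. r powr \<alpha>) has_real_derivative \<alpha> * r powr (\<alpha> - 1)) (at r)" if "r \<in> {a m..1}" for r
        using that a(1)[of m] by (intro has_real_derivative_powr) auto
      show "continuous_on {a m..1} (\<lambda>r. \<alpha> * r powr (\<alpha> - 1))"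
        using a(1)[of m] by (intro continuous_intros) auto
    qed (use a \<alpha> in auto)
    also have "\<dots> = (\<integral>\<^sup>+r. ennreal \<alpha> * (ennreal (h (r powr \<alpha>)) * ennreal (1 / r) * indicator {a m..1} r) \<partial>lborel)"
    proof (intro nn_integral_cong)
      fix r
      show "ennreal (h (r powr \<alpha>) / r powr \<alpha> * (\<alpha> * r powr (\<alpha> - 1)) * indicator {a m..1} r)
        = ennreal \<alpha> * (ennreal (h (r powr \<alpha>)) * ennreal (1 / r) * indicator {a m..1} r)"
      proof (cases "r \<in> {a m..1}")
        case True
        then have r: "0 < r" using a(1)[of m] by auto
        have "h (r powr \<alpha>) / r powr \<alpha> * (\<alpha> * r powr (\<alpha> - 1)) = \<alpha> * (h (r powr \<alpha>) * (1 / r))"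
          using r by (simp add: powr_diff)
        then show ?thesis using True r \<alpha> h0 by (simp add: ennreal_mult[symmetric])
      qed auto
    qed
    also have "\<dots> = ennreal \<alpha> * (\<integral>\<^sup>+r. ennreal (h (r powr \<alpha>)) * ennreal (1 / r) * indicator {a m..1} r \<partial>lborel)"
      by (rule nn_integral_cmult) measurable
    finally show ?thesis .
  qed
  have "(\<lambda>m. \<integral>\<^sup>+r. ennreal (h r) * ennreal (1 / r) * indicator {a m powr \<alpha>..1} r \<partial>lborel)
      \<longlonglongrightarrow> (\<integral>\<^sup>+r\<in>{0<..1}. ennreal (h r) * ennreal (1 / r) \<partial>lborel)"
  proof (rule lim)
    show "a n powr \<alpha> \<le> a m powr \<alpha>" if "m \<le> n" for m n
      using a_dec[OF that] a(1)[of n] \<alpha> by (intro powr_mono2) (auto intro: less_imp_le)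
    show "(\<lambda>m. a m powr \<alpha>) \<longlonglongrightarrow> 0"
      using tendsto_powr'[OF a_lim tendsto_const[of \<alpha>]] \<alpha> less_imp_le[OF a(1)] by simp
  qed (use a(1) in \<open>auto simp: less_imp_neq[symmetric]\<close>)
  moreover have "(\<lambda>m. ennreal \<alpha> * (\<integral>\<^sup>+r. ennreal (h (r powr \<alpha>)) * ennreal (1 / r) * indicator {a m..1} r \<partial>lborel))
      \<longlonglongrightarrow> ennreal \<alpha> * (\<integral>\<^sup>+r\<in>{0<..1}. ennreal (h (r powr \<alpha>)) * ennreal (1 / r) \<partial>lborel)"
    by (intro ennreal_tendsto_cmult lim) (use a a_dec a_lim in auto)
  ultimately show ?thesis unfolding sub by (rule LIMSEQ_unique)
qed

text \<open>
  This is the change of variables that absorbs the factor \<open>1 - s\<close>, with \<open>\<alpha> = 1 / (1 - s)\<close>.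
\<close>

lemma nn_integral_radial_dilation:
  fixes f :: "'a::euclidean_space \<Rightarrow> real"
  assumes f[measurable]: "f \<in> borel_measurable borel" and f0: "\<And>z. 0 \<le> f z" and \<alpha>: "0 < \<alpha>"
  shows "(\<integral>\<^sup>+z\<in>cball 0 1. ennreal (f z) * ennreal (1 / norm z ^ DIM('a)) \<partial>lborel)
    = ennreal \<alpha> * (\<integral>\<^sup>+z\<in>cball 0 1. ennreal (f (norm z powr (\<alpha> - 1) *\<^sub>R z)) * ennreal (1 / norm z ^ DIM('a)) \<partial>lborel)"
proof -
  have "(\<integral>\<^sup>+z\<in>cball 0 1. ennreal (f z) * ennreal (1 / norm z ^ DIM('a)) \<partial>lborel)
    = (\<integral>\<^sup>+w. (\<integral>\<^sup>+r\<in>{0<..1}. ennreal (f (r *\<^sub>R w)) * ennreal (1 / r) \<partial>lborel) \<partial>cone_measure)"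
    by (rule nn_integral_polar_unit_ball) measurable
  also have "\<dots> = (\<integral>\<^sup>+w. ennreal \<alpha> * (\<integral>\<^sup>+r\<in>{0<..1}. ennreal (f ((r powr \<alpha>) *\<^sub>R w)) * ennreal (1 / r) \<partial>lborel) \<partial>cone_measure)"
    using \<alpha> f0 by (intro nn_integral_cong nn_integral_dilate_radius) auto
  also have "\<dots> = ennreal \<alpha> * (\<integral>\<^sup>+w. (\<integral>\<^sup>+r\<in>{0<..1}. ennreal (f ((r powr \<alpha>) *\<^sub>R w)) * ennreal (1 / r) \<partial>lborel) \<partial>cone_measure)"
    by (rule nn_integral_cmult) measurable
  also have "(\<integral>\<^sup>+w. (\<integral>\<^sup>+r\<in>{0<..1}. ennreal (f ((r powr \<alpha>) *\<^sub>R w)) * ennreal (1 / r) \<partial>lborel) \<partial>cone_measure)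
    = (\<integral>\<^sup>+w. (\<integral>\<^sup>+r\<in>{0<..1}. ennreal (f (norm (r *\<^sub>R w) powr (\<alpha> - 1) *\<^sub>R (r *\<^sub>R w))) * ennreal (1 / r) \<partial>lborel) \<partial>cone_measure)"
  proof (rule nn_integral_cong_AE)
    show "AE w in (cone_measure :: 'a measure).
       (\<integral>\<^sup>+r\<in>{0<..1}. ennreal (f ((r powr \<alpha>) *\<^sub>R w)) * ennreal (1 / r) \<partial>lborel)
       = (\<integral>\<^sup>+r\<in>{0<..1}. ennreal (f (norm (r *\<^sub>R w) powr (\<alpha> - 1) *\<^sub>R (r *\<^sub>R w))) * ennreal (1 / r) \<partial>lborel)"
      using AE_cone_measure_norm
    proof eventually_elim
      case (elim w)
      have "r powr (\<alpha> - 1) * r = r powr \<alpha>" if "0 < r" for r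
        using that by (simp add: powr_diff)
      then show ?case by (intro nn_integral_cong) (auto simp: elim split: split_indicator)
    qed
  qed
  also have "\<dots> = (\<integral>\<^sup>+z\<in>cball 0 1. ennreal (f (norm z powr (\<alpha> - 1) *\<^sub>R z)) * ennreal (1 / norm z ^ DIM('a)) \<partial>lborel)"
    by (rule nn_integral_polar_unit_ball[symmetric]) measurable
  finally show ?thesis .
qed

section \<open>Surface measure of the sphere\<close>

text \<open>
  Let \<open>W\<close> be the set of the points whose distance to the complement of \<open>U\<close> is at least \<open>e\<close>, and \<open>r < e\<close>.
  Integrate \<open>\<nu>(B(x, r)) \<ge> V\<close> with respect to \<open>\<mu>\<close> over \<open>W\<close>, exchange the order of integration, and use
  \<open>\<mu>(B(y, r)) \<le> c V\<close> for the points \<open>y\<close> of these balls, all of which lie in \<open>U\<close>. Dividing by \<open>V\<close> gives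
  \<open>\<mu>(W) \<le> c \<nu>(U)\<close>; here \<open>c > 1\<close> is arbitrary, and \<open>W\<close> increases to \<open>U\<close> as \<open>e\<close> tends to \<open>0\<close>.
\<close>

lemma emeasure_open_le_of_ball_comparison:
  fixes \<mu> \<nu> :: "'a::euclidean_space measure"
  assumes fin: "finite_measure \<mu>" "finite_measure \<nu>"
    and sets[measurable_cong]: "sets \<mu> = sets borel" "sets \<nu> = sets borel"
    and X[measurable]: "X \<in> sets borel" and null: "emeasure \<mu> (- X) = 0" "emeasure \<nu> (- X) = 0"
    and balls: "\<And>c. 1 < c \<Longrightarrow> \<forall>\<^sub>F r in at_right 0. \<exists>V. 0 < V \<and>
        (\<forall>x\<in>X. ennreal V \<le> emeasure \<nu> (ball x r) \<and> emeasure \<mu> (ball x r) \<le> ennreal (c * V))"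
    and U: "open U"
  shows "emeasure \<mu> U \<le> emeasure \<nu> U"
proof -
  interpret M: finite_measure \<mu> by fact
  interpret N: finite_measure \<nu> by fact
  interpret P: pair_sigma_finite \<mu> \<nu> ..
  have sp: "space \<mu> = UNIV" "space \<nu> = UNIV" using sets_eq_imp_space_eq[OF sets(1)] sets_eq_imp_space_eq[OF sets(2)] by simp_all
  have Um[measurable]: "U \<in> sets borel" using U by simp
  have AEX: "AE x in \<mu>. x \<in> X" "AE x in \<nu>. x \<in> X"
  proof -
    show "AE x in \<mu>. x \<in> X" by (rule AE_I[OF _ null(1)]) (use sets in auto)
    show "AE x in \<nu>. x \<in> X" by (rule AE_I[OF _ null(2)]) (use sets in auto)
  qed
  \<comment> \<open>The points whose distance to the complement of \<open>U\<close> is at least \<open>1 / (m + 1)\<close>.\<close>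
  define W where "W m = {x. ball x (1 / real (Suc m)) \<subseteq> U}" for m
  have Wc: "closed (W m)" for m
  proof -
    have "- W m = (\<Union>y\<in>- U. ball y (1 / real (Suc m)))"
    proof (rule set_eqI)
      fix x
      have "x \<in> - W m \<longleftrightarrow> (\<exists>y. dist x y < 1 / real (Suc m) \<and> y \<notin> U)"
        unfolding W_def by (simp add: subset_iff del: of_nat_Suc)
      also have "\<dots> \<longleftrightarrow> x \<in> (\<Union>y\<in>- U. ball y (1 / real (Suc m)))"
        by (auto simp: dist_commute[of x] simp del: of_nat_Suc)
      finally show "x \<in> - W m \<longleftrightarrow> x \<in> (\<Union>y\<in>- U. ball y (1 / real (Suc m)))" .
    qed
    then have "open (- W m)" by auto
    then show ?thesis by (simp add: closed_def)
  qed
  then have Wm[measurable]: "W m \<in> sets borel" for m by simp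
  have "emeasure \<mu> (W m) \<le> ennreal c * emeasure \<nu> U" if c: "1 < c" for c m
  proof -
    have "\<forall>\<^sub>F r in at_right (0::real). 0 < r \<and> r < 1 / real (Suc m)"
      using eventually_at_right_less[of 0] eventually_at_right_real[of 0 "1 / real (Suc m)"]
      by (auto elim!: eventually_mono)
    then have "\<forall>\<^sub>F r in at_right 0. (0 < r \<and> r < 1 / real (Suc m)) \<and> (\<exists>V. 0 < V \<and>
        (\<forall>x\<in>X. ennreal V \<le> emeasure \<nu> (ball x r) \<and> emeasure \<mu> (ball x r) \<le> ennreal (c * V)))"
      using balls[OF c] by (rule eventually_conj)
    from eventually_happens'[OF trivial_limit_at_right_real this]
    obtain r V where r: "0 < r" "r < 1 / real (Suc m)" and V: "0 < V"
      and lo: "\<And>x. x \<in> X \<Longrightarrow> ennreal V \<le> emeasure \<nu> (ball x r)"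
      and hi: "\<And>x. x \<in> X \<Longrightarrow> emeasure \<mu> (ball x r) \<le> ennreal (c * V)"
      by blast
    \<comment> \<open>The kernel of the double integral: \<open>x\<close> deep inside \<open>U\<close> and \<open>y\<close> within distance \<open>r\<close>, so that \<open>y\<close> lies in \<open>U\<close>.\<close>
    let ?k = "\<lambda>x y. indicator (W m \<inter> X) x * indicator {p::'a \<times> 'a. dist (fst p) (snd p) < r} (x, y) :: ennreal"
    have kb: "indicator {p::'a \<times> 'a. dist (fst p) (snd p) < r} (x, y) = (indicator (ball x r) y :: ennreal)"
      "indicator {p::'a \<times> 'a. dist (fst p) (snd p) < r} (x, y) = (indicator (ball y r) x :: ennreal)" for x y
      by (auto split: split_indicator simp: dist_commute)
    have km: "case_prod ?k \<in> borel_measurable (\<mu> \<Otimes>\<^sub>M \<nu>)" by measurable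
    have "ennreal V * emeasure \<mu> (W m) = ennreal V * emeasure \<mu> (W m \<inter> X)"
    proof -
      have "emeasure \<mu> (W m) = emeasure \<mu> (W m \<inter> X)"
        using AEX(1) sets by (intro emeasure_eq_AE) auto
      then show ?thesis by simp
    qed
    also have "\<dots> = (\<integral>\<^sup>+x. ennreal V * indicator (W m \<inter> X) x \<partial>\<mu>)"
      using sets by (simp add: nn_integral_cmult_indicator)
    also have "\<dots> \<le> (\<integral>\<^sup>+x. \<integral>\<^sup>+y. ?k x y \<partial>\<nu> \<partial>\<mu>)"
    proof (rule nn_integral_mono)
      fix x
      have "(\<integral>\<^sup>+y. ?k x y \<partial>\<nu>) = indicator (W m \<inter> X) x * emeasure \<nu> (ball x r)"
        unfolding kb(1) using sets by (subst nn_integral_cmult_indicator) auto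
      then show "ennreal V * indicator (W m \<inter> X) x \<le> (\<integral>\<^sup>+y. ?k x y \<partial>\<nu>)"
        using lo by (auto split: split_indicator)
    qed
    also have "\<dots> = (\<integral>\<^sup>+y. \<integral>\<^sup>+x. ?k x y \<partial>\<mu> \<partial>\<nu>)"
      by (rule P.Fubini'[symmetric, OF km])
    also have "\<dots> \<le> (\<integral>\<^sup>+y. ennreal (c * V) * indicator U y \<partial>\<nu>)"
    proof (rule nn_integral_mono_AE)
      show "AE y in \<nu>. (\<integral>\<^sup>+x. ?k x y \<partial>\<mu>) \<le> ennreal (c * V) * indicator U y"
        using AEX(2)
      proof eventually_elim
        case (elim y)
        have "(\<integral>\<^sup>+x. ?k x y \<partial>\<mu>) \<le> (\<integral>\<^sup>+x. indicator U y * indicator (ball y r) x \<partial>\<mu>)"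
        proof (rule nn_integral_mono)
          fix x
          have "y \<in> U" if "x \<in> W m" "dist y x < r"
            using that r unfolding W_def by (auto simp: subset_iff dist_commute)
          then show "?k x y \<le> indicator U y * indicator (ball y r) x"
            unfolding kb(2) by (auto split: split_indicator)
        qed
        also have "\<dots> = indicator U y * emeasure \<mu> (ball y r)"
          using sets by (subst nn_integral_cmult_indicator) auto
        also have "\<dots> \<le> indicator U y * ennreal (c * V)"
          by (intro mult_left_mono hi elim) auto
        finally show ?case by (simp add: mult.commute)
      qed
    qed
    also have "\<dots> = ennreal (c * V) * emeasure \<nu> U"
      using sets by (simp add: nn_integral_cmult_indicator)
    also have "\<dots> = ennreal V * (ennreal c * emeasure \<nu> U)"
      using V c by (simp add: ennreal_mult mult_ac)
    finally show ?thesis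
      using V by (subst (asm) ennreal_mult_le_mult_iff) auto
  qed
  then have le: "emeasure \<mu> (W m) \<le> emeasure \<nu> U" for m
  proof -
    have "((\<lambda>c. ennreal c * emeasure \<nu> U) \<longlongrightarrow> ennreal 1 * emeasure \<nu> U) (at_right 1)"
      by (intro tendsto_mult_ennreal tendsto_ennrealI tendsto_const) (auto simp: tendsto_ident_at)
    then have "emeasure \<mu> (W m) \<le> ennreal 1 * emeasure \<nu> U"
      using \<open>\<And>m c. 1 < c \<Longrightarrow> emeasure \<mu> (W m) \<le> ennreal c * emeasure \<nu> U\<close>[of _ m]
      by (intro tendsto_lowerbound[where F="at_right 1"]) (auto simp: eventually_at_right_less eventually_at_filter)
    then show ?thesis by simp
  qed
  have inc: "incseq W"
  proof (rule monoI)
    fix m n :: nat assume "m \<le> n"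
    then have "ball x (1 / real (Suc n)) \<subseteq> ball x (1 / real (Suc m))" for x :: 'a
      by (intro subset_ball) (simp add: frac_le)
    then show "W m \<subseteq> W n" unfolding W_def by blast
  qed
  have WU: "(\<Union>m. W m) = U"
  proof (intro equalityI subsetI)
    fix x assume "x \<in> U"
    then obtain e where e: "0 < e" "ball x e \<subseteq> U" using U by (meson open_contains_ball)
    obtain m where "1 / real (Suc m) < e" by (rule nat_approx_posE[OF e(1)])
    then have "ball x (1 / real (Suc m)) \<subseteq> U"
      by (intro order_trans[OF subset_ball e(2)] less_imp_le)
    then show "x \<in> (\<Union>m. W m)" by (auto simp: W_def)
  next
    fix x assume "x \<in> (\<Union>m. W m)"
    then obtain m where "ball x (1 / real (Suc m)) \<subseteq> U" unfolding W_def by blast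
    then show "x \<in> U" by (rule subsetD) simp
  qed
  have "emeasure \<mu> U = (SUP m. emeasure \<mu> (W m))"
    unfolding WU[symmetric]
  proof (rule SUP_emeasure_incseq[symmetric, OF _ inc])
    show "range W \<subseteq> sets \<mu>" unfolding sets(1) using Wm by blast
  qed
  also have "\<dots> \<le> emeasure \<nu> U" by (rule SUP_least) (rule le)
  finally show ?thesis .
qed

lemma measure_eqI_of_ball_comparison:
  fixes \<mu> \<nu> :: "'a::euclidean_space measure"
  assumes fin: "finite_measure \<mu>" "finite_measure \<nu>"
    and sets: "sets \<mu> = sets borel" "sets \<nu> = sets borel"
    and X: "X \<in> sets borel" and null: "emeasure \<mu> (- X) = 0" "emeasure \<nu> (- X) = 0"
    and balls: "\<And>c. 1 < c \<Longrightarrow> \<forall>\<^sub>F r in at_right 0. \<exists>V. 0 < V \<and>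
        (\<forall>x\<in>X. ennreal V \<le> emeasure \<mu> (ball x r) \<and> emeasure \<mu> (ball x r) \<le> ennreal (c * V) \<and>
               ennreal V \<le> emeasure \<nu> (ball x r) \<and> emeasure \<nu> (ball x r) \<le> ennreal (c * V))"
  shows "\<mu> = \<nu>"
proof (rule measure_eqI_generator_eq[where E="{S. open S}" and \<Omega>=UNIV and A="\<lambda>_. UNIV"])
  show "Int_stable {S::'a set. open S}" by (auto simp: Int_stable_def)
  show "sets \<mu> = sigma_sets UNIV {S. open S}" "sets \<nu> = sigma_sets UNIV {S. open S}"
    unfolding sets by (simp_all add: borel_def)
  show "emeasure \<mu> UNIV \<noteq> \<infinity>" using finite_measure.emeasure_finite[OF fin(1)] by simp
  fix U :: "'a set" assume "U \<in> {S. open S}"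
  then have U: "open U" by simp
  show "emeasure \<mu> U = emeasure \<nu> U"
  proof (rule antisym)
    show "emeasure \<mu> U \<le> emeasure \<nu> U"
    proof (rule emeasure_open_le_of_ball_comparison[OF fin sets X null _ U])
      show "\<forall>\<^sub>F r in at_right 0. \<exists>V. 0 < V \<and>
        (\<forall>x\<in>X. ennreal V \<le> emeasure \<nu> (ball x r) \<and> emeasure \<mu> (ball x r) \<le> ennreal (c * V))"
        if "1 < c" for c by (rule eventually_mono[OF balls[OF that]]) blast
    qed
    show "emeasure \<nu> U \<le> emeasure \<mu> U"
    proof (rule emeasure_open_le_of_ball_comparison[OF fin(2,1) sets(2,1) X null(2,1) _ U])
      show "\<forall>\<^sub>F r in at_right 0. \<exists>V. 0 < V \<and>
        (\<forall>x\<in>X. ennreal V \<le> emeasure \<mu> (ball x r) \<and> emeasure \<nu> (ball x r) \<le> ennreal (c * V))"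
        if "1 < c" for c by (rule eventually_mono[OF balls[OF that]]) blast
    qed
  qed
qed auto

definition north_cap :: "real \<Rightarrow> ('a::euclidean_space \<times> real) set" where
  "north_cap c = {p \<in> sphere 0 1. c < snd p}"

definition flat_cone :: "real \<Rightarrow> real \<Rightarrow> ('a::euclidean_space \<times> real) set" where
  "flat_cone m h = {p. 0 < snd p \<and> snd p \<le> h \<and> norm (fst p) < m * snd p}"

lemma flat_cone_borel: "flat_cone m h \<in> sets (borel :: ('a::euclidean_space \<times> real) measure)"
proof -
  have "flat_cone m h = {p. 0 < snd p} \<inter> {p. snd p \<le> h} \<inter> {p :: 'a \<times> real. norm (fst p) < m * snd p}"
    by (auto simp: flat_cone_def)
  moreover have "{p :: 'a \<times> real. 0 < snd p} \<in> sets borel"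
    by (intro borel_open open_Collect_less continuous_intros)
  moreover have "{p :: 'a \<times> real. snd p \<le> h} \<in> sets borel"
    by (intro borel_closed closed_Collect_le continuous_intros)
  moreover have "{p :: 'a \<times> real. norm (fst p) < m * snd p} \<in> sets borel"
    by (intro borel_open open_Collect_less continuous_intros)
  ultimately show ?thesis by auto
qed

text \<open>
  Integrate the volumes of the horizontal slices, which are balls of radius \<open>m t\<close>.
\<close>

lemma emeasure_flat_cone:
  assumes m: "0 < m" and h: "0 < h"
  shows "emeasure lborel (flat_cone m h :: ('a::euclidean_space \<times> real) set)
    = ennreal (unit_ball_vol DIM('a) * m ^ DIM('a) * h ^ Suc DIM('a) / Suc DIM('a))"
proof -
  let ?S = "flat_cone m h :: ('a \<times> real) set"
  let ?\<omega> = "unit_ball_vol (real DIM('a))"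
  have S: "?S \<in> sets (borel :: ('a \<times> real) measure)" by (rule flat_cone_borel)
  have "emeasure lborel ?S = emeasure (lborel \<Otimes>\<^sub>M lborel) ?S" by (simp add: lborel_prod)
  also have "\<dots> = (\<integral>\<^sup>+t. emeasure lborel ((\<lambda>x. (x, t)) -` ?S) \<partial>lborel)"
    using S by (intro lborel_pair.emeasure_pair_measure_alt2) (simp only: lborel_prod sets_lborel)
  also have "\<dots> = (\<integral>\<^sup>+t. ennreal (?\<omega> * m ^ DIM('a) * t ^ DIM('a)) * indicator {0..h} t \<partial>lborel)"
  proof (rule nn_integral_cong_AE)
    show "AE t in lborel. emeasure lborel ((\<lambda>x. (x, t)) -` ?S)
        = ennreal (?\<omega> * m ^ DIM('a) * t ^ DIM('a)) * indicator {0..h} t"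
      using AE_lborel_singleton[of 0]
    proof eventually_elim
      case (elim t)
      have "(\<lambda>x. (x, t)) -` ?S = (if t \<in> {0<..h} then ball 0 (m * t) else {})"
        by (auto simp: flat_cone_def)
      then show ?case using elim m
        by (auto simp: emeasure_ball power_mult_distrib mult_ac split: split_indicator)
    qed
  qed
  also have "\<dots> = ennreal (?\<omega> * m ^ DIM('a) * h ^ Suc DIM('a) / Suc DIM('a)
      - ?\<omega> * m ^ DIM('a) * 0 ^ Suc DIM('a) / Suc DIM('a))"
  proof (rule nn_integral_FTC_Icc)
    show "((\<lambda>t. ?\<omega> * m ^ DIM('a) * t ^ Suc DIM('a) / Suc DIM('a)) has_real_derivative
        ?\<omega> * m ^ DIM('a) * t ^ DIM('a)) (at t)" for t
      by (auto intro!: derivative_eq_intros simp del: of_nat_Suc power_Suc)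
  qed (use m h in auto)
  finally show ?thesis by simp
qed

text \<open>
  The cap lies over the flat ball of radius \<open>e = \<surd>(1 - c\<^sup>2)\<close> and volume \<open>V\<close>. Vertical projection is
  \<open>1\<close>-Lipschitz and its inverse is \<open>1 / c\<close>-Lipschitz. The cone over the cap consists of the points
  \<open>(x, t)\<close> of the unit ball with \<open>\<bar>x\<bar> < (e / c) t\<close>; it contains the flat cone of height \<open>c\<close> and is contained
  in the flat cone of height \<open>1\<close> with this opening.
\<close>

lemma north_cap_estimates:
  fixes c :: real
  assumes c: "0 < c" "c < 1"
  defines "V \<equiv> unit_ball_vol DIM('a::euclidean_space) * sqrt (1 - c\<^sup>2) ^ DIM('a)"
  shows "ennreal V \<le> hausdorff_outer DIM('a) (north_cap c :: ('a \<times> real) set)" (is ?lower)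
    and "hausdorff_outer DIM('a) (north_cap c :: ('a \<times> real) set) \<le> ennreal (V / c ^ DIM('a))" (is ?upper)
    and "ennreal (c * V) \<le> ennreal (Suc DIM('a)) *
      emeasure lborel (unit_cone (north_cap c :: ('a \<times> real) set))" (is ?cone_lower)
    and "ennreal (Suc DIM('a)) *
      emeasure lborel (unit_cone (north_cap c :: ('a \<times> real) set))
      \<le> ennreal (V / c ^ DIM('a))" (is ?cone_upper)
proof -
  let ?C = "north_cap c :: ('a \<times> real) set"
  define e where "e = sqrt (1 - c\<^sup>2)"
  have c2: "c\<^sup>2 < 1" using c by (simp add: power_less_one_iff abs_square_less_1)
  have e: "0 < e" "e\<^sup>2 = 1 - c\<^sup>2" using c2 by (auto simp: e_def)
  have \<omega>: "0 < unit_ball_vol (real DIM('a))" by (rule unit_ball_vol_pos) simp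
  have V0: "0 \<le> V" using \<omega> e by (simp add: V_def e_def[symmetric])
  have ball: "hausdorff_outer DIM('a) (ball (0::'a) e) = ennreal V"
    using e by (simp add: hausdorff_outer_eq_lborel emeasure_ball V_def e_def)
  have n2: "(norm (x, t))\<^sup>2 = (norm x)\<^sup>2 + t\<^sup>2" for x :: 'a and t :: real
    by (simp add: norm_Pair)
  have cap_iff: "(x, t) \<in> ?C \<longleftrightarrow> norm x < e \<and> t = sqrt (1 - (norm x)\<^sup>2)" for x t
  proof
    assume "(x, t) \<in> ?C"
    then have t: "(norm x)\<^sup>2 + t\<^sup>2 = 1" "c < t" using n2[of x t] by (auto simp: north_cap_def)
    then have "c\<^sup>2 < t\<^sup>2" using c by (intro power_strict_mono) auto
    then have "(norm x)\<^sup>2 < e\<^sup>2" using t e by simp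
    then have "norm x < e" by (rule power2_less_imp_less) (use e(1) in auto)
    moreover have "t = sqrt (1 - (norm x)\<^sup>2)" using t c by (intro real_sqrt_unique[symmetric]) auto
    ultimately show "norm x < e \<and> t = sqrt (1 - (norm x)\<^sup>2)" by simp
  next
    assume A: "norm x < e \<and> t = sqrt (1 - (norm x)\<^sup>2)"
    then have x: "(norm x)\<^sup>2 < e\<^sup>2" by (intro power_strict_mono) auto
    then have "c\<^sup>2 < 1 - (norm x)\<^sup>2" using e by simp
    then have ct: "c < t" using A c by (simp add: real_less_rsqrt)
    have "0 \<le> 1 - (norm x)\<^sup>2" using \<open>c\<^sup>2 < 1 - (norm x)\<^sup>2\<close> zero_le_power2[of c] by linarith
    then have "t\<^sup>2 = 1 - (norm x)\<^sup>2" using A by simp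
    then have "(norm (x, t))\<^sup>2 = 1" by (simp add: n2)
    then have "norm (x, t) = 1" by (metis abs_norm_cancel abs_square_eq_1)
    then show "(x, t) \<in> ?C" using ct by (simp add: north_cap_def)
  qed
  show ?lower
  proof -
    have "ball (0::'a) e = fst ` ?C"
    proof (intro equalityI subsetI)
      fix x :: 'a assume "x \<in> ball 0 e"
      then have "(x, sqrt (1 - (norm x)\<^sup>2)) \<in> ?C" by (simp add: cap_iff)
      then show "x \<in> fst ` ?C" by (rule image_eqI[rotated]) simp
    next
      fix x :: 'a assume "x \<in> fst ` ?C"
      then obtain p where "p \<in> ?C" "x = fst p" by blast
      then show "x \<in> ball 0 e" using cap_iff[of "fst p" "snd p"] by simp
    qed
    then have "ennreal V = hausdorff_outer DIM('a) (fst ` ?C)" using ball by simp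
    also have "\<dots> \<le> ennreal (1 ^ DIM('a)) * hausdorff_outer DIM('a) ?C"
      by (rule hausdorff_outer_lipschitz) (auto simp: dist_fst_le)
    finally show ?thesis by simp
  qed
  show ?upper
  proof -
    define \<psi> where "\<psi> x = (x, sqrt (1 - (norm x)\<^sup>2))" for x :: 'a
    have C: "?C = \<psi> ` ball 0 e"
    proof (intro equalityI subsetI)
      fix p assume "p \<in> ?C"
      then have "norm (fst p) < e" "p = \<psi> (fst p)"
        using cap_iff[of "fst p" "snd p"] by (simp_all add: \<psi>_def prod_eq_iff)
      then show "p \<in> \<psi> ` ball 0 e" by simp
    next
      fix p assume "p \<in> \<psi> ` ball 0 e"
      then obtain x where "norm x < e" "p = \<psi> x" by auto
      then show "p \<in> ?C" by (simp add: \<psi>_def cap_iff)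
    qed
    \<comment> \<open>The heights \<open>a, b > c\<close> satisfy \<open>(a - b) (a + b) = \<bar>y\<bar>\<^sup>2 - \<bar>x\<bar>\<^sup>2\<close>, so the slope is at most \<open>e / c\<close>, and \<open>1 + (e / c)\<^sup>2 = (1 / c)\<^sup>2\<close>.\<close>
    have lip: "dist (\<psi> x) (\<psi> y) \<le> 1 / c * dist x y" if x: "x \<in> ball 0 e" and y: "y \<in> ball 0 e" for x y
    proof -
      define a b where "a = sqrt (1 - (norm x)\<^sup>2)" and "b = sqrt (1 - (norm y)\<^sup>2)"
      have ab: "(x, a) \<in> ?C" "(y, b) \<in> ?C" using x y by (auto simp: cap_iff a_def b_def)
      then have ca: "c < a" "c < b" by (auto simp: north_cap_def)
      have a2: "a\<^sup>2 = 1 - (norm x)\<^sup>2" "b\<^sup>2 = 1 - (norm y)\<^sup>2"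
        using ab n2[of x a] n2[of y b] by (auto simp: north_cap_def)
      have "\<bar>a - b\<bar> * (2 * c) \<le> \<bar>a - b\<bar> * (a + b)" using ca by (intro mult_left_mono) auto
      also have "\<dots> = \<bar>(norm y)\<^sup>2 - (norm x)\<^sup>2\<bar>"
      proof -
        have "\<bar>a - b\<bar> * (a + b) = \<bar>(a - b) * (a + b)\<bar>" using ca c by (simp add: abs_mult)
        also have "(a - b) * (a + b) = (norm y)\<^sup>2 - (norm x)\<^sup>2" using a2 by (simp add: power2_eq_square algebra_simps)
        finally show ?thesis .
      qed
      also have "\<dots> = \<bar>norm y - norm x\<bar> * (norm y + norm x)"
        by (simp add: power2_eq_square square_diff_square_factored abs_mult mult.commute)
      also have "\<dots> \<le> dist x y * (2 * e)"
      proof (intro mult_mono)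
        show "\<bar>norm y - norm x\<bar> \<le> dist x y"
          using norm_triangle_ineq3[of y x] by (simp add: dist_norm norm_minus_commute)
      qed (use x y in auto)
      finally have "\<bar>a - b\<bar> * c \<le> dist x y * e" by simp
      then have "(\<bar>a - b\<bar> * c)\<^sup>2 \<le> (dist x y * e)\<^sup>2" using c by (intro power_mono) auto
      then have le: "(a - b)\<^sup>2 * c\<^sup>2 \<le> (dist x y)\<^sup>2 * (1 - c\<^sup>2)" by (simp add: power_mult_distrib e)
      have "(c * dist (\<psi> x) (\<psi> y))\<^sup>2 = c\<^sup>2 * ((dist x y)\<^sup>2 + (a - b)\<^sup>2)"
        by (simp add: \<psi>_def dist_Pair_Pair power_mult_distrib a_def b_def dist_real_def)
      also have "\<dots> \<le> (dist x y)\<^sup>2" using le by (simp add: algebra_simps)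
      finally have "c * dist (\<psi> x) (\<psi> y) \<le> dist x y" by (rule power2_le_imp_le) simp
      then show ?thesis using c by (simp add: field_simps)
    qed
    have "hausdorff_outer DIM('a) ?C \<le> ennreal ((1 / c) ^ DIM('a)) * hausdorff_outer DIM('a) (ball (0::'a) e)"
      unfolding C using c lip by (intro hausdorff_outer_lipschitz) auto
    also have "\<dots> = ennreal (V / c ^ DIM('a))"
      using c V0 by (simp add: ball power_one_over ennreal_mult[symmetric])
    finally show ?thesis .
  qed
  let ?K = "unit_cone ?C"
  have key: "c * norm (x, t) < t \<longleftrightarrow> 0 < t \<and> norm x < e / c * t" for x :: 'a and t
  proof
    assume A: "c * norm (x, t) < t"
    then have t: "0 < t" using c by (meson less_imp_le mult_nonneg_nonneg norm_ge_zero order.strict_trans1)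
    have "(c * norm (x, t))\<^sup>2 < t\<^sup>2" using A c by (intro power_strict_mono) auto
    then have "(c * norm x)\<^sup>2 < (e * t)\<^sup>2" by (simp add: power_mult_distrib n2 e algebra_simps)
    then have "c * norm x < e * t" by (rule power2_less_imp_less) (use e(1) t in auto)
    then show "0 < t \<and> norm x < e / c * t" using t c by (simp add: field_simps)
  next
    assume A: "0 < t \<and> norm x < e / c * t"
    then have "c * norm x < e * t" using c by (simp add: field_simps)
    then have "(c * norm x)\<^sup>2 < (e * t)\<^sup>2" using c by (intro power_strict_mono) auto
    then have "(c * norm (x, t))\<^sup>2 < t\<^sup>2" by (simp add: power_mult_distrib n2 e algebra_simps)
    then show "c * norm (x, t) < t" by (rule power2_less_imp_less) (use A in auto)
  qed
  have K_iff: "(x, t) \<in> ?K \<longleftrightarrow> norm (x, t) \<le> 1 \<and> 0 < t \<and> norm x < e / c * t" for x t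
  proof -
    show ?thesis
    proof (cases "(x, t) = 0")
      case True
      then show ?thesis by (auto simp: zero_prod_def)
    next
      case False
      then have n: "0 < norm (x, t)" by simp
      have "norm (sgn (x, t)) = 1" "snd (sgn (x, t)) = t / norm (x, t)"
        using False n by (simp add: norm_sgn) (simp add: sgn_div_norm field_simps)
      then have "sgn (x, t) \<in> ?C \<longleftrightarrow> c < t / norm (x, t)"
        by (simp add: north_cap_def)
      also have "\<dots> \<longleftrightarrow> c * norm (x, t) < t" using n by (simp add: pos_less_divide_eq)
      finally show ?thesis using False key[of x t] by auto
    qed
  qed
  have Km: "?K \<in> sets borel"
  proof (rule sgn_section_borel)
    have "?C = sphere 0 1 \<inter> snd -` {c<..}" by (auto simp: north_cap_def)
    moreover have "open (snd -` {c<..} :: ('a \<times> real) set)" by (intro open_vimage_snd) simp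
    ultimately show "?C \<in> sets borel" by simp
  qed (rule punctured_cball_borel)
  have ee: "sqrt (1 - c\<^sup>2) = e" by (simp add: e_def)
  show ?cone_upper
  proof -
    have "?K \<subseteq> flat_cone (e / c) 1"
    proof
      fix z assume z: "z \<in> ?K"
      obtain x t where zt: "z = (x, t)" by (cases z)
      have "norm (x, t) \<le> 1" using z unfolding zt by blast
      then have "t \<le> 1" using norm_snd_le[of t x] by (metis abs_le_iff order_trans real_norm_def)
      then show "z \<in> flat_cone (e / c) 1" using z K_iff[of x t] unfolding zt by (auto simp: flat_cone_def)
    qed
    then have "emeasure lborel ?K \<le> emeasure lborel (flat_cone (e / c) 1 :: ('a \<times> real) set)"
      by (rule emeasure_mono) (simp add: flat_cone_borel)
    also have "\<dots> = ennreal (unit_ball_vol DIM('a) * (e / c) ^ DIM('a) / Suc DIM('a))"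
      using e c by (subst emeasure_flat_cone) auto
    finally have "ennreal (Suc DIM('a)) * emeasure lborel ?K
        \<le> ennreal (Suc DIM('a)) * ennreal (unit_ball_vol DIM('a) * (e / c) ^ DIM('a) / Suc DIM('a))"
      by (rule mult_left_mono) simp
    also have "\<dots> = ennreal (V / c ^ DIM('a))"
      unfolding V_def ee by (subst ennreal_mult'[symmetric]) (auto simp: power_divide simp del: of_nat_Suc)
    finally show ?thesis .
  qed
  show ?cone_lower
  proof -
    have "flat_cone (e / c) c \<subseteq> ?K"
    proof
      fix z :: "'a \<times> real" assume z: "z \<in> flat_cone (e / c) c"
      obtain x t where zt: "z = (x, t)" by (cases z)
      have t: "0 < t" "t \<le> c" "norm x < e / c * t" using z by (auto simp: zt flat_cone_def)
      then have "c * norm (x, t) < t" using key[of x t] by blast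
      then have "c * norm (x, t) < c * 1" using t by linarith
      then have "norm (x, t) < 1" by (simp only: mult_less_cancel_left_pos[OF c(1)])
      then have "norm (x, t) \<le> 1" by (rule less_imp_le)
      then show "z \<in> ?K" unfolding zt K_iff using t by (intro conjI)
    qed
    then have "ennreal (Suc DIM('a)) * emeasure lborel (flat_cone (e / c) c :: ('a \<times> real) set)
        \<le> ennreal (Suc DIM('a)) * emeasure lborel ?K"
      using Km by (intro mult_left_mono emeasure_mono) auto
    moreover have "emeasure lborel (flat_cone (e / c) c :: ('a \<times> real) set)
       = ennreal (unit_ball_vol DIM('a) * (e / c) ^ DIM('a) * c ^ Suc DIM('a) / Suc DIM('a))"
      using e c by (intro emeasure_flat_cone) auto
    moreover have "ennreal (Suc DIM('a)) * ennreal (unit_ball_vol DIM('a) * (e / c) ^ DIM('a) * c ^ Suc DIM('a) / Suc DIM('a))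
       = ennreal (c * V)"
      unfolding V_def ee using c
      by (subst ennreal_mult'[symmetric]) (auto simp: power_divide mult_ac simp del: of_nat_Suc)
    ultimately show ?thesis by simp
  qed
qed

text \<open>
  An index type with one element less, so that \<open>\<real>\<^sup>n\<close> is isometric to the product of the Euclidean space
  over it and a line. As types are inhabited, \<open>n = 1\<close> is an exception; the sphere then has two points and
  is treated directly.
\<close>

typedef (overloaded) ('n::finite) punctured = "if CARD('n) = 1 then UNIV else UNIV - {undefined :: 'n}"
proof -
  have "\<exists>x. x \<noteq> (undefined :: 'n)" if "CARD('n) \<noteq> 1"
    using that by (metis UNIV_eq_I card_1_singleton_iff One_nat_def singletonI singleton_iff subset_antisym)
  then show ?thesis by auto
qed

instance punctured :: (finite) finite
proof
  have "inj (Rep_punctured :: 'a punctured \<Rightarrow> 'a)" by (simp add: Rep_punctured_inject inj_on_def)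
  then show "finite (UNIV :: 'a punctured set)" by (rule finite_imageD[rotated]) simp
qed

lemma card_punctured:
  assumes "CARD('n::finite) \<noteq> 1"
  shows "CARD('n) = Suc CARD('n punctured)"
proof -
  have "CARD('n punctured) = card (if CARD('n) = 1 then UNIV else UNIV - {undefined :: 'n})"
    by (rule type_definition.card[OF type_definition_punctured])
  then have "CARD('n punctured) = CARD('n) - 1" using assms by simp
  moreover have "0 < CARD('n)" by simp
  ultimately show ?thesis by linarith
qed

text \<open>
  Used with the north pole and with the unit of the real line.
\<close>

lemma isometry_onto_with_pole:
  fixes w :: "real ^ 'n" and p :: "'b::euclidean_space"
  assumes dim: "DIM('b) = CARD('n)" and w: "norm w = 1" and p: "norm p = 1"
  obtains f :: "'b \<Rightarrow> real ^ 'n" where "linear f" "\<And>x. norm (f x) = norm x" "surj f" "f p = w"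
proof -
  obtain f0 :: "'b \<Rightarrow> real ^ 'n" and g where f0: "linear f0" "\<And>x. norm (f0 x) = norm x" "\<And>y. f0 (g y) = y"
    using isomorphisms_UNIV_UNIV[where 'M='b and 'N="real ^ 'n"] dim by (metis DIM_cart DIM_real mult.right_neutral)
  have "norm (f0 p) = 1" using f0 p by simp
  then obtain T where T: "orthogonal_transformation T" "T (f0 p) = w"
    using orthogonal_transformation_exists_1[OF _ w] by blast
  show thesis
  proof (rule that)
    show "linear (T \<circ> f0)" using f0 T by (intro linear_compose) (auto simp: orthogonal_transformation_linear)
    show "norm ((T \<circ> f0) x) = norm x" for x using f0(2) T by (simp add: orthogonal_transformation_norm)
    show "surj (T \<circ> f0)" using f0(3) T by (metis comp_surj orthogonal_transformation_surj surjI)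
    show "(T \<circ> f0) p = w" using T by simp
  qed
qed

lemma ball_estimates_of_isometry:
  fixes f :: "'b::euclidean_space \<Rightarrow> real ^ 'n"
  assumes dim: "DIM('b) = CARD('n)"
    and f: "linear f" "\<And>x. norm (f x) = norm x" "surj f"
    and C: "C = {x \<in> sphere 0 1. f x \<in> ball w r}"
  shows "hausdorff_outer d (ball w r \<inter> sphere 0 1) = hausdorff_outer d C"
    and "emeasure cone_measure (ball w r)
       = ennreal CARD('n) * emeasure lborel (unit_cone C)"
proof -
  have iso: "dist (f x) (f y) = dist x y" for x y
    using f(2)[of "x - y"] linear_diff[OF f(1)] by (simp add: dist_norm)
  have img: "ball w r \<inter> sphere 0 1 = f ` C"
  proof (intro equalityI subsetI)
    fix y assume y: "y \<in> ball w r \<inter> sphere 0 1"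
    obtain x where x: "y = f x" using f(3) by (metis surjD)
    then show "y \<in> f ` C" using y f(2)[of x] by (auto simp: C)
  next
    fix y assume "y \<in> f ` C"
    then show "y \<in> ball w r \<inter> sphere 0 1" using f(2) by (auto simp: C)
  qed
  show "hausdorff_outer d (ball w r \<inter> sphere 0 1) = hausdorff_outer d C"
    unfolding img by (rule hausdorff_outer_isometry) (rule iso)
  let ?K = "unit_cone C"
  let ?L = "(unit_cone (ball w r))"
  have z0: "f z = 0 \<longleftrightarrow> z = 0" for z using f(2)[of z] by (metis norm_eq_zero)
  have sg: "sgn (f z) = f (sgn z)" for z
    using f(2)[of z] linear_cmul[OF f(1)] by (simp add: sgn_div_norm)
  have mem: "f z \<in> ?L \<longleftrightarrow> z \<in> ?K" for z
    using f(2)[of z] by (auto simp: z0 sg C norm_sgn)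
  have img2: "?L = f ` ?K"
  proof (intro equalityI subsetI)
    fix y assume y: "y \<in> ?L"
    obtain z where z: "y = f z" using f(3) by (metis surjD)
    have "z \<in> ?K" using y unfolding z mem .
    then show "y \<in> f ` ?K" unfolding z by (rule imageI)
  next
    fix y assume "y \<in> f ` ?K"
    then obtain z where z: "z \<in> ?K" "y = f z" by blast
    show "y \<in> ?L" unfolding z(2) mem by (rule z(1))
  qed
  have fc: "continuous_on UNIV f" using f(1) by (simp add: linear_continuous_on linear_linear)
  have Cm: "C \<in> sets borel"
  proof -
    have "C = sphere 0 1 \<inter> f -` ball w r" by (auto simp: C)
    moreover have "open (f -` ball w r)" using fc by (intro open_vimage) auto
    ultimately show ?thesis by simp
  qed
  have Km: "?K \<in> sets borel" by (rule sgn_section_borel[OF Cm punctured_cball_borel])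
  have Lm: "?L \<in> sets borel" by (rule sgn_section_borel[OF _ punctured_cball_borel]) simp
  have "emeasure lborel ?L = emeasure lborel ?K"
    unfolding img2
  proof (rule emeasure_lborel_isometry[OF _ Km])
    show "f ` ?K \<in> sets borel" using Lm unfolding img2 .
    show "DIM('b) = DIM(real ^ 'n)" using dim by simp
  qed (rule iso)
  then show "emeasure cone_measure (ball w r) = ennreal CARD('n) * emeasure lborel ?K"
    by (simp add: emeasure_cone_measure)
qed

text \<open>
  All spherical caps of the same radius are isometric to a cap around the north pole, and the constants
  of the cap estimates tend to \<open>1\<close> as the radius tends to \<open>0\<close>. For \<open>n = 1\<close> a small cap is a single point,
  with Hausdorff measure \<open>1\<close> and with a segment of length \<open>1\<close> as its cone.
\<close>

lemma eventually_sphere_ball_estimates: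
  fixes C :: real
  assumes C: "1 < C"
  shows "\<forall>\<^sub>F r in at_right 0. \<exists>V. 0 < V \<and> (\<forall>w\<in>sphere (0 :: real ^ 'n) 1.
      ennreal V \<le> hausdorff_outer (CARD('n) - 1) (ball w r \<inter> sphere 0 1) \<and>
      hausdorff_outer (CARD('n) - 1) (ball w r \<inter> sphere 0 1) \<le> ennreal (C * V) \<and>
      ennreal V \<le> emeasure cone_measure (ball w r) \<and>
      emeasure cone_measure (ball w r) \<le> ennreal (C * V))"
proof (cases "CARD('n) = 1")
  case False
  define d where "d = DIM(real ^ 'n punctured)"
  have d: "CARD('n) = Suc d" using card_punctured[OF False] by (simp add: d_def)
  have "((\<lambda>r::real. C * (1 - r\<^sup>2 / 2) ^ Suc d) \<longlongrightarrow> C * (1 - 0\<^sup>2 / 2) ^ Suc d) (at_right 0)"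
    by (intro tendsto_intros) simp
  then have "\<forall>\<^sub>F r in at_right 0. 1 < C * (1 - r\<^sup>2 / 2) ^ Suc d"
    using C by (intro order_tendstoD(1)) auto
  moreover have "\<forall>\<^sub>F r in at_right (0::real). 0 < r \<and> r < 1"
    using eventually_at_right_real[of 0 "1::real"] by (auto elim!: eventually_mono)
  ultimately show ?thesis
  proof eventually_elim
    case (elim r)
    \<comment> \<open>Points \<open>x\<close> of the sphere have distance \<open>\<surd>(2 - 2 t)\<close> to the pole, where \<open>t\<close> is their height, so the cap of radius \<open>r\<close> is \<open>t > 1 - r\<^sup>2 / 2\<close>.\<close>
    define c where "c = 1 - r\<^sup>2 / 2"
    have r2: "0 < r\<^sup>2" "r\<^sup>2 < 1" using elim by (auto simp: power_less_one_iff abs_square_less_1)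
    then have c: "0 < c" "c < 1" by (auto simp: c_def)
    define V where "V = unit_ball_vol d * sqrt (1 - c\<^sup>2) ^ d"
    have "c\<^sup>2 < 1" using c by (simp add: abs_square_less_1)
    then have V: "0 < V" by (auto simp: V_def intro!: mult_pos_pos unit_ball_vol_pos zero_less_power)
    have VC: "V / c ^ d \<le> C * (c * V)"
    proof -
      have "V * 1 \<le> V * (C * c ^ Suc d)" using elim(1) V by (intro mult_left_mono) (auto simp: c_def)
      then show ?thesis using c by (simp add: divide_le_eq mult_ac)
    qed
    have cV: "c * V \<le> V" using c V by simp
    have VcV: "V \<le> V / c ^ d" using c V by (simp add: le_divide_eq power_le_one mult_left_le)
    show ?case
    proof (intro exI[of _ "c * V"] conjI ballI)
      show "0 < c * V" using c V by simp
      fix w :: "real ^ 'n" assume "w \<in> sphere 0 1"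
      then have w: "norm w = 1" by simp
      have dim: "DIM((real ^ 'n punctured) \<times> real) = CARD('n)" using d by (simp add: d_def)
      have pole: "norm (0 :: real ^ 'n punctured, 1 :: real) = 1" by (simp add: norm_Pair)
      obtain f :: "(real ^ 'n punctured) \<times> real \<Rightarrow> real ^ 'n"
        where f: "linear f" "\<And>x. norm (f x) = norm x" "surj f" and fw: "f (0, 1) = w"
        by (rule isometry_onto_with_pole[OF dim w pole]) blast
      have cap: "(north_cap c :: ((real ^ 'n punctured) \<times> real) set) = {x \<in> sphere 0 1. f x \<in> ball w r}"
      proof (intro set_eqI)
        fix x :: "(real ^ 'n punctured) \<times> real"
        obtain y t where x: "x = (y, t)" by (cases x)
        have "dist w (f x) = norm (f ((0, 1) - x))" using linear_diff[OF f(1)] by (simp add: dist_norm fw)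
        also have "\<dots> = norm (y, 1 - t)" by (simp add: f(2) x norm_Pair)
        finally have e: "(dist w (f x))\<^sup>2 = (norm y)\<^sup>2 + (1 - t)\<^sup>2" by (simp add: norm_Pair)
        have "f x \<in> ball w r \<longleftrightarrow> (dist w (f x))\<^sup>2 < r\<^sup>2"
          using elim by (auto intro: power_strict_mono power2_less_imp_less)
        also have "\<dots> \<longleftrightarrow> c < t" if "norm x = 1"
        proof -
          have "(norm y)\<^sup>2 + t\<^sup>2 = 1" using that by (simp add: x norm_Pair)
          then show ?thesis unfolding e c_def by (simp add: power2_diff) (auto simp: field_simps)
        qed
        finally show "x \<in> north_cap c \<longleftrightarrow> x \<in> {x \<in> sphere 0 1. f x \<in> ball w r}"
          by (auto simp: north_cap_def x)
      qed
      note H = ball_estimates_of_isometry[OF dim f cap]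
      note N = north_cap_estimates[OF c, where 'a="real ^ 'n punctured", folded d_def, folded V_def]
      have d1: "CARD('n) - 1 = d" using d by simp
      show "ennreal (c * V) \<le> hausdorff_outer (CARD('n) - 1) (ball w r \<inter> sphere 0 1)"
        unfolding H(1) d1 using N(1) cV by (meson ennreal_leI order_trans)
      show "hausdorff_outer (CARD('n) - 1) (ball w r \<inter> sphere 0 1) \<le> ennreal (C * (c * V))"
        unfolding H(1) d1 using N(2) VC by (meson ennreal_leI order_trans)
      show "ennreal (c * V) \<le> emeasure cone_measure (ball w r)"
        unfolding H(2) d using N(3) by simp
      show "emeasure cone_measure (ball w r) \<le> ennreal (C * (c * V))"
        unfolding H(2) d using N(4) VC by (meson ennreal_leI order_trans)
    qed
  qed
next
  case True
  have "\<forall>\<^sub>F r in at_right (0::real). 0 < r \<and> r < 1"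
    using eventually_at_right_real[of 0 "1::real"] by (auto elim!: eventually_mono)
  then show ?thesis
  proof eventually_elim
    case (elim r)
    show ?case
    proof (intro exI[of _ 1] conjI ballI)
      fix w :: "real ^ 'n" assume "w \<in> sphere 0 1"
      then have w: "norm w = 1" by simp
      have dim: "DIM(real) = CARD('n)" using True by simp
      obtain f :: "real \<Rightarrow> real ^ 'n"
        where f: "linear f" "\<And>x. norm (f x) = norm x" "surj f" and fw: "f 1 = w"
        by (rule isometry_onto_with_pole[OF dim w, of 1]) auto
      have cap: "{1} = {x \<in> sphere 0 1. f x \<in> ball w r}"
      proof (intro set_eqI)
        fix x :: real
        have "dist w (f x) = norm (f (1 - x))" using linear_diff[OF f(1)] by (simp add: dist_norm fw)
        also have "\<dots> = \<bar>1 - x\<bar>" by (simp add: f(2))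
        finally have "dist w (f x) = \<bar>1 - x\<bar>" .
        then show "x \<in> {1} \<longleftrightarrow> x \<in> {x \<in> sphere 0 1. f x \<in> ball w r}" using elim by auto
      qed
      note H = ball_estimates_of_isometry[OF dim f cap]
      have h: "hausdorff_outer 0 {1::real} = 1"
      proof (rule antisym)
        have "hausdorff_pre 0 \<delta> {1::real} \<le> 1" if "0 < \<delta>" for \<delta>
        proof -
          have "hausdorff_pre 0 \<delta> {1::real} \<le> (\<integral>\<^sup>+i. hausdorff_weight 0 {1::real} \<partial>count_space {()})"
            by (rule hausdorff_pre_le_countable) (use that in auto)
          then show ?thesis by (simp add: hausdorff_weight_def)
        qed
        then show "hausdorff_outer 0 {1::real} \<le> 1" unfolding hausdorff_outer_def by (intro SUP_least) auto
        have "1 \<le> hausdorff_pre 0 1 {1::real}"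
          unfolding hausdorff_pre_def
        proof (safe intro!: INF_greatest)
          fix D :: "nat \<Rightarrow> real set" assume "{1} \<subseteq> (\<Union>i. D i)"
          then obtain i where "1 \<in> D i" by auto
          then have "1 = hausdorff_weight 0 (D i)" by (auto simp: hausdorff_weight_def)
          also have "\<dots> \<le> (\<Sum>i. hausdorff_weight 0 (D i))"
            using sum_le_suminf[of "\<lambda>i. hausdorff_weight 0 (D i)" "{i}"] by simp
          finally show "1 \<le> (\<Sum>i. hausdorff_weight 0 (D i))" .
        qed
        also have "\<dots> \<le> hausdorff_outer 0 {1::real}" by (rule hausdorff_pre_le_outer) simp
        finally show "1 \<le> hausdorff_outer 0 {1::real}" .
      qed
      have "unit_cone {1::real} = {0<..1}"
        by (auto simp: sgn_if split: if_splits)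
      then have l: "ennreal CARD('n) * emeasure lborel (unit_cone {1::real}) = 1"
        using True by simp
      have d1: "CARD('n) - 1 = 0" using True by simp
      show "ennreal 1 \<le> hausdorff_outer (CARD('n) - 1) (ball w r \<inter> sphere 0 1)"
        "hausdorff_outer (CARD('n) - 1) (ball w r \<inter> sphere 0 1) \<le> ennreal (C * 1)"
        unfolding H(1) d1 h using C by auto
      show "ennreal 1 \<le> emeasure cone_measure (ball w r)"
        "emeasure cone_measure (ball w r) \<le> ennreal (C * 1)"
        unfolding H(2) l using C by auto
    qed simp
  qed
qed

lemma measurable_indicator_sphere:
  "(indicator (sphere 0 1) :: real ^ 'n \<Rightarrow> ennreal) \<in> borel_measurable (hausdorff_measure d)"
  by (rule borel_measurable_indicator) simp

text \<open>
  Compactness of the sphere makes the Hausdorff measure finite, which the comparison of measures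
  on balls requires.
\<close>

theorem surface_measure_eq_cone_measure:
  "density (hausdorff_measure (CARD('n) - 1)) (indicator (sphere 0 1)) = (cone_measure :: (real ^ 'n) measure)"
proof -
  define \<mu> where "\<mu> = density (hausdorff_measure (CARD('n) - 1)) (indicator (sphere (0 :: real ^ 'n) 1))"
  have s: "sets \<mu> = sets borel" by (simp add: \<mu>_def)
  have emb: "emeasure \<mu> A = hausdorff_outer (CARD('n) - 1) (A \<inter> sphere 0 1)" if A: "A \<in> sets borel" for A
  proof -
    have "emeasure \<mu> A = (\<integral>\<^sup>+x. indicator (sphere 0 1) x * indicator A x \<partial>hausdorff_measure (CARD('n) - 1))"
      unfolding \<mu>_def using A by (intro emeasure_density measurable_indicator_sphere) simp
    also have "\<dots> = (\<integral>\<^sup>+x. indicator (A \<inter> sphere 0 1) x \<partial>hausdorff_measure (CARD('n) - 1))"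
      by (intro nn_integral_cong) (auto split: split_indicator)
    also have "\<dots> = hausdorff_outer (CARD('n) - 1) (A \<inter> sphere 0 1)"
      using A by (simp add: emeasure_hausdorff_measure)
    finally show ?thesis .
  qed
  have fin: "finite_measure \<mu>"
  proof (rule finite_measureI)
    have "\<forall>\<^sub>F r in at_right 0. 0 < r \<and> (\<forall>w\<in>sphere (0 :: real ^ 'n) 1. emeasure \<mu> (ball w r) < top)"
    proof (rule eventually_mono[OF eventually_conj[OF eventually_at_right_less[of 0]
          eventually_sphere_ball_estimates[where 'n='n and C=2]]])
      fix r :: real
      assume "0 < r \<and> (\<exists>V. 0 < V \<and> (\<forall>w\<in>sphere (0 :: real ^ 'n) 1.
        ennreal V \<le> hausdorff_outer (CARD('n) - 1) (ball w r \<inter> sphere 0 1) \<and>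
        hausdorff_outer (CARD('n) - 1) (ball w r \<inter> sphere 0 1) \<le> ennreal (2 * V) \<and>
        ennreal V \<le> emeasure cone_measure (ball w r) \<and>
        emeasure cone_measure (ball w r) \<le> ennreal (2 * V)))"
      then obtain V where r: "0 < r" and V: "\<And>w. w \<in> sphere (0 :: real ^ 'n) 1 \<Longrightarrow>
        hausdorff_outer (CARD('n) - 1) (ball w r \<inter> sphere 0 1) \<le> ennreal (2 * V)" by blast
      show "0 < r \<and> (\<forall>w\<in>sphere (0 :: real ^ 'n) 1. emeasure \<mu> (ball w r) < top)"
        using r le_less_trans[OF V ennreal_less_top] by (simp add: emb)
    qed simp
    from eventually_happens'[OF trivial_limit_at_right_real this]
    obtain r where r: "0 < r" "\<And>w. w \<in> sphere (0 :: real ^ 'n) 1 \<Longrightarrow> emeasure \<mu> (ball w r) < top" by blast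
    obtain W where W: "finite W" "W \<subseteq> sphere (0 :: real ^ 'n) 1" "sphere 0 1 \<subseteq> (\<Union>w\<in>W. ball w r)"
    proof (rule compactE_image[of "sphere (0 :: real ^ 'n) 1" "sphere 0 1" "\<lambda>w. ball w r"])
      show "sphere 0 1 \<subseteq> (\<Union>w\<in>sphere (0 :: real ^ 'n) 1. ball w r)"
        using r(1) by (intro subsetI UN_I[of x "sphere 0 1" x for x]) auto
    qed (auto intro: that)
    have "emeasure \<mu> UNIV = emeasure \<mu> (sphere 0 1)" by (simp add: emb)
    also have "\<dots> \<le> emeasure \<mu> (\<Union>w\<in>W. ball w r)"
    proof (rule emeasure_mono[OF W(3)])
      show "(\<Union>w\<in>W. ball w r) \<in> sets \<mu>" unfolding s by (intro borel_open open_UN) simp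
    qed
    also have "\<dots> \<le> (\<Sum>w\<in>W. emeasure \<mu> (ball w r))"
    proof (rule emeasure_subadditive_finite[OF W(1)])
      show "(\<lambda>w. ball w r) ` W \<subseteq> sets \<mu>" unfolding s by (intro image_subsetI borel_open open_ball)
    qed
    also have "\<dots> < top" using r(2) subsetD[OF W(2)] by (subst ennreal_sum_less_top[OF W(1)]) blast
    finally show "emeasure \<mu> (space \<mu>) \<noteq> \<infinity>" using sets_eq_imp_space_eq[OF s] by simp
  qed
  have "\<mu> = cone_measure"
  proof (rule measure_eqI_of_ball_comparison[where X="sphere 0 1", OF fin finite_measure_cone_measure s])
    show "emeasure \<mu> (- sphere 0 1) = 0" using emb[of "- sphere 0 1"] by (simp add: borel_comp)
    show "emeasure (cone_measure :: (real ^ 'n) measure) (- sphere 0 1) = 0" by (rule emeasure_cone_measure_off_sphere)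
    show "\<forall>\<^sub>F r in at_right 0. \<exists>V. 0 < V \<and> (\<forall>x\<in>sphere 0 1. ennreal V \<le> emeasure \<mu> (ball x r) \<and>
       emeasure \<mu> (ball x r) \<le> ennreal (c * V) \<and> ennreal V \<le> emeasure cone_measure (ball x r) \<and>
       emeasure cone_measure (ball x r) \<le> ennreal (c * V))" if "1 < c" for c
      using eventually_sphere_ball_estimates[where 'n='n, OF that] by (simp add: emb)
  qed simp_all
  then show ?thesis by (simp add: \<mu>_def)
qed

lemma nn_integral_sphere:
  fixes f :: "real ^ 'n \<Rightarrow> ennreal"
  assumes "f \<in> borel_measurable borel"
  shows "(\<integral>\<^sup>+w\<in>sphere 0 1. f w \<partial>hausdorff_measure (CARD('n) - 1)) = (\<integral>\<^sup>+w. f w \<partial>cone_measure)"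
  unfolding surface_measure_eq_cone_measure[symmetric]
  using assms measurable_indicator_sphere
  by (subst nn_integral_density) (auto simp: mult.commute measurable_def)

section \<open>Generalized Young functions\<close>

text \<open>
  All that follows about \<open>G\<close> rests on these two bounds for its increments, which say that \<open>G\<close> is convex
  with density \<open>g\<close>.
\<close>

lemma integral_increment_bounds:
  fixes h :: "real \<Rightarrow> real"
  assumes mono: "mono_on {0..} h" and ab: "0 \<le> a" "a \<le> b"
  shows "(b - a) * h a \<le> (LBINT \<tau>:{0..b}. h \<tau>) - (LBINT \<tau>:{0..a}. h \<tau>)"
    and "(LBINT \<tau>:{0..b}. h \<tau>) - (LBINT \<tau>:{0..a}. h \<tau>) \<le> (b - a) * h b"
proof -
  \<comment> \<open>A function that is monotone on the whole line, hence Borel measurable, and agrees with \<open>h\<close> where it matters.\<close>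
  define k where "k \<tau> = h (max \<tau> 0)" for \<tau>
  have "mono k" using mono by (intro monoI) (auto simp: k_def mono_on_def)
  then have km: "k \<in> borel_measurable borel" by (rule borel_measurable_mono)
  have int: "set_integrable lborel {0..t} h" if "0 \<le> t" for t
  proof -
    have "set_integrable lborel {0..t} k"
      unfolding set_integrable_def
    proof (rule integrableI_bounded_set_indicator[where B="\<bar>h 0\<bar> + \<bar>h t\<bar>"])
      show "AE x in lborel. x \<in> {0..t} \<longrightarrow> norm (k x) \<le> \<bar>h 0\<bar> + \<bar>h t\<bar>"
      proof (intro always_eventually allI impI)
        fix x assume x: "x \<in> {0..t}"
        then have "h 0 \<le> h x" "h x \<le> h t" using mono by (auto simp: mono_on_def)
        then show "norm (k x) \<le> \<bar>h 0\<bar> + \<bar>h t\<bar>" using x by (simp add: k_def)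
      qed
    qed (use km \<open>0 \<le> t\<close> in auto)
    then show ?thesis
      by (rule set_integrable_cong[THEN iffD1, rotated -1]) (auto simp: k_def)
  qed
  have sub: "set_integrable lborel {a<..b} h"
    by (rule set_integrable_subset[OF int[of b]]) (use ab in auto)
  have "{0..b} = {0..a} \<union> {a<..b}" using ab by auto
  moreover have "(LBINT \<tau>:{0..a} \<union> {a<..b}. h \<tau>) = (LBINT \<tau>:{0..a}. h \<tau>) + (LBINT \<tau>:{a<..b}. h \<tau>)"
    by (rule set_integral_Un) (use sub int[of a] ab in auto)
  ultimately have eq: "(LBINT \<tau>:{0..b}. h \<tau>) - (LBINT \<tau>:{0..a}. h \<tau>) = (LBINT \<tau>:{a<..b}. h \<tau>)" by simp
  have ci: "set_integrable lborel {a<..b} (\<lambda>_. c::real)" for c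
    unfolding set_integrable_def using ab by (intro integrable_scaleR_left integrable_real_indicator) auto
  have cv: "(LBINT \<tau>:{a<..b}. c) = (b - a) * c" for c :: real
    using ab by (simp add: set_integral_const)
  have "(LBINT \<tau>:{a<..b}. h a) \<le> (LBINT \<tau>:{a<..b}. h \<tau>)"
    using mono ab by (intro set_integral_mono ci sub) (auto simp: mono_on_def)
  then show "(b - a) * h a \<le> (LBINT \<tau>:{0..b}. h \<tau>) - (LBINT \<tau>:{0..a}. h \<tau>)" by (simp add: eq cv)
  have "(LBINT \<tau>:{a<..b}. h \<tau>) \<le> (LBINT \<tau>:{a<..b}. h b)"
    using mono ab by (intro set_integral_mono ci sub) (auto simp: mono_on_def)
  then show "(LBINT \<tau>:{0..b}. h \<tau>) - (LBINT \<tau>:{0..a}. h \<tau>) \<le> (b - a) * h b" by (simp add: eq cv)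
qed

lemma young_increment:
  assumes "generalized_young g G" "0 \<le> a" "a \<le> b"
  shows "(b - a) * g x y a \<le> G x y b - G x y a" and "G x y b - G x y a \<le> (b - a) * g x y b"
  using assms integral_increment_bounds[of "g x y" a b] by (auto simp: generalized_young_def)

lemma young_zero:
  assumes "generalized_young g G"
  shows "G x y 0 = 0"
proof -
  have "G x y 0 = (LBINT \<tau>:{0..0}. g x y \<tau>)" using assms by (simp add: generalized_young_def)
  also have "\<dots> = 0"
    unfolding set_lebesgue_integral_def
  proof (rule integral_eq_zero_AE)
    show "AE \<tau> in lborel. indicator {0..0} \<tau> *\<^sub>R g x y \<tau> = 0"
      using AE_lborel_singleton[of 0] by eventually_elim simp
  qed
  finally show ?thesis .
qed

lemma young_density_nonneg: "generalized_young g G \<Longrightarrow> 0 \<le> t \<Longrightarrow> 0 \<le> g x y t"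
  unfolding generalized_young_def by (metis less_eq_real_def)

lemma young_mono: "generalized_young g G \<Longrightarrow> 0 \<le> a \<Longrightarrow> a \<le> b \<Longrightarrow> G x y a \<le> G x y b"
  using young_increment(1)[of g G a b x y] young_density_nonneg[of g G a x y]
  by (smt (verit) mult_nonneg_nonneg)

lemma young_nonneg: "generalized_young g G \<Longrightarrow> 0 \<le> t \<Longrightarrow> 0 \<le> G x y t"
  using young_mono[of g G 0 t x y] young_zero[of g G x y] by simp

text \<open>
  Convexity together with \<open>G(x, y, 0) = 0\<close>.
\<close>

lemma young_star_shaped:
  assumes Y: "generalized_young g G" and \<tau>: "0 \<le> \<tau>" "\<tau> \<le> 1" and l: "0 \<le> l"
  shows "G x y (\<tau> * l) \<le> \<tau> * G x y l"
proof -
  let ?a = "\<tau> * l"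
  have a: "0 \<le> ?a" "?a \<le> l" using \<tau> l by (auto simp: mult_left_le_one_le)
  have 1: "G x y ?a \<le> ?a * g x y ?a"
    using young_increment(2)[OF Y order_refl a(1), of x y] young_zero[OF Y, of x y] by simp
  have 2: "(l - ?a) * g x y ?a \<le> G x y l - G x y ?a" by (rule young_increment(1)[OF Y a])
  have "(1 - \<tau>) * G x y ?a \<le> (1 - \<tau>) * (?a * g x y ?a)" using 1 \<tau> by (intro mult_left_mono) auto
  also have "\<dots> = \<tau> * ((l - ?a) * g x y ?a)" by (simp add: algebra_simps)
  also have "\<dots> \<le> \<tau> * (G x y l - G x y ?a)" using 2 \<tau> by (intro mult_left_mono) auto
  finally show ?thesis by (simp add: algebra_simps)
qed

text \<open>
  The step from \<open>b (1 - 1 / (2 q))\<close> to \<open>b\<close> is chosen so short that the growth condition bounds the increment by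
  half of the value at \<open>b\<close>.
\<close>

lemma young_doubling:
  assumes Y: "generalized_young g G" and q: "\<And>x y t. 0 < t \<Longrightarrow> t * g x y t \<le> q * G x y t" and q1: "1 < q"
    and b: "0 \<le> b"
  shows "G x y b \<le> 2 * G x y (b * (1 - 1 / (2 * q)))"
proof (cases "b = 0")
  case False
  let ?a = "b * (1 - 1 / (2 * q))"
  have q2: "0 \<le> 1 - 1 / (2 * q)" "1 - 1 / (2 * q) \<le> 1" using q1 by (auto simp: field_simps)
  have a: "0 \<le> ?a" "?a \<le> b" using b mult_left_mono[OF q2(2) b] mult_nonneg_nonneg[OF b q2(1)] by simp_all
  have "G x y b - G x y ?a \<le> (b - ?a) * g x y b" by (rule young_increment(2)[OF Y a])
  also have "\<dots> = (b * g x y b) / (2 * q)" by (simp add: algebra_simps)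
  also have "\<dots> \<le> (q * G x y b) / (2 * q)" using q[of b x y] b False q1 by (intro divide_right_mono) auto
  also have "\<dots> = G x y b / 2" using q1 by simp
  finally show ?thesis by simp
qed (use young_zero[OF Y] in simp)

text \<open>
  The quotient in the growth condition forces \<open>G\<close> to be nonzero, since a quotient by \<open>0\<close> is \<open>0\<close>.
\<close>

lemma young_density_le:
  assumes "H3 g G"
  obtains q where "1 < q" "\<And>x y t. 0 < t \<Longrightarrow> 0 \<le> G x y t \<Longrightarrow> t * g x y t \<le> q * G x y t"
proof -
  obtain p q where pq: "1 < p" "p \<le> q"
    and b: "\<And>x y t. 0 < t \<Longrightarrow> p \<le> t * g x y t / G x y t \<and> t * g x y t / G x y t \<le> q"
    using assms unfolding H3_def by blast
  show thesis
  proof (rule that)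
    show "1 < q" using pq by simp
    fix x y t assume t: "0 < t" "0 \<le> G x y t"
    have "G x y t \<noteq> 0" using b[OF t(1), of x y] pq by auto
    then have "0 < G x y t" using t by simp
    then show "t * g x y t \<le> q * G x y t" using b[OF t(1), of x y] by (simp add: pos_divide_le_eq)
  qed
qed

text \<open>
  Finitely many steps, each by the fixed factor \<open>1 / \<theta>\<close>, lead from \<open>1\<close>, where \<open>G\<close> is uniformly
  bounded, beyond \<open>l\<close>, and each step at most doubles the bound.
\<close>

lemma young_uniform_bound:
  assumes Y: "generalized_young g G" and "H1 G" "H3 g G" and l: "0 \<le> l"
  shows "\<exists>C. \<forall>x y. G x y l \<le> C"
proof -
  obtain C2 where C2: "\<And>x y. G x y 1 \<le> C2" using \<open>H1 G\<close> unfolding H1_def by blast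
  obtain q where q1: "1 < q" and q': "\<And>x y t. 0 < t \<Longrightarrow> 0 \<le> G x y t \<Longrightarrow> t * g x y t \<le> q * G x y t"
    using young_density_le[OF \<open>H3 g G\<close>] by blast
  have q: "t * g x y t \<le> q * G x y t" if "0 < t" for x y t
    using q'[OF that] young_nonneg[OF Y] that by simp
  define \<theta> where "\<theta> = 1 - 1 / (2 * q)"
  have \<theta>: "0 < \<theta>" "\<theta> < 1" using q1 by (auto simp: \<theta>_def field_simps)
  have step: "G x y ((1 / \<theta>) ^ k) \<le> 2 ^ k * C2" for k x y
  proof (induction k)
    case (Suc k)
    have "G x y ((1 / \<theta>) ^ Suc k) \<le> 2 * G x y ((1 / \<theta>) ^ Suc k * \<theta>)"
      unfolding \<theta>_def by (rule young_doubling[OF Y q q1]) (use \<theta> in \<open>auto simp: \<theta>_def\<close>)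
    also have "(1 / \<theta>) ^ Suc k * \<theta> = (1 / \<theta>) ^ k" using \<theta> by simp
    finally show ?case using Suc by simp
  qed (use C2 in simp)
  have "1 < 1 / \<theta>" using \<theta> by simp
  then obtain k where "l < (1 / \<theta>) ^ k" using real_arch_pow by blast
  then have "G x y l \<le> 2 ^ k * C2" for x y
    using young_mono[OF Y l, of "(1 / \<theta>) ^ k" x y] step[of x y k] by linarith
  then show ?thesis by blast
qed

lemma young_lipschitz:
  assumes Y: "generalized_young g G" and t: "0 \<le> t" "t \<le> T" "0 \<le> t'" "t' \<le> T"
  shows "\<bar>G x y t - G x y t'\<bar> \<le> \<bar>t - t'\<bar> * g x y T"
proof -
  have main: "\<bar>G x y t - G x y t'\<bar> \<le> \<bar>t - t'\<bar> * g x y T" if "0 \<le> t'" "t' \<le> t" "t \<le> T" for t t'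
  proof -
    have "g x y t \<le> g x y T" using Y that by (auto simp: generalized_young_def mono_on_def)
    then have "(t - t') * g x y t \<le> (t - t') * g x y T" using that by (intro mult_left_mono) auto
    then show ?thesis
      using young_increment(2)[OF Y that(1,2), of x y] young_mono[OF Y that(1,2), of x y] that by simp
  qed
  show ?thesis
    using main[of t' t] main[of t t'] t by (cases "t' \<le> t") (auto simp: abs_minus_commute)
qed

lemma young_continuous: "continuous_on {0..} (G x y)" if Y: "generalized_young g G"
  unfolding continuous_on_sequentially
proof (intro ballI allI impI, elim conjE)
  fix t and S :: "nat \<Rightarrow> real" assume t: "t \<in> {0..}" and S: "\<forall>n. S n \<in> {0..}" "S \<longlonglongrightarrow> t"
  have "\<forall>\<^sub>F n in sequentially. S n \<le> t + 1"
    using order_tendstoD(2)[OF S(2), of "t + 1"] by (auto elim!: eventually_mono)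
  then have "\<forall>\<^sub>F n in sequentially. norm (G x y (S n) - G x y t) \<le> \<bar>S n - t\<bar> * g x y (t + 1)"
  proof eventually_elim
    case (elim n)
    then show ?case using young_lipschitz[OF Y, of "S n" "t + 1" t x y] S(1) t by simp
  qed
  moreover have "(\<lambda>n. \<bar>S n - t\<bar> * g x y (t + 1)) \<longlonglongrightarrow> 0"
    using S(2) by (intro tendsto_mult_left_zero tendsto_rabs_zero) (simp add: LIM_zero)
  ultimately have "(\<lambda>n. G x y (S n) - G x y t) \<longlonglongrightarrow> 0" by (rule Lim_null_comparison)
  then show "(G x y \<circ> S) \<longlonglongrightarrow> G x y t" by (simp add: LIM_zero_iff comp_def)
qed

text \<open>
  On bounded sets \<open>G\<close> is Lipschitz in its last argument, uniformly in \<open>y\<close>, so that continuity in each of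
  the last two arguments gives joint continuity.
\<close>

lemma young_tendsto:
  assumes Y: "generalized_young g G" and H: "H1 G" "H2 G" "H3 g G"
    and y: "Y \<longlonglongrightarrow> y" and t: "T \<longlonglongrightarrow> t" and T: "\<And>n. 0 \<le> T n"
  shows "(\<lambda>n::nat. G x (Y n) (T n)) \<longlonglongrightarrow> G x y t"
proof -
  have t0: "0 \<le> t" using t T by (simp add: LIMSEQ_le_const)
  obtain q where q: "1 < q" "\<And>x y t. 0 < t \<Longrightarrow> 0 \<le> G x y t \<Longrightarrow> t * g x y t \<le> q * G x y t"
    using young_density_le[OF H(3)] by blast
  obtain C where C: "\<And>x y. G x y (t + 1) \<le> C" using young_uniform_bound[OF Y H(1,3), of "t + 1"] t0 by auto
  define D where "D = q * C / (t + 1)"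
  have gD: "g x y (t + 1) \<le> D" for y
  proof -
    have "(t + 1) * g x y (t + 1) \<le> q * G x y (t + 1)" using q(2)[of "t + 1" x y] t0 young_nonneg[OF Y] by simp
    also have "\<dots> \<le> q * C" using q(1) C by (intro mult_left_mono) auto
    finally show ?thesis using t0 by (simp add: D_def field_simps)
  qed
  have "\<forall>\<^sub>F n in sequentially. T n \<le> t + 1"
    using order_tendstoD(2)[OF t, of "t + 1"] by (auto elim!: eventually_mono)
  then have "\<forall>\<^sub>F n in sequentially. norm (G x (Y n) (T n) - G x (Y n) t) \<le> \<bar>T n - t\<bar> * D"
  proof eventually_elim
    case (elim n)
    have "\<bar>G x (Y n) (T n) - G x (Y n) t\<bar> \<le> \<bar>T n - t\<bar> * g x (Y n) (t + 1)"
      using elim T t0 by (intro young_lipschitz[OF Y]) auto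
    also have "\<dots> \<le> \<bar>T n - t\<bar> * D" by (intro mult_left_mono gD) auto
    finally show ?case by simp
  qed
  moreover have "(\<lambda>n. \<bar>T n - t\<bar> * D) \<longlonglongrightarrow> 0"
    using t by (intro tendsto_mult_left_zero tendsto_rabs_zero) (simp add: LIM_zero)
  ultimately have "(\<lambda>n. G x (Y n) (T n) - G x (Y n) t) \<longlonglongrightarrow> 0" by (rule Lim_null_comparison)
  moreover have "(\<lambda>n. G x (Y n) t) \<longlonglongrightarrow> G x y t"
  proof -
    have "isCont (\<lambda>y. G x y t) y" using H(2) t0 by (simp add: H2_def continuous_on_eq_continuous_at)
    then show ?thesis using y by (rule isCont_tendsto_compose)
  qed
  ultimately have "(\<lambda>n. (G x (Y n) (T n) - G x (Y n) t) + G x (Y n) t) \<longlonglongrightarrow> 0 + G x y t" by (rule tendsto_add)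
  then show ?thesis by simp
qed

section \<open>Measurability and iterated Lebesgue integrals\<close>

text \<open>
  Approximate \<open>\<tau>\<close> by functions with countably many values.
\<close>

lemma borel_measurable_caratheodory_compose:
  fixes F :: "'w \<Rightarrow> real \<Rightarrow> real"
  assumes meas: "\<And>t. 0 \<le> t \<Longrightarrow> (\<lambda>\<omega>. F \<omega> t) \<in> borel_measurable M"
    and cont: "\<And>\<omega>. continuous_on {0..} (F \<omega>)"
    and \<tau>[measurable]: "\<tau> \<in> borel_measurable M" and \<tau>0: "\<And>\<omega>. 0 \<le> \<tau> \<omega>"
  shows "(\<lambda>\<omega>. F \<omega> (\<tau> \<omega>)) \<in> borel_measurable M"
proof -
  \<comment> \<open>Round \<open>\<tau>\<close> down to multiples of \<open>1 / (m + 1)\<close>.\<close>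
  define a where "a m \<omega> = real (nat \<lfloor>real (Suc m) * \<tau> \<omega>\<rfloor>) / real (Suc m)" for m :: nat and \<omega>
  have m: "(\<lambda>\<omega>. F \<omega> (a m \<omega>)) \<in> borel_measurable M" for m
    unfolding a_def
    by (rule measurable_compose_countable[where f="\<lambda>i \<omega>. F \<omega> (real i / real (Suc m))"
          and g="\<lambda>\<omega>. nat \<lfloor>real (Suc m) * \<tau> \<omega>\<rfloor>"]) (auto intro!: meas)
  show ?thesis
  proof (rule borel_measurable_LIMSEQ_real[OF _ m])
    fix \<omega>
    have near: "norm (a m \<omega> - \<tau> \<omega>) \<le> 1 / real (Suc m)" for m
    proof -
      define N where "N = real (Suc m)"
      have N: "0 < N" by (simp add: N_def)
      have fl: "real (nat \<lfloor>N * \<tau> \<omega>\<rfloor>) = of_int \<lfloor>N * \<tau> \<omega>\<rfloor>" using N \<tau>0[of \<omega>] by simp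
      have "a m \<omega> - \<tau> \<omega> = (of_int \<lfloor>N * \<tau> \<omega>\<rfloor> - N * \<tau> \<omega>) / N"
        unfolding a_def N_def[symmetric] fl using N by (simp add: diff_divide_distrib)
      moreover have "\<bar>of_int \<lfloor>N * \<tau> \<omega>\<rfloor> - N * \<tau> \<omega>\<bar> \<le> 1" by linarith
      ultimately have "\<bar>a m \<omega> - \<tau> \<omega>\<bar> \<le> 1 / N"
        using N by (simp add: abs_divide divide_right_mono)
      then show ?thesis by (simp only: N_def real_norm_def)
    qed
    have "(\<lambda>m. a m \<omega> - \<tau> \<omega>) \<longlonglongrightarrow> 0"
      by (rule Lim_null_comparison[OF always_eventually LIMSEQ_Suc[OF lim_1_over_n]]) (use near in blast)
    then have "(\<lambda>m. a m \<omega>) \<longlonglongrightarrow> \<tau> \<omega>" by (simp add: LIM_zero_iff)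
    then show "(\<lambda>m. F \<omega> (a m \<omega>)) \<longlonglongrightarrow> F \<omega> (\<tau> \<omega>)"
      by (rule continuous_on_tendsto_compose[OF cont]) (use \<tau>0 in \<open>auto simp: a_def\<close>)
  qed
qed

lemma lebesgue_measurable_AE_eq:
  fixes f h :: "'a::euclidean_space \<Rightarrow> ennreal"
  assumes h: "h \<in> borel_measurable lebesgue" and eq: "AE x in lebesgue. f x = h x"
  shows "f \<in> borel_measurable lebesgue"
proof (rule measurableI)
  fix S :: "ennreal set" assume S: "S \<in> sets borel"
  have A: "h -` S \<inter> space lebesgue \<in> sets lebesgue" by (rule measurable_sets[OF h S])
  have ae: "AE x in lebesgue. x \<in> h -` S \<inter> space lebesgue \<longleftrightarrow> x \<in> f -` S \<inter> space lebesgue"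
    using eq by eventually_elim auto
  show "f -` S \<inter> space lebesgue \<in> sets lebesgue"
    by (rule completion.in_sets_AE[OF ae A]) simp
qed simp

text \<open>
  Sections of a Lebesgue measurable function need not be measurable; almost all of them are, which is
  enough for the iterated integrals.
\<close>

lemma lebesgue_tonelli:
  fixes f :: "'a::euclidean_space \<times> 'b::euclidean_space \<Rightarrow> ennreal"
  assumes f: "f \<in> borel_measurable lebesgue"
  shows "(\<lambda>x. \<integral>\<^sup>+y. f (x, y) \<partial>lborel) \<in> borel_measurable lebesgue"
    and "(\<integral>\<^sup>+p. f p \<partial>lebesgue) = (\<integral>\<^sup>+x. \<integral>\<^sup>+y. f (x, y) \<partial>lborel \<partial>lebesgue)"
proof -
  obtain f' where f': "f' \<in> borel_measurable lborel" and eq: "AE p in lborel. f p = f' p"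
    using completion_ex_borel_measurable[OF f] by blast
  have f'm: "f' \<in> borel_measurable (lborel \<Otimes>\<^sub>M lborel)" using f' by (simp only: lborel_prod)
  have "AE p in lborel \<Otimes>\<^sub>M lborel. f p = f' p" using eq by (simp only: lborel_prod)
  then have "AE x in lborel. AE y in lborel. f (x, y) = f' (x, y)" by (rule lborel_pair.AE_pair)
  then have sec: "AE x in lborel. (\<integral>\<^sup>+y. f (x, y) \<partial>lborel) = (\<integral>\<^sup>+y. f' (x, y) \<partial>lborel)"
    by eventually_elim (rule nn_integral_cong_AE)
  have m: "(\<lambda>x. \<integral>\<^sup>+y. f' (x, y) \<partial>lborel) \<in> borel_measurable lborel"
    by (rule lborel.borel_measurable_nn_integral_fst[OF f'm])
  show "(\<lambda>x. \<integral>\<^sup>+y. f (x, y) \<partial>lborel) \<in> borel_measurable lebesgue"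
    by (rule lebesgue_measurable_AE_eq[OF measurable_completion[OF m]]) (use sec in \<open>simp add: AE_completion_iff\<close>)
  have "(\<integral>\<^sup>+p. f p \<partial>lebesgue) = (\<integral>\<^sup>+p. f' p \<partial>lborel)"
    unfolding nn_integral_completion by (rule nn_integral_cong_AE[OF eq])
  also have "\<dots> = (\<integral>\<^sup>+p. f' p \<partial>(lborel \<Otimes>\<^sub>M lborel))" by (simp only: lborel_prod)
  also have "\<dots> = (\<integral>\<^sup>+x. \<integral>\<^sup>+y. f' (x, y) \<partial>lborel \<partial>lborel)"
    by (rule lborel.nn_integral_fst[OF f'm, symmetric])
  also have "\<dots> = (\<integral>\<^sup>+x. \<integral>\<^sup>+y. f (x, y) \<partial>lborel \<partial>lborel)"
    by (rule nn_integral_cong_AE) (use sec in eventually_elim, simp)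
  finally show "(\<integral>\<^sup>+p. f p \<partial>lebesgue) = (\<integral>\<^sup>+x. \<integral>\<^sup>+y. f (x, y) \<partial>lborel \<partial>lebesgue)"
    by (simp add: nn_integral_completion)
qed

section \<open>Smooth functions with compact support\<close>

text \<open>
  The derivative is continuous and vanishes off the support, hence is bounded. The bound for \<open>u\<close>
  itself follows by comparing with a point outside the support.
\<close>

lemma C2_compact_support_bounds:
  fixes u :: "real ^ 'n \<Rightarrow> real"
  assumes "C2_compact_support u"
  obtains Du :: "real ^ 'n \<Rightarrow> (real ^ 'n) \<Rightarrow>\<^sub>L real" and L R M
  where "\<And>x. (u has_derivative blinfun_apply (Du x)) (at x)" "0 \<le> L" "0 \<le> R" "0 \<le> M"
    "\<And>x y. \<bar>u x - u y\<bar> \<le> L * norm (x - y)" "\<And>x. R < norm x \<Longrightarrow> u x = 0" "\<And>x y. \<bar>u x - u y\<bar> \<le> M"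
proof -
  let ?K = "closure {x. u x \<noteq> 0}"
  obtain Du :: "real ^ 'n \<Rightarrow> (real ^ 'n) \<Rightarrow>\<^sub>L real" and D2u
    where Du: "\<And>x. (u has_derivative blinfun_apply (Du x)) (at x)"
      and D2u: "\<And>x. (Du has_derivative blinfun_apply (D2u x)) (at x)"
    using assms unfolding C2_compact_support_def C2_def by blast
  have K: "compact ?K" using assms by (simp add: C2_compact_support_def)
  have off: "u x = 0" if "x \<notin> ?K" for x using that closure_subset[of "{x. u x \<noteq> 0}"] by blast
  obtain R where R: "\<And>x. x \<in> ?K \<Longrightarrow> norm x \<le> R" using compact_imp_bounded[OF K] by (auto simp: bounded_iff)
  define R' where "R' = \<bar>R\<bar>"
  have R': "u x = 0" if "R' < norm x" for x
  proof (rule off)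
    show "x \<notin> ?K" using R[of x] that by (force simp: R'_def)
  qed
  have R0: "0 \<le> R'" by (simp add: R'_def)
  have "continuous_on ?K Du"
    by (intro continuous_at_imp_continuous_on ballI has_derivative_continuous[OF D2u])
  then have "bounded (Du ` ?K)" by (intro compact_imp_bounded compact_continuous_image K)
  then obtain L where L: "\<And>x. x \<in> ?K \<Longrightarrow> norm (Du x) \<le> L" by (auto simp: bounded_iff)
  define L' where "L' = \<bar>L\<bar>"
  have L': "norm (Du x) \<le> L'" for x
  proof (cases "x \<in> ?K")
    case True
    then show ?thesis using L[of x] by (simp add: L'_def)
  next
    case False
    have "(u has_derivative (\<lambda>_. 0)) (at x)"
    proof (rule has_derivative_transform_within_open[of "\<lambda>_. 0" _ _ _ "- ?K"])
      show "((\<lambda>_. 0) has_derivative (\<lambda>_. 0)) (at x)" by simp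
      show "open (- ?K)" by (rule open_Compl[OF closed_closure])
      show "x \<in> - ?K" using False unfolding Compl_iff .
      show "0 = u y" if "y \<in> - ?K" for y using off[of y] that by simp
    qed
    then have "blinfun_apply (Du x) = (\<lambda>_. 0)" using Du has_derivative_unique by blast
    then have "Du x = 0" by (simp add: blinfun_eqI)
    then show ?thesis by (simp add: L'_def)
  qed
  have lip: "\<bar>u x - u y\<bar> \<le> L' * norm (x - y)" for x y
    using differentiable_bound[of UNIV u "\<lambda>x. blinfun_apply (Du x)" L' x y] Du L'
    by (simp add: norm_blinfun.rep_eq)
  define e :: "real ^ 'n" where "e = (R' + 1) *\<^sub>R axis undefined 1"
  have e: "norm e = R' + 1" using R0 by (simp add: e_def)
  have ue: "u e = 0" using R'[of e] e by simp
  have b: "\<bar>u x\<bar> \<le> L' * (2 * R' + 1)" for x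
  proof (cases "R' < norm x")
    case True
    then show ?thesis using R' R0 by (simp add: L'_def)
  next
    case False
    have "\<bar>u x - u e\<bar> \<le> L' * norm (x - e)" by (rule lip)
    also have "\<dots> \<le> L' * (2 * R' + 1)"
      using norm_triangle_ineq4[of x e] False e by (intro mult_left_mono) (auto simp: L'_def)
    finally show ?thesis by (simp add: ue)
  qed
  show thesis
  proof (rule that[of Du L' R' "2 * (L' * (2 * R' + 1))"])
    show "\<bar>u x - u y\<bar> \<le> 2 * (L' * (2 * R' + 1))" for x y using b[of x] b[of y] by linarith
    show "0 \<le> 2 * (L' * (2 * R' + 1))" using R0 by (simp add: L'_def)
  qed (use Du lip R' R0 in \<open>auto simp: L'_def\<close>)
qed

lemma grad_inner:
  fixes u :: "real ^ 'n \<Rightarrow> real"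
  assumes "(u has_derivative D) (at x)"
  shows "grad u x \<bullet> z = D z"
proof -
  have D: "frechet_derivative u (at x) = D" using frechet_derivative_at[OF assms] by simp
  have lin: "linear D" using assms by (rule has_derivative_linear)
  have "D z = D (\<Sum>i\<in>UNIV. z $ i *\<^sub>R axis i 1)"
    using basis_expansion[of z] by (simp add: scalar_mult_eq_scaleR)
  also have "\<dots> = (\<Sum>i\<in>UNIV. z $ i * D (axis i 1))"
    using lin by (simp add: linear_sum linear_cmul)
  finally show ?thesis by (simp add: grad_def inner_vec_def D mult.commute)
qed

lemma difference_quotient_tendsto:
  fixes u :: "real ^ 'n \<Rightarrow> real"
  assumes u: "(u has_derivative D) (at x)" and \<tau>: "\<tau> \<longlonglongrightarrow> 0" "\<And>m::nat. 0 < \<tau> m"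
  shows "(\<lambda>m. \<bar>u x - u (x + \<tau> m *\<^sub>R z)\<bar> / \<tau> m) \<longlonglongrightarrow> \<bar>D z\<bar>"
proof -
  have lin: "linear D" using u by (rule has_derivative_linear)
  have "((\<lambda>t. x + t *\<^sub>R z) has_derivative (\<lambda>t. t *\<^sub>R z)) (at (0::real))"
    by (auto intro!: derivative_eq_intros)
  moreover have "(u has_derivative D) (at (x + 0 *\<^sub>R z))" using u by simp
  ultimately have "((\<lambda>t. u (x + t *\<^sub>R z)) has_derivative (\<lambda>t. D (t *\<^sub>R z))) (at 0)"
    by (rule has_derivative_compose)
  then have "((\<lambda>t. u (x + t *\<^sub>R z)) has_real_derivative D z) (at 0)"
    using lin by (simp add: has_field_derivative_def linear_cmul mult.commute[of _ "D z"])
  then have "(\<lambda>t. (u (x + t *\<^sub>R z) - u x) / t) \<midarrow>0\<rightarrow> D z" by (simp add: DERIV_def)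
  moreover have "filterlim \<tau> (at 0) sequentially"
    using \<tau> by (auto simp: filterlim_at intro!: always_eventually less_imp_neq[symmetric])
  ultimately have "(\<lambda>m. (u (x + \<tau> m *\<^sub>R z) - u x) / \<tau> m) \<longlonglongrightarrow> D z" by (rule filterlim_compose)
  then have "(\<lambda>m. \<bar>(u (x + \<tau> m *\<^sub>R z) - u x) / \<tau> m\<bar>) \<longlonglongrightarrow> \<bar>D z\<bar>" by (rule tendsto_rabs)
  moreover have "\<bar>(u (x + \<tau> m *\<^sub>R z) - u x) / \<tau> m\<bar> = \<bar>u x - u (x + \<tau> m *\<^sub>R z)\<bar> / \<tau> m" for m
    using \<tau>(2)[of m] by (simp add: abs_divide abs_minus_commute)
  ultimately show ?thesis by simp
qed

section \<open>The limit density\<close>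

lemma nn_integral_orthogonal:
  fixes T :: "real ^ 'n \<Rightarrow> real ^ 'n" and f :: "real ^ 'n \<Rightarrow> ennreal"
  assumes T: "orthogonal_transformation T" and f: "f \<in> borel_measurable borel"
  shows "(\<integral>\<^sup>+z. f (T z) \<partial>lborel) = (\<integral>\<^sup>+z. f z \<partial>lborel)"
proof -
  have Tm: "T \<in> borel_measurable borel"
    by (intro borel_measurable_continuous_onI linear_continuous_on)
      (use T in \<open>simp add: linear_linear orthogonal_transformation_linear\<close>)
  have iso: "dist (T x) (T y) = dist x y" for x y
    using linear_diff[OF orthogonal_transformation_linear[OF T], of x y]
      orthogonal_transformation_norm[OF T, of "x - y"] by (simp add: dist_norm)
  have "distr lborel borel T = lborel"
  proof (rule measure_eqI)
    fix A assume "A \<in> sets (distr lborel borel T)"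
    then have A: "A \<in> sets borel" by simp
    have V: "T -` A \<inter> space borel \<in> sets borel" by (rule measurable_sets[OF Tm A])
    have im: "T ` (T -` A) = A" using orthogonal_transformation_surj[OF T] by (rule surj_image_vimage_eq)
    have "emeasure (distr lborel borel T) A = emeasure lborel (T -` A)"
      using Tm A by (subst emeasure_distr) auto
    also have "\<dots> = emeasure lborel (T ` (T -` A))"
      by (rule emeasure_lborel_isometry[symmetric]) (use V im A iso in auto)
    finally show "emeasure (distr lborel borel T) A = emeasure lborel A" unfolding im .
  qed simp
  then have "(\<integral>\<^sup>+z. f z \<partial>lborel) = (\<integral>\<^sup>+z. f z \<partial>distr lborel borel T)" by simp
  also have "\<dots> = (\<integral>\<^sup>+z. f (T z) \<partial>lborel)" using Tm f by (intro nn_integral_distr) auto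
  finally show ?thesis by simp
qed

lemma borel_measurable_young:
  assumes Y: "generalized_young g G" and \<tau>: "\<tau> \<in> borel_measurable M" "\<And>\<omega>. 0 \<le> \<tau> \<omega>"
  shows "(\<lambda>\<omega>. G x y (\<tau> \<omega>)) \<in> borel_measurable M"
  by (rule borel_measurable_caratheodory_compose[where F="\<lambda>_. G x y"]) (use young_continuous[OF Y] \<tau> in auto)

text \<open>
  A rotation takes \<open>v\<close> to the axis of index \<open>k\<close>; it preserves volume and norms, so only the coordinate
  \<open>z $ k\<close> remains, and polar coordinates produce the two integrals in the definition of \<open>H0\<close>.
\<close>

lemma H0_eq_ball_integral:
  fixes G :: "real ^ 'n \<Rightarrow> real ^ 'n \<Rightarrow> real \<Rightarrow> real" and v x :: "real ^ 'n" and k :: 'n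
  assumes Y: "generalized_young g G"
  shows "(\<integral>\<^sup>+z\<in>cball 0 1. ennreal (G x x \<bar>v \<bullet> z\<bar>) * ennreal (1 / norm z ^ CARD('n)) \<partial>lborel)
    = H0 G k x (norm v)"
proof -
  have [measurable]: "cball (0 :: real ^ 'n) 1 \<in> sets borel" by simp
  have nd: "norm (norm v *\<^sub>R axis k (1::real)) = norm v" by simp
  obtain T :: "real ^ 'n \<Rightarrow> real ^ 'n"
    where T: "orthogonal_transformation T" and Tv: "T (norm v *\<^sub>R axis k 1) = v"
    by (rule orthogonal_transformation_exists[OF nd])
  have Tz: "\<bar>v \<bullet> T z\<bar> = norm v * \<bar>z $ k\<bar>" for z
  proof -
    have "v \<bullet> T z = (norm v *\<^sub>R axis k 1) \<bullet> z"
      using T Tv by (metis orthogonal_transformation_def)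
    also have "\<dots> = norm v * z $ k" by (simp add: cart_eq_inner_axis inner_commute)
    finally show ?thesis by (simp add: abs_mult)
  qed
  have comp[measurable]: "(\<lambda>w :: real ^ 'n. w $ k) \<in> borel_measurable borel"
    by (intro borel_measurable_continuous_onI continuous_intros)
  have Gm[measurable]: "(\<lambda>z. G x x \<bar>v \<bullet> z\<bar>) \<in> borel_measurable borel"
    by (rule borel_measurable_young[OF Y]) auto
  have Fm[measurable]: "(\<lambda>p. G x x (norm v * \<bar>fst p $ k\<bar> * \<bar>snd p\<bar>)) \<in> borel_measurable (borel \<Otimes>\<^sub>M (borel :: real measure))"
  proof (rule borel_measurable_young[OF Y])
    show "(\<lambda>p. norm v * \<bar>fst p $ k\<bar> * \<bar>snd p\<bar>) \<in> borel_measurable (borel \<Otimes>\<^sub>M (borel :: real measure))"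
      by measurable
  qed simp
  let ?F = "\<lambda>w r. ennreal (G x x (norm v * \<bar>w $ k\<bar> * \<bar>r\<bar>)) * ennreal (1 / r) * indicator {0<..<1} r"
  have "(\<integral>\<^sup>+z\<in>cball 0 1. ennreal (G x x \<bar>v \<bullet> z\<bar>) * ennreal (1 / norm z ^ CARD('n)) \<partial>lborel)
    = (\<integral>\<^sup>+z. ennreal (G x x \<bar>v \<bullet> T z\<bar>) * ennreal (1 / norm (T z) ^ CARD('n)) * indicator (cball 0 1) (T z) \<partial>lborel)"
    by (rule nn_integral_orthogonal[OF T, symmetric]) measurable
  also have "\<dots> = (\<integral>\<^sup>+z\<in>cball 0 1. ennreal (G x x (norm v * \<bar>z $ k\<bar>)) * ennreal (1 / norm z ^ DIM(real ^ 'n)) \<partial>lborel)"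
    unfolding Tz using T by (intro nn_integral_cong) (auto simp: orthogonal_transformation_norm split: split_indicator)
  also have "\<dots> = (\<integral>\<^sup>+w. (\<integral>\<^sup>+r\<in>{0<..1}. ennreal (G x x (norm v * \<bar>(r *\<^sub>R w) $ k\<bar>)) * ennreal (1 / r) \<partial>lborel) \<partial>cone_measure)"
  proof (rule nn_integral_polar_unit_ball)
    have "(\<lambda>z. G x x (norm v * \<bar>z $ k\<bar>)) \<in> borel_measurable (borel :: (real ^ 'n) measure)"
      by (rule borel_measurable_young[OF Y]) auto
    then show "(\<lambda>z. ennreal (G x x (norm v * \<bar>z $ k\<bar>))) \<in> borel_measurable (borel :: (real ^ 'n) measure)"
      by measurable
  qed
  also have "\<dots> = (\<integral>\<^sup>+w. (\<integral>\<^sup>+r. ?F w r \<partial>lborel) \<partial>cone_measure)"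
  proof (rule nn_integral_cong, rule nn_integral_cong_AE)
    fix w :: "real ^ 'n"
    show "AE r in lborel. ennreal (G x x (norm v * \<bar>(r *\<^sub>R w) $ k\<bar>)) * ennreal (1 / r) * indicator {0<..1} r = ?F w r"
      using AE_lborel_singleton[of "1::real"]
      by eventually_elim (auto simp: abs_mult mult_ac split: split_indicator)
  qed
  also have "\<dots> = (\<integral>\<^sup>+r. (\<integral>\<^sup>+w. ?F w r \<partial>cone_measure) \<partial>lborel)"
  proof -
    interpret C: finite_measure "cone_measure :: (real ^ 'n) measure" by (rule finite_measure_cone_measure)
    interpret P: pair_sigma_finite "cone_measure :: (real ^ 'n) measure" "lborel :: real measure" ..
    show ?thesis by (rule P.Fubini'[symmetric]) (use Fm in measurable)
  qed
  also have "\<dots> = H0 G k x (norm v)"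
    unfolding H0_def
  proof (intro nn_integral_cong)
    fix r :: real
    have wm: "(\<lambda>w :: real ^ 'n. G x x (norm v * \<bar>w $ k\<bar> * \<bar>r\<bar>)) \<in> borel_measurable borel"
      by (rule borel_measurable_young[OF Y]) auto
    show "(\<integral>\<^sup>+w. ?F w r \<partial>cone_measure)
      = (\<integral>\<^sup>+w\<in>sphere 0 1. ennreal (G x x (norm v * \<bar>w $ k\<bar> * r)) \<partial>hausdorff_measure (CARD('n) - 1)) / ennreal r * indicator {0<..<1} r"
    proof (cases "r \<in> {0<..<1}")
      case True
      then have r: "0 < r" by simp
      have "(\<integral>\<^sup>+w\<in>sphere 0 1. ennreal (G x x (norm v * \<bar>w $ k\<bar> * r)) \<partial>hausdorff_measure (CARD('n) - 1))
         = (\<integral>\<^sup>+w. ennreal (G x x (norm v * \<bar>w $ k\<bar> * \<bar>r\<bar>)) \<partial>cone_measure)"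
        using r nn_integral_sphere[of "\<lambda>w. ennreal (G x x (norm v * \<bar>w $ k\<bar> * \<bar>r\<bar>))"] wm by simp
      moreover have "(\<integral>\<^sup>+w. ?F w r \<partial>cone_measure)
         = (\<integral>\<^sup>+w. ennreal (G x x (norm v * \<bar>w $ k\<bar> * \<bar>r\<bar>)) \<partial>cone_measure) * ennreal (1 / r)"
        using True wm by (simp add: nn_integral_multc)
      moreover have "X / ennreal r = X * ennreal (1 / r)" for X
        using r by (simp add: divide_ennreal_def inverse_ennreal inverse_eq_divide)
      ultimately show ?thesis using True by simp
    qed simp
  qed
  finally show ?thesis .
qed

section \<open>The energy near the diagonal\<close>

definition frac_kernel ::
    "real \<Rightarrow> (real ^ 'n \<Rightarrow> real ^ 'n \<Rightarrow> real \<Rightarrow> real) \<Rightarrow> (real ^ 'n \<Rightarrow> real) \<Rightarrow> real ^ 'n \<Rightarrow> real ^ 'n \<Rightarrow> real" where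
  "frac_kernel s G u x y = G x y (\<bar>u x - u y\<bar> / norm (x - y) powr s) / norm (x - y) ^ CARD('n)"

lemma frac_kernel_measurable:
  fixes u :: "real ^ 'n \<Rightarrow> real"
  assumes Y: "generalized_young g G" and u: "continuous_on UNIV u"
  shows "(\<lambda>p. ennreal (frac_kernel s G u (fst p) (snd p))) \<in> borel_measurable lebesgue"
proof -
  have um[measurable]: "u \<in> borel_measurable borel" using u by (rule borel_measurable_continuous_onI)
  have lift: "f \<in> borel_measurable lebesgue"
    if "f \<in> borel_measurable (borel \<Otimes>\<^sub>M borel)" for f :: "(real ^ 'n) \<times> (real ^ 'n) \<Rightarrow> real"
    using that by (intro measurable_completion) (simp add: borel_prod)
  have t: "(\<lambda>p. \<bar>u (fst p) - u (snd p)\<bar> / norm (fst p - snd p) powr s) \<in> borel_measurable lebesgue"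
    by (rule lift) measurable
  have d: "(\<lambda>p::(real ^ 'n) \<times> (real ^ 'n). norm (fst p - snd p) ^ CARD('n)) \<in> borel_measurable lebesgue"
    by (rule lift) measurable
  have "(\<lambda>p. G (fst p) (snd p) (\<bar>u (fst p) - u (snd p)\<bar> / norm (fst p - snd p) powr s)) \<in> borel_measurable lebesgue"
  proof (rule borel_measurable_caratheodory_compose[where F="\<lambda>p. G (fst p) (snd p)", OF _ _ t])
    show "(\<lambda>p. G (fst p) (snd p) t) \<in> borel_measurable lebesgue" if "0 \<le> t" for t
      using Y that unfolding generalized_young_def case_prod_beta' by blast
    show "continuous_on {0..} (G (fst p) (snd p))" for p by (rule young_continuous[OF Y])
  qed simp
  then have "(\<lambda>p. frac_kernel s G u (fst p) (snd p)) \<in> borel_measurable lebesgue"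
    unfolding frac_kernel_def using d by (rule borel_measurable_divide)
  then show ?thesis by simp
qed

text \<open>
  The inner integral of the energy over the points at distance at most \<open>1\<close> from \<open>x\<close>; its companion
  takes the remaining points.
\<close>

definition near_density ::
    "real \<Rightarrow> (real ^ 'n \<Rightarrow> real ^ 'n \<Rightarrow> real \<Rightarrow> real) \<Rightarrow> (real ^ 'n \<Rightarrow> real) \<Rightarrow> real ^ 'n \<Rightarrow> ennreal" where
  "near_density s G u x = (\<integral>\<^sup>+y\<in>cball x 1. ennreal (frac_kernel s G u x y) \<partial>lborel)"

definition far_density ::
    "real \<Rightarrow> (real ^ 'n \<Rightarrow> real ^ 'n \<Rightarrow> real \<Rightarrow> real) \<Rightarrow> (real ^ 'n \<Rightarrow> real) \<Rightarrow> real ^ 'n \<Rightarrow> ennreal" where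
  "far_density s G u x = (\<integral>\<^sup>+y\<in>- cball x 1. ennreal (frac_kernel s G u x y) \<partial>lborel)"

lemma frac_energy_split:
  fixes u :: "real ^ 'n \<Rightarrow> real"
  assumes Y: "generalized_young g G" and u: "continuous_on UNIV u"
  shows "near_density s G u \<in> borel_measurable lebesgue"
    and "frac_energy s G u = (\<integral>\<^sup>+x. near_density s G u x \<partial>lebesgue) + (\<integral>\<^sup>+x. far_density s G u x \<partial>lebesgue)"
proof -
  define K where "K p = ennreal (frac_kernel s G u (fst p) (snd p))" for p
  have meas: "(\<lambda>p. K p * indicator A p) \<in> borel_measurable lebesgue" if "A \<in> sets borel" for A
    unfolding K_def using that
    by (intro borel_measurable_times_ennreal frac_kernel_measurable[OF Y u] borel_measurable_indicator) simp
  let ?N = "{p :: (real ^ 'n) \<times> (real ^ 'n). dist (fst p) (snd p) \<le> 1}"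
  let ?F = "{p :: (real ^ 'n) \<times> (real ^ 'n). 1 < dist (fst p) (snd p)}"
  have "?N \<in> sets borel" by (intro borel_closed closed_Collect_le continuous_intros)
  note N = meas[OF this]
  have "?F \<in> sets borel" by (intro borel_open open_Collect_less continuous_intros)
  note F = meas[OF this]
  have near: "(\<lambda>x. \<integral>\<^sup>+y. K (x, y) * indicator ?N (x, y) \<partial>lborel) = near_density s G u"
    unfolding near_density_def K_def by (intro ext nn_integral_cong) (auto split: split_indicator)
  have far: "(\<lambda>x. \<integral>\<^sup>+y. K (x, y) * indicator ?F (x, y) \<partial>lborel) = far_density s G u"
    unfolding far_density_def K_def by (intro ext nn_integral_cong) (auto split: split_indicator)
  show "near_density s G u \<in> borel_measurable lebesgue"
    using lebesgue_tonelli(1)[OF N] unfolding near .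
  have "frac_energy s G u = (\<integral>\<^sup>+p. K p \<partial>lebesgue)"
    by (simp add: frac_energy_def frac_kernel_def K_def case_prod_beta')
  also have "\<dots> = (\<integral>\<^sup>+p. K p * indicator ?N p + K p * indicator ?F p \<partial>lebesgue)"
    by (intro nn_integral_cong) (auto split: split_indicator)
  also have "\<dots> = (\<integral>\<^sup>+p. K p * indicator ?N p \<partial>lebesgue) + (\<integral>\<^sup>+p. K p * indicator ?F p \<partial>lebesgue)"
    by (rule nn_integral_add[OF N F])
  also have "(\<integral>\<^sup>+p. K p * indicator ?N p \<partial>lebesgue) = (\<integral>\<^sup>+x. near_density s G u x \<partial>lebesgue)"
    unfolding lebesgue_tonelli(2)[OF N] near[symmetric] ..
  also have "(\<integral>\<^sup>+p. K p * indicator ?F p \<partial>lebesgue) = (\<integral>\<^sup>+x. far_density s G u x \<partial>lebesgue)"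
    unfolding lebesgue_tonelli(2)[OF F] far[symmetric] ..
  finally show "frac_energy s G u = (\<integral>\<^sup>+x. near_density s G u x \<partial>lebesgue) + (\<integral>\<^sup>+x. far_density s G u x \<partial>lebesgue)" .
qed

lemma frac_kernel_section_measurable:
  fixes u :: "real ^ 'n \<Rightarrow> real"
  assumes Y: "generalized_young g G" and H: "H2 G" and u: "continuous_on UNIV u"
  shows "(\<lambda>h. G x (x + h) (\<bar>u x - u (x + h)\<bar> / norm h powr s)) \<in> borel_measurable borel"
proof -
  have um[measurable]: "u \<in> borel_measurable borel" using u by (rule borel_measurable_continuous_onI)
  show ?thesis
  proof (rule borel_measurable_caratheodory_compose[where F="\<lambda>h. G x (x + h)"])
    show "(\<lambda>h. G x (x + h) t) \<in> borel_measurable borel" if "0 \<le> t" for t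
    proof (rule borel_measurable_continuous_onI)
      have "continuous_on UNIV (\<lambda>y. G x y t)" using H that by (simp add: H2_def)
      then show "continuous_on UNIV (\<lambda>h. G x (x + h) t)"
        by (rule continuous_on_compose2) (auto intro!: continuous_intros)
    qed
    show "continuous_on {0..} (G x (x + h))" for h by (rule young_continuous[OF Y])
    show "(\<lambda>h. \<bar>u x - u (x + h)\<bar> / norm h powr s) \<in> borel_measurable borel" by measurable
  qed simp
qed

text \<open>
  With \<open>a = s / (1 - s)\<close> the dilation is \<open>h = \<bar>z\<bar>\<^sup>a z\<close>, and \<open>\<bar>h\<bar>\<^sup>s = \<bar>z\<bar>\<^sup>(\<^sup>a\<^sup>+\<^sup>1\<^sup>)\<^sup>s = \<bar>z\<bar>\<^sup>a\<close>.
\<close>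

lemma near_integral_dilated:
  fixes u :: "real ^ 'n \<Rightarrow> real"
  assumes Y: "generalized_young g G" and H: "H2 G" and u: "continuous_on UNIV u"
    and s: "0 < s" "s < 1"
  defines "\<tau> \<equiv> \<lambda>z :: real ^ 'n. norm z powr (s / (1 - s))"
  shows "ennreal (1 - s) * near_density s G u x
    = (\<integral>\<^sup>+z\<in>cball 0 1. ennreal (G x (x + \<tau> z *\<^sub>R z) (\<bar>u x - u (x + \<tau> z *\<^sub>R z)\<bar> / \<tau> z)) * ennreal (1 / norm z ^ CARD('n)) \<partial>lborel)"
proof -
  define f where "f h = G x (x + h) (\<bar>u x - u (x + h)\<bar> / norm h powr s)" for h
  have fm[measurable]: "f \<in> borel_measurable borel"
    unfolding f_def by (rule frac_kernel_section_measurable[OF Y H u])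
  have f0: "0 \<le> f h" for h unfolding f_def by (rule young_nonneg[OF Y]) simp
  have [measurable]: "cball (0 :: real ^ 'n) 1 \<in> sets borel" by simp
  define \<alpha> where "\<alpha> = 1 / (1 - s)"
  have \<alpha>: "0 < \<alpha>" "(1 - s) * \<alpha> = 1" "\<alpha> - 1 = s / (1 - s)" using s by (auto simp: \<alpha>_def field_simps)
  have ker: "frac_kernel s G u x (x + h) = f h * (1 / norm h ^ CARD('n))" for h
    by (simp add: frac_kernel_def f_def)
  have shift: "(\<integral>\<^sup>+y. F (y - x) \<partial>lborel) = (\<integral>\<^sup>+h. F h \<partial>lborel)"
    if F: "F \<in> borel_measurable borel" for F :: "real ^ 'n \<Rightarrow> ennreal"
  proof -
    have "(\<integral>\<^sup>+h. F h \<partial>lborel) = (\<integral>\<^sup>+h. F h \<partial>distr lborel borel ((+) (- x)))" by (simp add: lborel_distr_plus)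
    also have "\<dots> = (\<integral>\<^sup>+y. F (- x + y) \<partial>lborel)" using F by (intro nn_integral_distr) auto
    finally show ?thesis by simp
  qed
  have "near_density s G u x
    = (\<integral>\<^sup>+y. ennreal (f (y - x)) * ennreal (1 / norm (y - x) ^ CARD('n)) * indicator (cball 0 1) (y - x) \<partial>lborel)"
    unfolding near_density_def
  proof (intro nn_integral_cong)
    fix y
    have "frac_kernel s G u x y = f (y - x) * (1 / norm (y - x) ^ CARD('n))" using ker[of "y - x"] by simp
    then have "ennreal (frac_kernel s G u x y) = ennreal (f (y - x)) * ennreal (1 / norm (y - x) ^ CARD('n))"
      using f0 by (simp only: ennreal_mult' f0)
    moreover have "indicator (cball x 1) y = (indicator (cball 0 1) (y - x) :: ennreal)"
      by (auto simp: dist_norm norm_minus_commute split: split_indicator)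
    ultimately show "ennreal (frac_kernel s G u x y) * indicator (cball x 1) y
      = ennreal (f (y - x)) * ennreal (1 / norm (y - x) ^ CARD('n)) * indicator (cball 0 1) (y - x)" by simp
  qed
  also have "\<dots> = (\<integral>\<^sup>+h\<in>cball 0 1. ennreal (f h) * ennreal (1 / norm h ^ DIM(real ^ 'n)) \<partial>lborel)"
  proof -
    have "(\<lambda>h. ennreal (f h) * ennreal (1 / norm h ^ CARD('n)) * indicator (cball 0 1) h) \<in> borel_measurable borel"
      by measurable
    from shift[OF this] show ?thesis by simp
  qed
  also have "\<dots> = ennreal \<alpha> * (\<integral>\<^sup>+z\<in>cball 0 1. ennreal (f (norm z powr (\<alpha> - 1) *\<^sub>R z)) * ennreal (1 / norm z ^ DIM(real ^ 'n)) \<partial>lborel)"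
    by (rule nn_integral_radial_dilation[OF fm f0 \<alpha>(1)])
  finally have "ennreal (1 - s) * near_density s G u x
    = ennreal ((1 - s) * \<alpha>) * (\<integral>\<^sup>+z\<in>cball 0 1. ennreal (f (\<tau> z *\<^sub>R z)) * ennreal (1 / norm z ^ CARD('n)) \<partial>lborel)"
    using s \<alpha>(1) by (simp add: ennreal_mult mult.assoc \<alpha>(3) \<tau>_def)
  also have "\<dots> = (\<integral>\<^sup>+z\<in>cball 0 1. ennreal (f (\<tau> z *\<^sub>R z)) * ennreal (1 / norm z ^ CARD('n)) \<partial>lborel)"
    by (simp only: \<alpha>(2) ennreal_1 mult_1)
  also have "\<dots> = (\<integral>\<^sup>+z\<in>cball 0 1. ennreal (G x (x + \<tau> z *\<^sub>R z) (\<bar>u x - u (x + \<tau> z *\<^sub>R z)\<bar> / \<tau> z)) * ennreal (1 / norm z ^ CARD('n)) \<partial>lborel)"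
  proof (intro nn_integral_cong)
    fix z :: "real ^ 'n"
    have "norm (\<tau> z *\<^sub>R z) powr s = \<tau> z" if "z \<noteq> 0"
    proof -
      have n: "0 < norm z" using that by simp
      have "norm (\<tau> z *\<^sub>R z) = norm z powr (s / (1 - s)) * norm z powr 1" using n by (simp add: \<tau>_def)
      also have "\<dots> = norm z powr (s / (1 - s) + 1)" by (rule powr_add[symmetric])
      finally have "norm (\<tau> z *\<^sub>R z) powr s = norm z powr ((s / (1 - s) + 1) * s)" by (simp add: powr_powr)
      also have "(s / (1 - s) + 1) * s = s / (1 - s)" using s by (simp add: field_simps)
      finally show ?thesis by (simp add: \<tau>_def)
    qed
    then show "ennreal (f (\<tau> z *\<^sub>R z)) * ennreal (1 / norm z ^ CARD('n)) * indicator (cball 0 1) z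
       = ennreal (G x (x + \<tau> z *\<^sub>R z) (\<bar>u x - u (x + \<tau> z *\<^sub>R z)\<bar> / \<tau> z)) * ennreal (1 / norm z ^ CARD('n)) * indicator (cball 0 1) z"
      by (cases "z = 0") (simp_all add: f_def)
  qed
  finally show ?thesis .
qed

lemma nn_integral_norm_power_ball:
  "(\<integral>\<^sup>+z\<in>cball (0::'a) 1. ennreal (norm z) * ennreal (1 / norm z ^ DIM('a)) \<partial>lborel)
     = emeasure (cone_measure :: 'a::euclidean_space measure) UNIV"
proof -
  have "(\<integral>\<^sup>+z\<in>cball (0::'a) 1. ennreal (norm z) * ennreal (1 / norm z ^ DIM('a)) \<partial>lborel)
    = (\<integral>\<^sup>+w. (\<integral>\<^sup>+r\<in>{0<..1}. ennreal (norm (r *\<^sub>R w)) * ennreal (1 / r) \<partial>lborel) \<partial>(cone_measure :: 'a measure))"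
    by (rule nn_integral_polar_unit_ball) measurable
  also have "\<dots> = (\<integral>\<^sup>+w. 1 \<partial>(cone_measure :: 'a measure))"
  proof (rule nn_integral_cong_AE)
    show "AE w in (cone_measure :: 'a measure).
      (\<integral>\<^sup>+r\<in>{0<..1}. ennreal (norm (r *\<^sub>R w)) * ennreal (1 / r) \<partial>lborel) = 1"
      using AE_cone_measure_norm
    proof eventually_elim
      case (elim w)
      have "ennreal r * ennreal (1 / r) = 1" if "0 < r" for r
        using that by (simp add: ennreal_mult[symmetric])
      then have "(\<integral>\<^sup>+r\<in>{0<..1}. ennreal (norm (r *\<^sub>R w)) * ennreal (1 / r) \<partial>lborel)
        = (\<integral>\<^sup>+r. indicator {0<..1::real} r \<partial>lborel)"
        by (intro nn_integral_cong) (auto simp: elim split: split_indicator)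
      then show ?case by simp
    qed
  qed
  finally show ?thesis by simp
qed

lemma powr_sequence_tendsto_0:
  fixes S :: "nat \<Rightarrow> real" and r :: real
  assumes S: "S \<longlonglongrightarrow> 1" "\<And>m. 0 < S m" "\<And>m. S m < 1" and r: "0 < r" "r < 1"
  shows "(\<lambda>m. r powr (S m / (1 - S m))) \<longlonglongrightarrow> 0"
proof -
  have "filterlim (\<lambda>m. 1 - S m) (at_right 0) sequentially"
    unfolding filterlim_at using S by (auto intro!: tendsto_eq_intros always_eventually simp: less_imp_neq[symmetric])
  then have "filterlim (\<lambda>m. inverse (1 - S m)) at_top sequentially"
    by (rule filterlim_compose[OF filterlim_inverse_at_top_right])
  then have "filterlim (\<lambda>m. S m * inverse (1 - S m)) at_top sequentially"
    by (rule filterlim_tendsto_pos_mult_at_top[OF S(1) zero_less_one])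
  then have "filterlim (\<lambda>m. ln r * (S m * inverse (1 - S m))) at_bot sequentially"
    by (rule filterlim_tendsto_neg_mult_at_bot[OF tendsto_const, rotated]) (use r in auto)
  then have "(\<lambda>m. exp (ln r * (S m * inverse (1 - S m)))) \<longlonglongrightarrow> 0"
    by (rule filterlim_compose[OF exp_at_bot])
  then show ?thesis using r by (simp add: powr_def divide_inverse mult.commute)
qed

text \<open>
  Dominated convergence, first in \<open>z\<close> with the bound \<open>C \<bar>z\<bar> / \<bar>z\<bar>\<^sup>n\<close>, where \<open>C\<close> bounds \<open>G\<close> at the Lipschitz
  constant of \<open>u\<close>, and then in \<open>x\<close>: pairs at distance at most \<open>1\<close> contribute only for \<open>x\<close> in the
  \<open>1\<close>-neighbourhood of a ball containing the support of \<open>u\<close>.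
\<close>

lemma near_energy_tendsto:
  fixes u :: "real ^ 'n \<Rightarrow> real" and k :: 'n and S :: "nat \<Rightarrow> real"
  assumes Y: "generalized_young g G" and H: "H1 G" "H2 G" "H3 g G" and u: "C2_compact_support u"
    and S: "S \<longlonglongrightarrow> 1" "\<And>m. 0 < S m" "\<And>m. S m < 1"
  shows "(\<lambda>m. \<integral>\<^sup>+x. ennreal (1 - S m) * near_density (S m) G u x \<partial>lebesgue)
    \<longlonglongrightarrow> (\<integral>\<^sup>+x. H0 G k x (norm (grad u x)) \<partial>lebesgue)"
proof -
  obtain Du :: "real ^ 'n \<Rightarrow> (real ^ 'n) \<Rightarrow>\<^sub>L real" and L R M
    where Du: "\<And>x. (u has_derivative blinfun_apply (Du x)) (at x)" and L: "0 \<le> L" and R: "0 \<le> R"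
      and lip: "\<And>x y. \<bar>u x - u y\<bar> \<le> L * norm (x - y)" and supp: "\<And>x. R < norm x \<Longrightarrow> u x = 0"
    using C2_compact_support_bounds[OF u] by metis
  have uc: "continuous_on UNIV u"
    by (intro continuous_at_imp_continuous_on ballI has_derivative_continuous[OF Du])
  obtain C where C: "\<And>x y. G x y L \<le> C" using young_uniform_bound[OF Y H(1,3) L] by blast
  have C0: "0 \<le> C" using C[of 0 0] young_nonneg[OF Y L, of 0 0] by linarith
  define \<tau> where "\<tau> m z = norm z powr (S m / (1 - S m))" for m and z :: "real ^ 'n"
  define J where "J m x = ennreal (1 - S m) * near_density (S m) G u x" for m x
  define I where "I m x z = ennreal (G x (x + \<tau> m z *\<^sub>R z) (\<bar>u x - u (x + \<tau> m z *\<^sub>R z)\<bar> / \<tau> m z))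
      * ennreal (1 / norm z ^ CARD('n)) * indicator (cball 0 1) z" for m x z
  have JI: "J m x = (\<integral>\<^sup>+z. I m x z \<partial>lborel)" for m x
    unfolding J_def I_def \<tau>_def by (rule near_integral_dilated[OF Y H(2) uc S(2,3)])
  define w where "w z = ennreal C * (ennreal (norm z) * ennreal (1 / norm z ^ DIM(real ^ 'n)) * indicator (cball 0 1) z)"
    for z :: "real ^ 'n"
  have [measurable]: "cball (0 :: real ^ 'n) 1 \<in> sets borel" by simp
  have wm[measurable]: "w \<in> borel_measurable borel" unfolding w_def by measurable
  define B where "B = (\<integral>\<^sup>+z. w z \<partial>lborel)"
  have B: "B < top"
  proof -
    have "B = ennreal C * (\<integral>\<^sup>+z\<in>cball (0 :: real ^ 'n) 1. ennreal (norm z) * ennreal (1 / norm z ^ DIM(real ^ 'n)) \<partial>lborel)"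
      unfolding B_def w_def by (rule nn_integral_cmult) measurable
    also have "\<dots> < top"
      unfolding nn_integral_norm_power_ball by (intro ennreal_mult_less_top[THEN iffD2])
        (simp add: emeasure_cone_measure_finite)
    finally show ?thesis .
  qed
  have Iw: "I m x z \<le> w z" for m x z
  proof (cases "z \<noteq> 0 \<and> z \<in> cball 0 1")
    case True
    then have \<tau>: "0 < \<tau> m z" by (simp add: \<tau>_def)
    let ?t = "\<bar>u x - u (x + \<tau> m z *\<^sub>R z)\<bar> / \<tau> m z"
    have "?t \<le> norm z * L"
      using lip[of x "x + \<tau> m z *\<^sub>R z"] \<tau> by (simp add: divide_le_eq mult_ac)
    then have "G x (x + \<tau> m z *\<^sub>R z) ?t \<le> G x (x + \<tau> m z *\<^sub>R z) (norm z * L)"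
      using \<tau> by (intro young_mono[OF Y]) auto
    also have "\<dots> \<le> norm z * G x (x + \<tau> m z *\<^sub>R z) L"
      using True by (intro young_star_shaped[OF Y] L) auto
    also have "\<dots> \<le> C * norm z" using mult_left_mono[OF C norm_ge_zero] by (simp add: mult.commute)
    finally have "ennreal (G x (x + \<tau> m z *\<^sub>R z) ?t) \<le> ennreal C * ennreal (norm z)"
      using C0 by (simp add: ennreal_mult[symmetric] ennreal_leI)
    then show ?thesis
      unfolding I_def w_def by (simp add: mult.assoc[symmetric] mult_right_mono)
  next
    case False
    then show ?thesis by (auto simp: I_def w_def)
  qed
  have Im: "I m x \<in> borel_measurable borel" for m x
  proof -
    have \<tau>m[measurable]: "\<tau> m \<in> borel_measurable borel" unfolding \<tau>_def by measurable
    have um[measurable]: "u \<in> borel_measurable borel" using uc by (rule borel_measurable_continuous_onI)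
    have "(\<lambda>z. G x (x + \<tau> m z *\<^sub>R z) (\<bar>u x - u (x + \<tau> m z *\<^sub>R z)\<bar> / \<tau> m z)) \<in> borel_measurable borel"
    proof (rule borel_measurable_caratheodory_compose[where F="\<lambda>z. G x (x + \<tau> m z *\<^sub>R z)"])
      show "(\<lambda>z. G x (x + \<tau> m z *\<^sub>R z) t) \<in> borel_measurable borel" if "0 \<le> t" for t
      proof (rule measurable_compose[where f="\<lambda>z. x + \<tau> m z *\<^sub>R z" and N=borel])
        show "(\<lambda>y. G x y t) \<in> borel_measurable borel"
          using H(2) that by (intro borel_measurable_continuous_onI) (simp add: H2_def)
      qed measurable
      show "continuous_on {0..} (G x (x + \<tau> m z *\<^sub>R z))" for z by (rule young_continuous[OF Y])
    qed (measurable, simp add: \<tau>_def)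
    then show ?thesis unfolding I_def by measurable
  qed
  have "(\<lambda>m. J m x) \<longlonglongrightarrow> H0 G k x (norm (grad u x))" for x
  proof -
    define I' where "I' z = ennreal (G x x \<bar>grad u x \<bullet> z\<bar>) * ennreal (1 / norm z ^ CARD('n)) * indicator (cball 0 1) z" for z
    have Gm[measurable]: "(\<lambda>z. G x x \<bar>grad u x \<bullet> z\<bar>) \<in> borel_measurable borel"
      by (rule borel_measurable_young[OF Y]) auto
    have I'm: "I' \<in> borel_measurable borel" unfolding I'_def by measurable
    \<comment> \<open>On the unit sphere the dilation is trivial and the integrands do not converge.\<close>
    have sph: "AE z in lborel. z \<notin> sphere (0 :: real ^ 'n) 1"
      using negligible_sphere[of "0 :: real ^ 'n" 1]
      by (intro AE_not_in) (simp add: negligible_iff_null_sets null_sets_completion_iff)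
    have "AE z in lborel. (\<lambda>m. I m x z) \<longlonglongrightarrow> I' z"
      using sph
    proof eventually_elim
      case (elim z)
      show ?case
      proof (cases "z \<noteq> 0 \<and> z \<in> cball 0 1")
        case True
        then have z: "0 < norm z" "norm z < 1" using elim by auto
        have \<tau>0: "(\<lambda>m. \<tau> m z) \<longlonglongrightarrow> 0" unfolding \<tau>_def by (rule powr_sequence_tendsto_0[OF S z])
        have \<tau>pos: "0 < \<tau> m z" for m using z by (simp add: \<tau>_def)
        have "(\<lambda>m. G x (x + \<tau> m z *\<^sub>R z) (\<bar>u x - u (x + \<tau> m z *\<^sub>R z)\<bar> / \<tau> m z)) \<longlonglongrightarrow> G x x \<bar>grad u x \<bullet> z\<bar>"
        proof (rule young_tendsto[OF Y H])
          have "(\<lambda>m. x + \<tau> m z *\<^sub>R z) \<longlonglongrightarrow> x + 0 *\<^sub>R z" by (intro tendsto_intros \<tau>0)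
          then show "(\<lambda>m. x + \<tau> m z *\<^sub>R z) \<longlonglongrightarrow> x" by simp
          show "(\<lambda>m. \<bar>u x - u (x + \<tau> m z *\<^sub>R z)\<bar> / \<tau> m z) \<longlonglongrightarrow> \<bar>grad u x \<bullet> z\<bar>"
            unfolding grad_inner[OF Du] by (rule difference_quotient_tendsto[OF Du \<tau>0 \<tau>pos])
          show "0 \<le> \<bar>u x - u (x + \<tau> m z *\<^sub>R z)\<bar> / \<tau> m z" for m using \<tau>pos[of m] by simp
        qed
        then have "(\<lambda>m. ennreal (G x (x + \<tau> m z *\<^sub>R z) (\<bar>u x - u (x + \<tau> m z *\<^sub>R z)\<bar> / \<tau> m z)) * ennreal (1 / norm z ^ CARD('n)))
            \<longlonglongrightarrow> ennreal (G x x \<bar>grad u x \<bullet> z\<bar>) * ennreal (1 / norm z ^ CARD('n))"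
          by (intro tendsto_mult_ennreal tendsto_ennrealI tendsto_const) auto
        then show ?thesis using True by (simp add: I_def I'_def)
      next
        case False
        then show ?thesis by (auto simp: I_def I'_def)
      qed
    qed
    then have "(\<lambda>m. \<integral>\<^sup>+z. I m x z \<partial>lborel) \<longlonglongrightarrow> (\<integral>\<^sup>+z. I' z \<partial>lborel)"
      using B Iw Im I'm by (intro nn_integral_dominated_convergence[where w=w]) (auto simp: B_def)
    also have "(\<integral>\<^sup>+z. I' z \<partial>lborel) = H0 G k x (norm (grad u x))"
      unfolding I'_def by (rule H0_eq_ball_integral[OF Y])
    finally show ?thesis unfolding JI .
  qed
  moreover have Jm: "J m \<in> borel_measurable lebesgue" for m
    unfolding J_def by (intro borel_measurable_times_ennreal borel_measurable_const frac_energy_split(1)[OF Y uc])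
  moreover have "J m x \<le> B * indicator (cball 0 (R + 1)) x" for m x
  proof (cases "x \<in> cball 0 (R + 1)")
    case True
    then show ?thesis unfolding JI B_def by (simp add: nn_integral_mono Iw)
  next
    case False
    have "near_density (S m) G u x = (\<integral>\<^sup>+(y :: real ^ 'n). 0 \<partial>lborel)"
      unfolding near_density_def
    proof (intro nn_integral_cong)
      fix y
      have "frac_kernel (S m) G u x y = 0" if "y \<in> cball x 1"
      proof -
        have "norm x \<le> norm y + norm (x - y)" using norm_triangle_sub[of x y] by simp
        then have "R < norm x" "R < norm y" using that False by (auto simp: dist_norm)
        then show ?thesis using supp by (simp add: frac_kernel_def young_zero[OF Y])
      qed
      then show "ennreal (frac_kernel (S m) G u x y) * indicator (cball x 1) y = 0"
        by (auto split: split_indicator)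
    qed
    then show ?thesis unfolding J_def by simp
  qed
  ultimately have "(\<lambda>m. \<integral>\<^sup>+x. J m x \<partial>lebesgue) \<longlonglongrightarrow> (\<integral>\<^sup>+x. H0 G k x (norm (grad u x)) \<partial>lebesgue)"
  proof (intro nn_integral_dominated_convergence[where w="\<lambda>x. B * indicator (cball 0 (R + 1)) x"])
    show "(\<lambda>x. H0 G k x (norm (grad u x))) \<in> borel_measurable lebesgue"
      using \<open>\<And>x. (\<lambda>m. J m x) \<longlonglongrightarrow> H0 G k x (norm (grad u x))\<close> Jm by (rule borel_measurable_LIMSEQ_order)
    have "emeasure lborel (cball (0 :: real ^ 'n) (R + 1)) < top" using R by (simp add: emeasure_cball)
    then show "(\<integral>\<^sup>+x. B * indicator (cball (0 :: real ^ 'n) (R + 1)) x \<partial>lebesgue) < \<infinity>"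
      using B by (simp add: nn_integral_completion nn_integral_cmult_indicator ennreal_mult_less_top)
  qed (auto intro!: borel_measurable_times_ennreal borel_measurable_indicator)
  then show ?thesis unfolding J_def .
qed

section \<open>The energy far from the diagonal\<close>

lemma nn_integral_norm_power_outside_ball:
  "(\<integral>\<^sup>+z\<in>- cball (0::'a) 1. ennreal (norm z powr (- 1 / 2)) * ennreal (1 / norm z ^ DIM('a)) \<partial>lborel)
     \<le> 2 * emeasure (cone_measure :: 'a::euclidean_space measure) UNIV"
proof -
  have [measurable]: "cball (0 :: 'a) 1 \<in> sets borel" by simp
  have "(\<integral>\<^sup>+z\<in>- cball (0::'a) 1. ennreal (norm z powr (- 1 / 2)) * ennreal (1 / norm z ^ DIM('a)) \<partial>lborel)
    = (\<integral>\<^sup>+z. ennreal (norm z powr (- 1 / 2)) * indicator (- cball (0::'a) 1) z * ennreal (1 / norm z ^ DIM('a)) \<partial>lborel)"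
    by (simp add: mult_ac)
  also have "\<dots> = (\<integral>\<^sup>+w. (\<integral>\<^sup>+r\<in>{0<..}. ennreal (norm (r *\<^sub>R w) powr (- 1 / 2)) * indicator (- cball 0 1) (r *\<^sub>R w) * ennreal (1 / r) \<partial>lborel) \<partial>(cone_measure :: 'a measure))"
    by (rule nn_integral_polar_scale_invariant) measurable
  also have "\<dots> \<le> (\<integral>\<^sup>+w. 2 \<partial>(cone_measure :: 'a measure))"
  proof (rule nn_integral_mono_AE)
    show "AE w in (cone_measure :: 'a measure).
      (\<integral>\<^sup>+r\<in>{0<..}. ennreal (norm (r *\<^sub>R w) powr (- 1 / 2)) * indicator (- cball 0 1) (r *\<^sub>R w) * ennreal (1 / r) \<partial>lborel) \<le> 2"
      using AE_cone_measure_norm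
    proof eventually_elim
      case (elim w)
      have "(\<integral>\<^sup>+r\<in>{0<..}. ennreal (norm (r *\<^sub>R w) powr (- 1 / 2)) * indicator (- cball 0 1) (r *\<^sub>R w) * ennreal (1 / r) \<partial>lborel)
        \<le> (\<integral>\<^sup>+r. ennreal (r powr (- 3 / 2)) * indicator {1..} r \<partial>lborel)"
      proof (rule nn_integral_mono)
        fix r :: real
        have "ennreal (r powr (- 1 / 2)) * ennreal (1 / r) = ennreal (r powr (- 3 / 2))" if "0 < r"
        proof -
          have "r powr (- 1 / 2 - 1) = r powr (- 1 / 2) / r powr 1" by (rule powr_diff)
          moreover have "(- 1 / 2 - 1 :: real) = - 3 / 2" by simp
          ultimately have "r powr (- 1 / 2) * (1 / r) = r powr (- 3 / 2)" using that by simp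
          then show ?thesis using that by (simp add: ennreal_mult[symmetric])
        qed
        then show "ennreal (norm (r *\<^sub>R w) powr (- 1 / 2)) * indicator (- cball 0 1) (r *\<^sub>R w) * ennreal (1 / r) * indicator {0<..} r
          \<le> ennreal (r powr (- 3 / 2)) * indicator {1..} r"
          by (auto simp: elim split: split_indicator)
      qed
      also have "\<dots> = ennreal (0 - (- 2 * 1 powr (- 1 / 2)))"
      proof (rule nn_integral_FTC_atLeast[where F="\<lambda>r. - 2 * r powr (- 1 / 2)"])
        show "((\<lambda>r. - 2 * r powr (- 1 / 2)) has_real_derivative r powr (- 3 / 2)) (at r)" if "1 \<le> r" for r :: real
        proof -
          have "((\<lambda>r. - 2 * r powr (- 1 / 2)) has_real_derivative - 2 * (- 1 / 2 * r powr (- 1 / 2 - 1))) (at r)"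
            using that by (intro DERIV_cmult has_real_derivative_powr) simp
          moreover have "(- 1 / 2 - 1 :: real) = - 3 / 2" by simp
          ultimately show ?thesis by simp
        qed
        have "((\<lambda>r::real. r powr (- 1 / 2)) \<longlongrightarrow> 0) at_top"
          by (intro tendsto_neg_powr filterlim_ident) simp
        then show "((\<lambda>r::real. - 2 * r powr (- 1 / 2)) \<longlongrightarrow> 0) at_top"
          by (rule tendsto_mult_right_zero)
      qed auto
      finally show ?case by simp
    qed
  qed
  also have "\<dots> = 2 * emeasure (cone_measure :: 'a measure) UNIV" by simp
  finally show ?thesis .
qed

text \<open>
  Since \<open>G(x, y, t M) \<le> t G(x, y, M)\<close> for \<open>t \<le> 1\<close>, the integrand is at most a multiple of
  \<open>\<bar>x - y\<bar>\<^sup>-\<^sup>s\<^sup>-\<^sup>n\<close>, which is integrable away from the diagonal uniformly for \<open>s \<ge> 1 / 2\<close>; it vanishes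
  unless one of the points lies in a ball containing the support of \<open>u\<close>.
\<close>

lemma far_energy_bounded:
  fixes u :: "real ^ 'n \<Rightarrow> real"
  assumes Y: "generalized_young g G" and H: "H1 G" "H3 g G" and u: "C2_compact_support u"
  shows "\<exists>D<top. \<forall>s. 1 / 2 \<le> s \<longrightarrow>
    (\<integral>\<^sup>+x. far_density s G u x \<partial>lebesgue) \<le> D"
proof -
  obtain Du :: "real ^ 'n \<Rightarrow> (real ^ 'n) \<Rightarrow>\<^sub>L real" and L R M
    where R: "0 \<le> R" and M: "0 \<le> M" and supp: "\<And>x. R < norm x \<Longrightarrow> u x = 0" and uM: "\<And>x y. \<bar>u x - u y\<bar> \<le> M"
    using C2_compact_support_bounds[OF u] by metis
  obtain C where C: "\<And>x y. G x y M \<le> C" using young_uniform_bound[OF Y H M] by blast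
  have C0: "0 \<le> C" using C[of 0 0] young_nonneg[OF Y M, of 0 0] by linarith
  let ?K = "cball (0 :: real ^ 'n) R"
  have [measurable]: "?K \<in> sets borel" "cball (0 :: real ^ 'n) 1 \<in> sets borel" by auto
  define \<phi> where "\<phi> z = ennreal (norm z powr (- 1 / 2)) * ennreal (1 / norm z ^ DIM(real ^ 'n)) * indicator (- cball 0 1) z"
    for z :: "real ^ 'n"
  have \<phi>m[measurable]: "\<phi> \<in> borel_measurable borel" unfolding \<phi>_def by measurable
  \<comment> \<open>Needed to integrate over \<open>x\<close> first when it is \<open>y\<close> that lies in the ball.\<close>
  have \<phi>sym: "\<phi> (x - y) = \<phi> (y - x)" for x y
    unfolding \<phi>_def by (simp add: norm_minus_commute indicator_def)
  define E where "E = (\<integral>\<^sup>+z. \<phi> z \<partial>lborel)"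
  have E: "E < top"
  proof -
    have "E \<le> 2 * emeasure (cone_measure :: (real ^ 'n) measure) UNIV"
      unfolding E_def \<phi>_def by (rule nn_integral_norm_power_outside_ball)
    also have "\<dots> < top" using emeasure_cone_measure_finite[of "UNIV :: (real ^ 'n) set"] by (simp add: ennreal_mult_less_top)
    finally show ?thesis .
  qed
  have shift: "(\<integral>\<^sup>+y. \<phi> (y - x) \<partial>lborel) = E" for x
  proof -
    have "E = (\<integral>\<^sup>+h. \<phi> h \<partial>distr lborel borel ((+) (- x)))" by (simp add: lborel_distr_plus E_def)
    also have "\<dots> = (\<integral>\<^sup>+y. \<phi> (- x + y) \<partial>lborel)" by (intro nn_integral_distr) auto
    finally show ?thesis by simp
  qed
  have vol: "emeasure lborel ?K < top" using R by (simp add: emeasure_cball)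
  define D where "D = ennreal C * (emeasure lborel ?K * E + emeasure lborel ?K * E)"
  have mult3: "ennreal (a * (b * c)) = ennreal a * (ennreal b * ennreal c)"
    if "0 \<le> a" "0 \<le> b" "0 \<le> c" for a b c :: real
    using that by (simp add: ennreal_mult)
  have bound: "(\<integral>\<^sup>+x. far_density s G u x \<partial>lebesgue) \<le> D"
    if s: "1 / 2 \<le> s" for s
  proof -
    have pt: "ennreal (frac_kernel s G u x y) * indicator (- cball x 1) y
      \<le> ennreal C * (indicator ?K x * \<phi> (y - x) + indicator ?K y * \<phi> (y - x))" for x y
    proof (cases "y \<in> - cball x 1 \<and> (x \<in> ?K \<or> y \<in> ?K)")
      case True
      define r where "r = norm (x - y)"
      have r: "1 < r" using True by (simp add: r_def dist_norm)
      have t: "\<bar>u x - u y\<bar> / r powr s \<le> r powr (- s) * M"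
        using uM[of x y] r by (simp add: powr_minus divide_inverse mult.commute mult_left_mono)
      have "G x y (\<bar>u x - u y\<bar> / r powr s) \<le> G x y (r powr (- s) * M)"
        using t by (intro young_mono[OF Y]) auto
      also have "\<dots> \<le> r powr (- s) * G x y M"
        using r s powr_mono[of "- s" 0 r] by (intro young_star_shaped[OF Y] M) auto
      also have "\<dots> \<le> r powr (- 1 / 2) * C"
        using r s C young_nonneg[OF Y M] by (intro mult_mono powr_mono) auto
      finally have "frac_kernel s G u x y \<le> C * (r powr (- 1 / 2) * (1 / r ^ CARD('n)))"
        using r by (simp add: frac_kernel_def r_def[symmetric] divide_right_mono mult_ac)
      then have "ennreal (frac_kernel s G u x y) \<le> ennreal (C * (r powr (- 1 / 2) * (1 / r ^ CARD('n))))" by (rule ennreal_leI)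
      also have "\<dots> = ennreal C * (ennreal (r powr (- 1 / 2)) * ennreal (1 / r ^ CARD('n)))"
        by (rule mult3) (use C0 r in auto)
      also have "\<dots> = ennreal C * \<phi> (y - x)"
        using r by (simp add: \<phi>_def r_def norm_minus_commute)
      also have "\<dots> \<le> ennreal C * (indicator ?K x * \<phi> (y - x) + indicator ?K y * \<phi> (y - x))"
        using True by (intro mult_left_mono) (auto simp: indicator_def)
      finally show ?thesis using True by simp
    next
      case False
      have "frac_kernel s G u x y = 0" if "x \<notin> ?K" "y \<notin> ?K"
        using that supp[of x] supp[of y] by (simp add: frac_kernel_def young_zero[OF Y])
      then show ?thesis using False by (auto split: split_indicator)
    qed
    have "(\<integral>\<^sup>+x. far_density s G u x \<partial>lebesgue)
      \<le> (\<integral>\<^sup>+x. (\<integral>\<^sup>+y. ennreal C * (indicator ?K x * \<phi> (y - x) + indicator ?K y * \<phi> (y - x)) \<partial>lborel) \<partial>lborel)"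
      unfolding nn_integral_completion far_density_def by (intro nn_integral_mono pt)
    also have "\<dots> = ennreal C * ((\<integral>\<^sup>+x. (\<integral>\<^sup>+y. indicator ?K x * \<phi> (y - x) \<partial>lborel) \<partial>lborel)
        + (\<integral>\<^sup>+x. (\<integral>\<^sup>+y. indicator ?K y * \<phi> (y - x) \<partial>lborel) \<partial>lborel))"
      by (simp add: nn_integral_cmult nn_integral_add)
    also have "(\<integral>\<^sup>+x. (\<integral>\<^sup>+y. indicator ?K x * \<phi> (y - x) \<partial>lborel) \<partial>lborel) = emeasure lborel ?K * E"
      by (simp add: nn_integral_cmult shift nn_integral_multc)
    also have "(\<integral>\<^sup>+x. (\<integral>\<^sup>+y. indicator ?K y * \<phi> (y - x) \<partial>lborel) \<partial>lborel)
        = (\<integral>\<^sup>+y. (\<integral>\<^sup>+x. indicator ?K y * \<phi> (y - x) \<partial>lborel) \<partial>lborel)"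
      by (rule lborel_pair.Fubini'[symmetric]) measurable
    also have "\<dots> = emeasure lborel ?K * E"
      by (subst \<phi>sym) (simp add: nn_integral_cmult shift nn_integral_multc)
    finally show ?thesis unfolding D_def .
  qed
  have "D < top" unfolding D_def using E vol by (simp add: ennreal_mult_less_top)
  then show ?thesis using bound by blast
qed

section \<open>Convergence of the energies\<close>

theorem theorem3p3:
  fixes g G :: "real ^ 'n \<Rightarrow> real ^ 'n \<Rightarrow> real \<Rightarrow> real"
    and u :: "real ^ 'n \<Rightarrow> real"
    and k :: 'n
  assumes "generalized_young g G"
    and "H1 G" and "H2 G" and "H3 g G"
    and "C2_compact_support u"
  shows "((\<lambda>s. ennreal (1 - s) * frac_energy s G u)
           \<longlongrightarrow> (\<integral>\<^sup>+x. H0 G k x (norm (grad u x)) \<partial>lebesgue)) (at_left 1)"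
proof (rule tendsto_at_left_sequentially[where b="1 / 2"])
  fix S :: "nat \<Rightarrow> real"
  assume S1: "\<And>m. S m < 1" and S2: "\<And>m. 1 / 2 < S m" and S: "S \<longlonglongrightarrow> 1"
  have S0: "0 < S m" for m using S2[of m] by simp
  obtain Du :: "real ^ 'n \<Rightarrow> (real ^ 'n) \<Rightarrow>\<^sub>L real"
    where Du: "\<And>x. (u has_derivative blinfun_apply (Du x)) (at x)"
    using C2_compact_support_bounds[OF assms(5)] by metis
  have uc: "continuous_on UNIV u"
    by (intro continuous_at_imp_continuous_on ballI has_derivative_continuous[OF Du])
  obtain D where D1: "D < top" and D2: "\<And>s. 1 / 2 \<le> s \<Longrightarrow>
      (\<integral>\<^sup>+x. far_density s G u x \<partial>lebesgue) \<le> D"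
    using far_energy_bounded[OF assms(1,2,4,5)] by blast
  have D: "(\<integral>\<^sup>+x. far_density (S m) G u x \<partial>lebesgue) \<le> D" for m
    by (rule D2[OF less_imp_le[OF S2]])
  have "(\<lambda>m. ennreal (1 - S m) * (\<integral>\<^sup>+x. near_density (S m) G u x \<partial>lebesgue)) \<longlonglongrightarrow> (\<integral>\<^sup>+x. H0 G k x (norm (grad u x)) \<partial>lebesgue)"
    using near_energy_tendsto[OF assms S S0 S1, of k]
    by (simp add: nn_integral_cmult frac_energy_split(1)[OF assms(1) uc])
  moreover have "(\<lambda>m. ennreal (1 - S m) * (\<integral>\<^sup>+x. far_density (S m) G u x \<partial>lebesgue)) \<longlonglongrightarrow> 0"
  proof (rule tendsto_sandwich[where f="\<lambda>_. 0" and h="\<lambda>m. ennreal (1 - S m) * D"])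
    have "(\<lambda>m. 1 - S m) \<longlonglongrightarrow> 1 - 1" by (intro tendsto_intros S)
    then have "(\<lambda>m. ennreal (1 - S m) * D) \<longlonglongrightarrow> ennreal 0 * D"
      using D1 by (intro tendsto_mult_ennreal tendsto_ennrealI tendsto_const) auto
    then show "(\<lambda>m. ennreal (1 - S m) * D) \<longlonglongrightarrow> 0" by simp
    show "\<forall>\<^sub>F m in sequentially. ennreal (1 - S m) * (\<integral>\<^sup>+x. far_density (S m) G u x \<partial>lebesgue) \<le> ennreal (1 - S m) * D"
      by (intro always_eventually allI mult_left_mono D) simp
  qed auto
  ultimately have "(\<lambda>m. ennreal (1 - S m) * (\<integral>\<^sup>+x. near_density (S m) G u x \<partial>lebesgue) + ennreal (1 - S m) * (\<integral>\<^sup>+x. far_density (S m) G u x \<partial>lebesgue))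
      \<longlonglongrightarrow> (\<integral>\<^sup>+x. H0 G k x (norm (grad u x)) \<partial>lebesgue) + 0" by (rule tendsto_add)
  then show "(\<lambda>m. ennreal (1 - S m) * frac_energy (S m) G u) \<longlonglongrightarrow> (\<integral>\<^sup>+x. H0 G k x (norm (grad u x)) \<partial>lebesgue)"
    by (simp add: frac_energy_split(2)[OF assms(1) uc] distrib_left)
qed simp

end
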